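(* Let $\mu$ be a probability measure on $\mathbb{R}^d$ with a Riemann-integrable density $p(x)$ such that $p(x)\le C(1+\|x\|^2)^{-(d+3)/2}$ for some constant $C$. Then $$\lambda_i(K^{\mathrm{NT}};\mathbb{R}^d,d\mu)\asymp i^{-\frac{d+1}{d}}.$$
   Context: Let $\kappa_0(u)=\frac1\pi(\pi-\arccos u)$ and $\kappa_1(u)=\frac1\pi\big[\sqrt{1-u^2}+u(\pi-\arccos u)\big]$; $\kappa_1^{(r)}$ is the $r$-fold composition ($\kappa_1^{(0)}(u)=u$). Fix $L\ge2$. For $x\in\mathbb{R}^d$ let $\tilde x=(x,1)\in\mathbb{R}^{d+1}$ and $\bar u=\langle\tilde x,\tilde x'\rangle/(\|\tilde x\|\|\tilde x'\|)$. Define $K^{\mathrm{NT}}(x,x')=\|\tilde x\|\|\tilde x'\|\sum_{r=0}^{L}\kappa_1^{(r)}(\bar u)\prod_{s=r}^{L-1}\kappa_0(\kappa_1^{(s)}(\bar u))+1$ (empty product $=1$). $\lambda_i(k;\mathbb{R}^d,d\mu)$ is the $i$-th largest eigenvalue (with multiplicity) of the integral operator $(Tf)(x)=\int k(x,x')f(x')\,d\mu(x')$ on $L^2(\mathbb{R}^d,d\mu)$. $a_i\asymp b_i$ means $c\,b_i\le a_i\le C\,b_i$ for positive constants. *)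

theory Defs
  imports "HOL-Analysis.Analysis" "HOL-Probability.Probability"
begin

definition kappa0 :: "real \<Rightarrow> real" where
  "kappa0 u = (pi - arccos u) / pi"

definition kappa1 :: "real \<Rightarrow> real" where
  "kappa1 u = (sqrt (1 - u\<^sup>2) + u * (pi - arccos u)) / pi"

definition NTK :: "nat \<Rightarrow> 'a::euclidean_space \<Rightarrow> 'a \<Rightarrow> real" where
  "NTK L x x' =
    (let nx = norm (x, 1::real); nx' = norm (x', 1::real);
         u = inner (x, 1::real) (x', 1::real) / (nx * nx')
     in nx * nx' * (\<Sum>r = 0..L. (kappa1 ^^ r) u * (\<Prod>s\<in>{r..<L}. kappa0 ((kappa1 ^^ s) u))) + 1)"

definition riemann_integrable_on :: "('a::euclidean_space \<Rightarrow> real) \<Rightarrow> 'a set \<Rightarrow> bool" where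
  "riemann_integrable_on f S \<longleftrightarrow>
    (\<exists>I. \<forall>e>0. \<exists>\<delta>>0. \<forall>D. D tagged_division_of S \<and> (\<lambda>x. ball x \<delta>) fine D \<longrightarrow>
        \<bar>(\<Sum>(x, K)\<in>D. Henstock_Kurzweil_Integration.content K * f x) - I\<bar> < e)"

text \<open>i-th largest eigenvalue (counted with multiplicity, i >= 1) of the integral operator
  (T f)(x) = integral of k(x,y) f(y) dM(y) on L2(M): the supremum of the t > 0 such that there are
  i eigenfunctions in L2(M), linearly independent modulo M-a.e. equality, with eigenvalues >= t
  (0 if there are fewer than i positive eigenvalues).\<close>
definition int_op_eigenvalue :: "('a \<Rightarrow> 'a \<Rightarrow> real) \<Rightarrow> 'a measure \<Rightarrow> nat \<Rightarrow> real" where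
  "int_op_eigenvalue k M i =
    (let S = {t. t > 0 \<and> (\<exists>(f :: nat \<Rightarrow> 'a \<Rightarrow> real) (lam :: nat \<Rightarrow> real).
            (\<forall>j<i. f j \<in> borel_measurable M \<and> integrable M (\<lambda>x. (f j x)\<^sup>2) \<and> lam j \<ge> t \<and>
               (AE x in M. integrable M (\<lambda>y. k x y * f j y) \<and>
                           (\<integral>y. k x y * f j y \<partial>M) = lam j * f j x)) \<and>
            (\<forall>c :: nat \<Rightarrow> real. (AE x in M. (\<Sum>j<i. c j * f j x) = 0) \<longrightarrow> (\<forall>j<i. c j = 0)))}
     in if S = {} then 0 else Sup S)"

end

(* With w(x) = |(x,1)| and xh = (x,1)/w(x) the kernel is w(x) w(y) g(<xh,yh>) + 1, where g is a power
   series with coefficients a_n >= 0. Hence its quadratic form is the sum over n of a_n times a finite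
   sum of squares of coefficients against tensor-power features, plus a rank one term. No spherical
   harmonics are needed; only two properties of g enter.

   Upper bound: g(1) - g(u) <= C sqrt(1 - u). Divide the sphere of directions into O(q^d) cells of
   diameter O(1/q). On eigenfunction combinations orthogonal to the constants and to w on each cell,
   every feature may be replaced by its difference to its value at a representative of the cell, and
   Bessel's inequality bounds the trace of the form by C/q. So about q^d further eigenvalues have sum
   O(1/q), that is, the eigenvalue of index about q^d is O(q^-(d+1)).

   Lower bound: a_(2k) >= c k^(-3/2), because of the arcsine singularity of kappa0 at u = 1. A Riemann
   integrable density is bounded below by a positive constant on some cube. Place m^d small cubes
   there. For k between A m^2 and 2 A m^2 the kernel <xh,yh>^(2k) is close to 1 within one cube and
   sums to a small number over different cubes, so by diagonal dominance the form is at least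
   c m^-(d+1) on the span of the normalised indicators.

   Both bounds are turned into statements on eigenvalues by constructing eigenfunctions as maximisers
   of the form on orthogonal complements. *)
theory Submission
  imports Defs "HOL-Complex_Analysis.Great_Picard"
begin

section \<open>Power series with nonnegative coefficients\<close>

text \<open>Why the two rates meet: both come from the singularity of type sqrt(1 - u) of the
  profile at u = 1. On the upper side it bounds the gap of the profile over a cell of diameter 1/q
  by a multiple of 1/q. On the lower side about m^2 coefficients of size m^-3 add up to 1/m, while a
  cube of side 1/m has mass at least of order m^-d. The space R^d is not compact, but its directions
  lie on a compact sphere: the cells are drawn there, and the weight w is moved into the measure w^2
  dmu. The decay of the density makes that measure finite. Eigenvalues are defined as suprema of
  thresholds t admitting i eigenfunctions that are independent modulo null sets; neither
  orthogonality nor existence is given. Hence both halves of the min-max principle are proved for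
  thresholds: independent eigenfunctions with eigenvalues >= t yield orthonormal test functions with
  form >= t, and a finite-dimensional space on which the form is >= t yields eigenfunctions.\<close>

definition nonneg_powser :: "(nat \<Rightarrow> real) \<Rightarrow> (real \<Rightarrow> real) \<Rightarrow> bool" where
  "nonneg_powser a f \<longleftrightarrow> (\<forall>n. 0 \<le> a n) \<and> (\<forall>u. \<bar>u\<bar> \<le> 1 \<longrightarrow> (\<lambda>n. a n * u ^ n) sums f u)"

lemma nonneg_powser_nonneg: "nonneg_powser a f \<Longrightarrow> 0 \<le> a n"
  by (simp add: nonneg_powser_def)

lemma nonneg_powser_sums: "nonneg_powser a f \<Longrightarrow> \<bar>u\<bar> \<le> 1 \<Longrightarrow> (\<lambda>n. a n * u ^ n) sums f u"
  by (simp add: nonneg_powser_def)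

lemma nonneg_powser_sums_one: "nonneg_powser a f \<Longrightarrow> a sums f 1"
  using nonneg_powser_sums[of a f 1] by simp

lemma nonneg_powser_abs_le:
  assumes "nonneg_powser a f" "\<bar>u\<bar> \<le> 1"
  shows "\<bar>f u\<bar> \<le> f 1"
proof -
  have le: "\<bar>a n * u ^ n\<bar> \<le> a n" for n
    using assms nonneg_powser_nonneg[OF assms(1), of n] power_le_one[of "\<bar>u\<bar>" n]
    by (simp add: abs_mult power_abs mult_left_le)
  have s: "summable (\<lambda>n. \<bar>a n * u ^ n\<bar>)"
    by (rule summable_comparison_test[OF _ sums_summable[OF nonneg_powser_sums_one[OF assms(1)]]])
      (use le in auto)
  have "\<bar>f u\<bar> = \<bar>\<Sum>n. a n * u ^ n\<bar>"
    using nonneg_powser_sums[OF assms] by (simp add: sums_iff)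
  also have "\<dots> \<le> (\<Sum>n. \<bar>a n * u ^ n\<bar>)" by (rule summable_rabs[OF s])
  also have "\<dots> \<le> (\<Sum>n. a n)"
    by (rule suminf_le[OF le s]) (use nonneg_powser_sums_one[OF assms(1)] in \<open>simp add: sums_iff\<close>)
  finally show ?thesis using nonneg_powser_sums_one[OF assms(1)] by (simp add: sums_iff)
qed

lemma nonneg_powser_one_nonneg: "nonneg_powser a f \<Longrightarrow> 0 \<le> f 1"
  using nonneg_powser_abs_le[of a f 0] abs_ge_zero order_trans by fastforce

lemma nonneg_powser_zero: "nonneg_powser a f \<Longrightarrow> a 0 = f 0"
  using nonneg_powser_sums[of a f 0] powser_sums_zero[of a] sums_unique2 by fastforce

lemma continuous_on_powser_cball:
  fixes a :: "nat \<Rightarrow> real"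
  assumes "summable (\<lambda>n. \<bar>a n\<bar>)"
  shows "continuous_on {-1..1} (\<lambda>u. \<Sum>n. a n * u ^ n)"
proof -
  have "uniform_limit {-1..1} (\<lambda>N u. \<Sum>n<N. a n * u ^ n) (\<lambda>u. \<Sum>n. a n * u ^ n) sequentially"
  proof (rule Weierstrass_m_test[OF _ assms])
    fix n and u :: real assume "u \<in> {-1..1}"
    then have "\<bar>u\<bar> ^ n \<le> 1" by (intro power_le_one) auto
    then show "norm (a n * u ^ n) \<le> \<bar>a n\<bar>"
      by (simp add: abs_mult power_abs mult_left_le)
  qed
  then show ?thesis
    by (rule uniform_limit_theorem[rotated]) (auto intro!: continuous_intros always_eventually)
qed

lemma nonneg_powser_continuous:
  assumes "nonneg_powser a f"
  shows "continuous_on {-1..1} f"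
proof -
  have "continuous_on {-1..1} (\<lambda>u. \<Sum>n. a n * u ^ n)"
    using nonneg_powser_nonneg[OF assms] nonneg_powser_sums_one[OF assms]
    by (intro continuous_on_powser_cball) (simp add: sums_iff)
  then show ?thesis
    by (rule continuous_on_eq) (use nonneg_powser_sums[OF assms] in \<open>auto simp: sums_iff\<close>)
qed

lemma nonneg_powser_const: "0 \<le> c \<Longrightarrow> nonneg_powser (\<lambda>n. if n = 0 then c else 0) (\<lambda>u. c)"
  unfolding nonneg_powser_def
proof (intro conjI allI impI)
  fix u :: real
  have "(\<lambda>n. if n = 0 then c else 0) sums c" using sums_single[of 0 "\<lambda>_. c"] by simp
  then show "(\<lambda>n. (if n = 0 then c else 0) * u ^ n) sums c"
    by (rule sums_cong[THEN iffD1, rotated]) auto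
qed auto

lemma nonneg_powser_ident: "nonneg_powser (\<lambda>n. if n = 1 then 1 else 0) (\<lambda>u. u)"
  unfolding nonneg_powser_def
proof (intro conjI allI impI)
  fix u :: real
  have "(\<lambda>n. if n = 1 then u ^ n else 0) sums (u ^ 1)" by (rule sums_single)
  then show "(\<lambda>n. (if n = 1 then 1 else 0) * u ^ n) sums u"
    by (simp add: if_distrib[of "\<lambda>z. z * _"] cong: if_cong)
qed auto

lemma nonneg_powser_add:
  "nonneg_powser a f \<Longrightarrow> nonneg_powser b g \<Longrightarrow> nonneg_powser (\<lambda>n. a n + b n) (\<lambda>u. f u + g u)"
  by (auto simp: nonneg_powser_def distrib_right intro: sums_add)

lemma nonneg_powser_cmult:
  "nonneg_powser a f \<Longrightarrow> 0 \<le> c \<Longrightarrow> nonneg_powser (\<lambda>n. c * a n) (\<lambda>u. c * f u)"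
  by (auto simp: nonneg_powser_def mult.assoc intro: sums_mult)

lemma nonneg_powser_mult:
  assumes "nonneg_powser a f" "nonneg_powser b g"
  shows "nonneg_powser (\<lambda>n. \<Sum>i\<le>n. a i * b (n - i)) (\<lambda>u. f u * g u)"
  unfolding nonneg_powser_def
proof (intro conjI allI impI)
  fix n show "0 \<le> (\<Sum>i\<le>n. a i * b (n - i))"
    using assms by (intro sum_nonneg mult_nonneg_nonneg) (auto simp: nonneg_powser_def)
next
  fix u :: real assume u: "\<bar>u\<bar> \<le> 1"
  have s: "summable (\<lambda>n. norm (c n * u ^ n))" if "nonneg_powser c h" for c h
  proof -
    have "(\<lambda>n. c n * \<bar>u\<bar> ^ n) sums h \<bar>u\<bar>" using nonneg_powser_sums[OF that] u by simp
    then show ?thesis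
      using nonneg_powser_nonneg[OF that] by (simp add: abs_mult power_abs sums_iff)
  qed
  have "(\<lambda>n. \<Sum>i\<le>n. (a i * u ^ i) * (b (n - i) * u ^ (n - i))) sums
      ((\<Sum>n. a n * u ^ n) * (\<Sum>n. b n * u ^ n))"
    by (rule Cauchy_product_sums) (use s assms in auto)
  moreover have "(\<Sum>i\<le>n. (a i * u ^ i) * (b (n - i) * u ^ (n - i))) = (\<Sum>i\<le>n. a i * b (n - i)) * u ^ n" for n
    unfolding sum_distrib_right
  proof (rule sum.cong)
    fix i assume "i \<in> {..n}"
    then have "u ^ n = u ^ i * u ^ (n - i)" by (simp flip: power_add)
    then show "a i * u ^ i * (b (n - i) * u ^ (n - i)) = a i * b (n - i) * u ^ n" by simp
  qed simp
  ultimately show "(\<lambda>n. (\<Sum>i\<le>n. a i * b (n - i)) * u ^ n) sums (f u * g u)"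
    using nonneg_powser_sums[OF assms(1) u] nonneg_powser_sums[OF assms(2) u] by (simp add: sums_iff)
qed

text \<open>Of the Cauchy product only the term \<open>i = n\<close> is kept. In this way a lower
  bound on coefficients survives multiplication by a factor that is positive at 0.\<close>

lemma nonneg_powser_mult_coeff_ge:
  assumes "nonneg_powser a f" "nonneg_powser b g"
  shows "a n * g 0 \<le> (\<Sum>i\<le>n. a i * b (n - i))"
proof -
  have "a n * b (n - n) \<le> (\<Sum>i\<le>n. a i * b (n - i))"
    using assms by (intro member_le_sum mult_nonneg_nonneg) (auto simp: nonneg_powser_def)
  then show ?thesis using nonneg_powser_zero[OF assms(2)] by simp
qed

lemma ex_nonneg_powser_power:
  assumes "nonneg_powser b g"
  shows "\<exists>c. nonneg_powser c (\<lambda>u. g u ^ n)"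
proof (induction n)
  case 0
  show ?case using nonneg_powser_const[of 1] by auto
next
  case (Suc n)
  then show ?case using nonneg_powser_mult[OF assms] by auto
qed

text \<open>Substituting the series of the powers of \<open>g\<close> into that of \<open>f\<close>
  gives a double series, and summing it by columns gives the new coefficients. The condition
  \<open>g 1 \<le> 1\<close> keeps the values of \<open>g\<close> in the domain of \<open>f\<close>
  and bounds each coefficient of a power of \<open>g\<close> by 1, so that the column sums
  converge.\<close>

lemma ex_nonneg_powser_compose:
  assumes f: "nonneg_powser a f" and g: "nonneg_powser b g" and g1: "g 1 \<le> 1"
  shows "\<exists>c. nonneg_powser c (\<lambda>u. f (g u))"
proof -
  obtain B where B: "\<And>n. nonneg_powser (B n) (\<lambda>u. g u ^ n)"
    using ex_nonneg_powser_power[OF g] by metis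
  have g_le: "\<bar>g u\<bar> \<le> 1" if "\<bar>u\<bar> \<le> 1" for u
    using nonneg_powser_abs_le[OF g that] g1 by simp
  define c where "c m = (\<Sum>n. a n * B n m)" for m
  have a0: "0 \<le> a n" and B0: "0 \<le> B n m" for n m
    using f B by (auto simp: nonneg_powser_def)
  have summable_B: "summable (\<lambda>n. a n * B n m)" for m
  proof -
    have "a n * B n m \<le> a n" for n
    proof -
      have "B n m \<le> (\<Sum>m. B n m)"
        using sum_le_suminf[OF sums_summable[OF nonneg_powser_sums_one[OF B[of n]]], of "{m}"] B0 by auto
      also have "\<dots> = g 1 ^ n" using nonneg_powser_sums_one[OF B[of n]] by (simp add: sums_iff)
      also have "\<dots> \<le> 1" using g1 nonneg_powser_one_nonneg[OF g] by (intro power_le_one)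
      finally show ?thesis using a0 by (simp add: mult_left_le)
    qed
    then have "norm (a n * B n m) \<le> a n" for n using a0 B0 by (simp add: abs_mult)
    then show ?thesis
      by (intro summable_comparison_test[OF _ sums_summable[OF nonneg_powser_sums_one[OF f]]]) blast
  qed
  have hs: "((\<lambda>m. c m * u ^ m) has_sum f (g u)) UNIV" if u: "\<bar>u\<bar> \<le> 1" for u
  proof -
    define h where "h v = (\<lambda>(n, m). a n * B n m * v ^ m)" for v :: real
    have norm_h: "norm (h u p) = h \<bar>u\<bar> p" for p
      using a0 B0 by (auto simp: h_def abs_mult power_abs split: prod.splits)
    have row: "((\<lambda>m. h v (n, m)) has_sum a n * g v ^ n) UNIV" if v: "\<bar>v\<bar> \<le> 1" for v n
    proof -
      have s: "(\<lambda>m. h w (n, m)) sums (a n * g w ^ n)" if "\<bar>w\<bar> \<le> 1" for w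
        using sums_mult[OF nonneg_powser_sums[OF B that], of "a n"] by (simp add: h_def mult.assoc)
      have "norm (h v (n, m)) = h \<bar>v\<bar> (n, m)" for m
        using a0 B0 by (auto simp: h_def abs_mult power_abs)
      then have "summable (\<lambda>m. norm (h v (n, m)))" using s[of "\<bar>v\<bar>"] v by (simp add: sums_iff)
      then show ?thesis using s[OF v] by (intro norm_summable_imp_has_sum)
    qed
    \<comment> \<open>At the point \<open>\<bar>u\<bar>\<close> all terms are nonnegative and the
      row sums \<open>a n * g \<bar>u\<bar> ^ n\<close> add up to
      \<open>f (g \<bar>u\<bar>)\<close>; absolute summability then permits the exchange of rows and
      columns.\<close>
    have "(\<lambda>p. norm (h u p)) summable_on (UNIV \<times> UNIV)"
      unfolding Infinite_Sum.abs_summable_on_Sigma_iff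
    proof (intro conjI ballI)
      fix n
      show "(\<lambda>m. norm (h u (n, m))) summable_on UNIV"
        unfolding norm_h using row[of "\<bar>u\<bar>" n] u by (auto simp: summable_on_def)
    next
      have "(\<Sum>\<^sub>\<infinity>m. norm (h u (n, m))) = a n * g \<bar>u\<bar> ^ n" for n
        unfolding norm_h using row[of "\<bar>u\<bar>" n] u by (simp add: infsumI)
      moreover have "(\<lambda>n. norm (a n * g \<bar>u\<bar> ^ n)) summable_on UNIV"
      proof -
        have "g \<bar>u\<bar> \<ge> 0"
          using suminf_nonneg[OF sums_summable[OF nonneg_powser_sums[OF g, of "\<bar>u\<bar>"]]]
            nonneg_powser_sums[OF g, of "\<bar>u\<bar>"] u nonneg_powser_nonneg[OF g] by (simp add: sums_iff)
        moreover have "(\<lambda>n. a n * g \<bar>u\<bar> ^ n) sums f (g \<bar>u\<bar>)"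
          using nonneg_powser_sums[OF f g_le[of "\<bar>u\<bar>"]] u by simp
        ultimately show ?thesis
          using a0 by (subst summable_on_UNIV_nonneg_real_iff) (auto simp: sums_iff abs_mult power_abs)
      qed
      ultimately show "(\<lambda>n. norm (\<Sum>\<^sub>\<infinity>m. norm (h u (n, m)))) summable_on UNIV" by simp
    qed
    then have sm: "(h u) summable_on (UNIV \<times> UNIV)" by (rule abs_summable_summable)
    then obtain S where S: "((h u) has_sum S) (UNIV \<times> UNIV)" by (auto simp: summable_on_def)
    have "((\<lambda>n. a n * g u ^ n) has_sum S) UNIV"
      by (rule has_sum_SigmaD[OF S]) (use row[OF u] in auto)
    moreover have "(\<lambda>n. a n * g u ^ n) sums f (g u)" by (rule nonneg_powser_sums[OF f g_le[OF u]])
    ultimately have S_eq: "S = f (g u)" using has_sum_imp_sums sums_unique2 by blast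
    have S': "((\<lambda>(m, n). h u (n, m)) has_sum S) (UNIV \<times> UNIV)"
      using S has_sum_swap by blast
    have col: "((\<lambda>n. (\<lambda>(m, n). h u (n, m)) (m, n)) has_sum c m * u ^ m) UNIV" for m
    proof -
      have "((\<lambda>n. a n * B n m) has_sum c m) UNIV"
        unfolding c_def using a0 B0 summable_B by (intro sums_nonneg_imp_has_sum) auto
      then show ?thesis by (auto simp: h_def intro!: has_sum_cmult_left)
    qed
    show ?thesis
      using has_sum_SigmaD[OF S' col] S_eq by simp
  qed
  have "0 \<le> c m" for m
    unfolding c_def using a0 B0 by (intro suminf_nonneg summable_B) auto
  then show ?thesis using hs has_sum_imp_sums unfolding nonneg_powser_def by blast
qed

text \<open>The derivative may be unbounded at the endpoints, as for arcsin, so it is expanded on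
  the open interval only. Continuity of \<open>F\<close> and the signs of the coefficients carry the
  integrated series to the closed interval: bounded partial sums give absolute convergence there,
  and the two continuous functions agree on a dense part.\<close>

lemma nonneg_powser_antideriv:
  assumes a: "\<And>n. 0 \<le> a n" and s: "\<And>u. \<bar>u\<bar> < 1 \<Longrightarrow> (\<lambda>n. a n * u ^ n) sums f u"
    and cont: "continuous_on {-1..1} F"
    and deriv: "\<And>u. \<bar>u\<bar> < 1 \<Longrightarrow> (F has_real_derivative f u) (at u)"
    and F0: "0 \<le> F 0"
  shows "nonneg_powser (case_nat (F 0) (\<lambda>n. a n / Suc n)) F"
proof -
  define b where "b = case_nat (F 0) (\<lambda>n. a n / Suc n)"
  have b0: "0 \<le> b n" for n using a F0 by (auto simp: b_def split: nat.split)
  define G where "G u = (\<Sum>n. a n / Suc n * u ^ Suc n)" for u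
  have a_summable: "summable (\<lambda>n. a n * u ^ n)" if "\<bar>u\<bar> < 1" for u
    using s[OF that] by (simp add: sums_iff)
  have G_deriv: "(G has_real_derivative f u) (at u)" if u: "\<bar>u\<bar> < 1" for u
  proof -
    have "DERIV (\<lambda>x. \<Sum>n. a n / Suc n * x ^ Suc n) u :> (\<Sum>n. a n / Suc n * real (Suc n) * u ^ n)"
    proof (rule DERIV_power_series')
      show "summable (\<lambda>n. a n / real (Suc n) * real (Suc n) * x ^ n)" if "x \<in> {-1<..<1}" for x
        using a_summable[of x] that by auto
    qed (use u in auto)
    then show ?thesis using s[OF u] by (simp add: G_def[abs_def] sums_iff)
  qed
  have FG: "F u = F 0 + G u" if u: "\<bar>u\<bar> < 1" for u
  proof -
    have "\<exists>c. \<forall>x\<in>{-1<..<1}. F x - G x = c"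
    proof (rule has_field_derivative_zero_constant)
      fix x :: real assume "x \<in> {-1<..<1}"
      then have "((\<lambda>x. F x - G x) has_real_derivative f x - f x) (at x)"
        by (intro derivative_intros deriv G_deriv) auto
      then show "((\<lambda>x. F x - G x) has_real_derivative 0) (at x within {-1<..<1})"
        by (simp add: has_field_derivative_at_within)
    qed auto
    then have "F u - G u = F 0 - G 0" using u by (metis abs_less_iff greaterThanLessThan_iff minus_less_iff zero_less_one neg_less_0_iff_less)
    then show ?thesis by (simp add: G_def)
  qed
  have b_sums: "(\<lambda>n. b n * u ^ n) sums F u" if u: "\<bar>u\<bar> < 1" for u
  proof -
    have "summable (\<lambda>n. a n / Suc n * u ^ Suc n)"
    proof (rule summable_comparison_test, intro exI allI impI)
      fix n
      have "\<bar>a n / Suc n * u ^ Suc n\<bar> = a n * \<bar>u\<bar> ^ n * (\<bar>u\<bar> / Suc n)"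
        using a[of n] by (simp add: abs_mult power_abs)
      also have "\<dots> \<le> a n * \<bar>u\<bar> ^ n * 1"
        using a[of n] u by (intro mult_left_mono) (auto simp: divide_le_eq)
      finally show "norm (a n / Suc n * u ^ Suc n) \<le> a n * \<bar>u\<bar> ^ n" by simp
    qed (use a_summable[of "\<bar>u\<bar>"] u in auto)
    then have "(\<lambda>n. b (Suc n) * u ^ Suc n) sums G u"
      unfolding b_def G_def nat.case by (rule summable_sums)
    then have "(\<lambda>n. b n * u ^ n) sums (G u + b 0 * u ^ 0)"
      by (subst (asm) sums_Suc_iff) simp
    then show ?thesis using FG[OF u] by (simp add: b_def add.commute)
  qed
  \<comment> \<open>For 0 < u < 1 a partial sum is at most \<open>F u\<close>; letting u tend to 1
    from the left bounds the partial sums of the coefficients themselves.\<close>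
  have partial: "(\<Sum>n<N. b n) \<le> F 1" for N
  proof -
    have F_lim: "(F \<longlongrightarrow> F 1) (at_left 1)"
    proof -
      have "(F \<longlongrightarrow> F 1) (at 1 within {-1..1})" using cont by (auto simp: continuous_on_def)
      then show ?thesis by (simp add: at_within_Icc_at_left)
    qed
    have "((\<lambda>u. \<Sum>n<N. b n * u ^ n) \<longlongrightarrow> (\<Sum>n<N. b n * 1 ^ n)) (at_left 1)"
      by (intro tendsto_intros)
    moreover have "eventually (\<lambda>u. (\<Sum>n<N. b n * u ^ n) \<le> F u) (at_left 1)"
    proof (rule eventually_mono)
      show "eventually (\<lambda>u::real. u \<in> {0<..<1}) (at_left 1)" by (rule eventually_at_left_real) simp
      fix u :: real assume u: "u \<in> {0<..<1}"
      then have "(\<lambda>n. b n * u ^ n) sums F u" by (intro b_sums) auto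
      then show "(\<Sum>n<N. b n * u ^ n) \<le> F u"
        using b0 u sum_le_suminf[of "\<lambda>n. b n * u ^ n" "{..<N}"] by (auto simp: sums_iff)
    qed
    ultimately show ?thesis using tendsto_le[OF _ F_lim] by fastforce
  qed
  have "summable (\<lambda>n. \<bar>b n\<bar>)"
    using b0 partial by (intro bounded_imp_summable[of _ "F 1"]) (simp_all add: lessThan_Suc_atMost[symmetric] del: sum.lessThan_Suc)
  then have contS: "continuous_on {-1..1} (\<lambda>u. \<Sum>n. b n * u ^ n)" and sb: "summable (\<lambda>n. \<bar>b n\<bar>)"
    by (auto intro: continuous_on_powser_cball)
  have "F u - (\<Sum>n. b n * u ^ n) = 0" if "\<bar>u\<bar> \<le> 1" for u
  proof (rule continuous_constant_on_closure[of "{-1<..<1}" "\<lambda>u. F u - (\<Sum>n. b n * u ^ n)"])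
    have cl: "closure {-1<..<1::real} = {-1..1}" by simp
    show "continuous_on (closure {-1<..<1}) (\<lambda>u. F u - (\<Sum>n. b n * u ^ n))"
      unfolding cl by (intro continuous_intros cont contS)
    show "u \<in> closure {-1<..<1}" unfolding cl using that by auto
    show "F x - (\<Sum>n. b n * x ^ n) = 0" if "x \<in> {-1<..<1}" for x
      using b_sums[of x] that by (auto simp: sums_iff)
  qed
  moreover have "summable (\<lambda>n. b n * u ^ n)" if u: "\<bar>u\<bar> \<le> 1" for u
  proof (rule summable_comparison_test[OF _ sb], intro exI allI impI)
    fix n
    show "norm (b n * u ^ n) \<le> \<bar>b n\<bar>"
      using u power_le_one[of "\<bar>u\<bar>" n] by (simp add: abs_mult power_abs mult_left_le)
  qed
  ultimately show ?thesis using b0 unfolding b_def[symmetric] nonneg_powser_def by (auto simp: sums_iff)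
qed

section \<open>Taylor coefficients of arcsin, \<open>kappa0\<close> and
  \<open>kappa1\<close>\<close>

text \<open>Binomial series with exponent -1/2 at -u^2: the alternating signs of the binomial
  coefficients cancel those of the powers. The coefficient of u^(2k) is the central binomial
  coefficient divided by 4^k.\<close>

lemma inverse_sqrt_sums:
  fixes u :: real
  assumes "\<bar>u\<bar> < 1"
  shows "(\<lambda>n. (if even n then pochhammer (1/2) (n div 2) / fact (n div 2) else 0) * u ^ n) sums (1 / sqrt (1 - u\<^sup>2))"
proof -
  have u2: "u\<^sup>2 < 1" using assms by (simp add: abs_square_less_1)
  have "(\<lambda>k. ((-1/2) gchoose k) * (- (u\<^sup>2)) ^ k) sums (1 + - u\<^sup>2) powr (-1/2)"
    by (rule gen_binomial_real) (use u2 in auto)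
  also have "(1 + - u\<^sup>2) powr (-1/2) = 1 / sqrt (1 - u\<^sup>2)"
    using u2 by (simp add: powr_minus_divide powr_half_sqrt)
  also have "(\<lambda>k. ((-1/2) gchoose k) * (- (u\<^sup>2)) ^ k) = (\<lambda>k. pochhammer (1/2) k / fact k * u ^ (2 * k))"
  proof
    fix k
    have "(-1) ^ k * (- (u\<^sup>2)) ^ k = u ^ (2 * k)"
      by (simp flip: power_mult_distrib add: power_mult)
    then show "((-1/2) gchoose k) * (- (u\<^sup>2)) ^ k = pochhammer (1/2) k / fact k * u ^ (2 * k)"
      by (simp add: gbinomial_pochhammer)
  qed
  finally have *: "(\<lambda>k. pochhammer (1/2) k / fact k * u ^ (2 * k)) sums (1 / sqrt (1 - u\<^sup>2))" .
  let ?f = "\<lambda>n. (if even n then pochhammer (1/2) (n div 2) / fact (n div 2) else 0) * u ^ n"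
  have "(\<lambda>k. ?f (2 * k)) sums (1 / sqrt (1 - u\<^sup>2)) \<longleftrightarrow> ?f sums (1 / sqrt (1 - u\<^sup>2))"
  proof (rule sums_mono_reindex)
    show "strict_mono (\<lambda>k::nat. 2 * k)" by (auto simp: strict_mono_def)
    fix n :: nat assume "n \<notin> range (\<lambda>k. 2 * k)"
    then have "odd n" by (auto elim: evenE)
    then show "?f n = 0" by simp
  qed
  then show ?thesis using * by simp
qed

text \<open>Consecutive coefficients have ratio (2k+1)/(2k+2), which is at least sqrt(k/(k+1))
  because 4k(k+1) <= (2k+1)^2. The constant is that of equality at k = 1.\<close>

lemma pochhammer_half_ge:
  assumes "k \<ge> 1"
  shows "pochhammer (1/2) k / fact k \<ge> 1 / (2 * sqrt (real k))"
  using assms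
proof (induction k rule: nat_induct_at_least)
  case base
  show ?case by simp
next
  case (Suc k)
  let ?b = "pochhammer (1/2 :: real) k / fact k"
  have "1 / (2 * sqrt (Suc k)) \<le> 1 / (2 * sqrt k) * ((2 * k + 1) / (2 * k + 2))"
  proof -
    have "sqrt k * (2 * k + 2) = sqrt (real k * (2 * real k + 2)\<^sup>2)" by (simp add: real_sqrt_mult)
    also have "\<dots> \<le> sqrt (real (Suc k) * (2 * real k + 1)\<^sup>2)"
      by (rule real_sqrt_le_mono) (simp add: power2_eq_square algebra_simps)
    also have "\<dots> = sqrt (Suc k) * (2 * k + 1)"
      unfolding real_sqrt_mult by simp
    finally show ?thesis using Suc.hyps by (simp add: divide_simps mult.commute)
  qed
  also have "\<dots> \<le> ?b * ((2 * k + 1) / (2 * k + 2))"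
    by (intro mult_right_mono Suc.IH) auto
  also have "\<dots> = pochhammer (1/2) (Suc k) / fact (Suc k)"
    by (simp add: pochhammer_Suc divide_simps)
  finally show ?case .
qed

lemma arcsin_nonneg_powser:
  "nonneg_powser (case_nat 0 (\<lambda>n. (if even n then pochhammer (1/2) (n div 2) / fact (n div 2) else 0) / Suc n)) arcsin"
proof -
  have "nonneg_powser (case_nat (arcsin 0) (\<lambda>n. (if even n then pochhammer (1/2) (n div 2) / fact (n div 2) else 0) / Suc n)) arcsin"
  proof (rule nonneg_powser_antideriv[OF _ inverse_sqrt_sums])
    show "0 \<le> (if even n then pochhammer (1/2) (n div 2) / fact (n div 2) else (0::real))" for n
      by (auto intro!: divide_nonneg_nonneg pochhammer_nonneg)
    show "continuous_on {-1..1} arcsin" by (rule continuous_on_arcsin')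
    show "(arcsin has_real_derivative 1 / sqrt (1 - u\<^sup>2)) (at u)" if "\<bar>u\<bar> < 1" for u
      using DERIV_arcsin[of u] that by (auto simp: inverse_eq_divide)
  qed auto
  then show ?thesis by simp
qed

lemma kappa0_eq: "\<bar>u\<bar> \<le> 1 \<Longrightarrow> kappa0 u = 1 / 2 + 1 / pi * arcsin u"
  using arcsin_arccos_eq[of u] by (simp add: kappa0_def abs_le_iff divide_simps)

text \<open>Integration divides the coefficients of order k^(-1/2) by their degree, hence k^(-3/2).
  The odd degree is written \<open>2 * k - 1\<close> because a factor u in the profile will shift it
  to \<open>2 * k\<close>. The constant is the product of 1/pi, 1/2 from
  \<open>pochhammer_half_ge\<close>, and 1/2 from the degree being less than 2k.\<close>

lemma kappa0_nonneg_powser: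
  "\<exists>a. nonneg_powser a kappa0 \<and> (\<forall>k\<ge>1. a (2 * k - 1) \<ge> 1 / (4 * pi) * real k powr (-3/2))"
proof -
  define s where "s = (case_nat 0 (\<lambda>n. (if even n then pochhammer (1/2) (n div 2) / fact (n div 2) else (0::real)) / Suc n))"
  define a where "a n = (if n = 0 then 1/2 else 0) + 1 / pi * s n" for n :: nat
  have "nonneg_powser a (\<lambda>u. 1/2 + 1 / pi * arcsin u)"
    unfolding a_def s_def
    by (intro nonneg_powser_add nonneg_powser_cmult arcsin_nonneg_powser nonneg_powser_const) auto
  then have 1: "nonneg_powser a kappa0"
    using kappa0_eq by (simp add: nonneg_powser_def)
  have "a (2 * k - 1) \<ge> 1 / (4 * pi) * real k powr (-3/2)" if k: "k \<ge> 1" for k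
  proof -
    obtain j where j: "k = Suc j" using k by (cases k) auto
    have "1 / (2 * sqrt k) / (2 * k) \<le> pochhammer (1/2) j / fact j / (2 * j + 1)"
    proof (rule frac_le)
      show "1 / (2 * sqrt k) \<le> pochhammer (1/2) j / fact j"
      proof (cases "j = 0")
        case False
        then have "1 / (2 * sqrt k) \<le> 1 / (2 * sqrt j)" by (intro frac_le) (auto simp: j)
        also have "\<dots> \<le> pochhammer (1/2) j / fact j" using False by (intro pochhammer_half_ge) auto
        finally show ?thesis .
      qed (simp add: j)
      show "0 \<le> pochhammer (1/2) j / (fact j :: real)"
        by (intro divide_nonneg_nonneg pochhammer_nonneg) auto
    qed (auto simp: j)
    then have "1 / pi * (1 / (2 * sqrt k) / (2 * k)) \<le> 1 / pi * (pochhammer (1/2) j / fact j / (2 * j + 1))"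
      by (intro mult_left_mono) auto
    also have "\<dots> = a (2 * k - 1)" by (simp add: a_def s_def j)
    finally have "1 / pi * (1 / (2 * sqrt k) / (2 * k)) \<le> a (2 * k - 1)" .
    moreover have "1 / pi * (1 / (2 * sqrt k) / (2 * k)) = 1 / (4 * pi) * (1 / (k powr (1/2) * k powr 1))"
      using k by (simp add: powr_half_sqrt)
    moreover have "1 / (real k powr (1/2) * k powr 1) = k powr (-3/2)"
      unfolding powr_add[symmetric] by (simp add: powr_minus_divide)
    ultimately show ?thesis by metis
  qed
  with 1 show ?thesis by blast
qed

text \<open>\<open>kappa0\<close> is the derivative of \<open>kappa1\<close> on the open
  interval.\<close>

lemma kappa1_nonneg_powser: "\<exists>a. nonneg_powser a kappa1"
proof -
  obtain a where a: "nonneg_powser a kappa0" using kappa0_nonneg_powser by blast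
  have "nonneg_powser (case_nat (kappa1 0) (\<lambda>n. a n / Suc n)) kappa1"
  proof (rule nonneg_powser_antideriv)
    show "continuous_on {-1..1} kappa1"
      unfolding kappa1_def by (intro continuous_intros) auto
    show "(\<lambda>n. a n * u ^ n) sums kappa0 u" if "\<bar>u\<bar> < 1" for u
      using nonneg_powser_sums[OF a] that by simp
    show "(kappa1 has_real_derivative kappa0 u) (at u)" if "\<bar>u\<bar> < 1" for u
    proof -
      have u2: "u\<^sup>2 < 1" using that by (simp add: abs_square_less_1)
      have "u > -1" "u < 1" using that by auto
      then show ?thesis
        unfolding kappa1_def kappa0_def using u2
        by (auto intro!: derivative_eq_intros simp: field_simps)
    qed
  qed (use nonneg_powser_nonneg[OF a] in \<open>auto simp: kappa1_def\<close>)
  then show ?thesis by blast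
qed

section \<open>Iterates of \<open>kappa1\<close> and the coefficients of the profile\<close>

lemma kappa1_one [simp]: "kappa1 1 = 1" and kappa0_one [simp]: "kappa0 1 = 1"
  by (simp_all add: kappa1_def kappa0_def)

lemma kappa1_funpow_one [simp]: "(kappa1 ^^ r) 1 = 1"
  by (induction r) auto

lemma kappa1_funpow_nonneg_powser: "\<exists>a. nonneg_powser a (kappa1 ^^ r)"
proof (induction r)
  case 0
  show ?case using nonneg_powser_ident by (auto simp: id_def)
next
  case (Suc r)
  then obtain b where "nonneg_powser b (kappa1 ^^ r)" by blast
  moreover obtain a where "nonneg_powser a kappa1" using kappa1_nonneg_powser by blast
  ultimately have "\<exists>c. nonneg_powser c (\<lambda>u. kappa1 ((kappa1 ^^ r) u))"
    by (intro ex_nonneg_powser_compose) auto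
  then show ?case by (simp add: comp_def)
qed

lemma kappa1_funpow_abs_le: "\<bar>u\<bar> \<le> 1 \<Longrightarrow> \<bar>(kappa1 ^^ r) u\<bar> \<le> 1"
  using kappa1_funpow_nonneg_powser[of r] nonneg_powser_abs_le by fastforce

lemma kappa0_compose_nonneg_powser: "\<exists>a. nonneg_powser a (\<lambda>u. kappa0 ((kappa1 ^^ r) u))"
proof -
  obtain a where "nonneg_powser a kappa0" using kappa0_nonneg_powser by blast
  moreover obtain b where "nonneg_powser b (kappa1 ^^ r)" using kappa1_funpow_nonneg_powser by blast
  ultimately show ?thesis by (intro ex_nonneg_powser_compose) auto
qed

lemma nonneg_powser_prod:
  "finite S \<Longrightarrow> (\<And>s. s \<in> S \<Longrightarrow> \<exists>a. nonneg_powser a (f s)) \<Longrightarrow> \<exists>a. nonneg_powser a (\<lambda>u. \<Prod>s\<in>S. f s u)"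
proof (induction S rule: finite_induct)
  case empty
  show ?case using nonneg_powser_const[of 1] by auto
next
  case (insert s S)
  then show ?case using nonneg_powser_mult by (simp add: insert.hyps) blast
qed

lemma nonneg_powser_sum:
  "finite S \<Longrightarrow> (\<And>s. s \<in> S \<Longrightarrow> \<exists>a. nonneg_powser a (f s)) \<Longrightarrow> \<exists>a. nonneg_powser a (\<lambda>u. \<Sum>s\<in>S. f s u)"
proof (induction S rule: finite_induct)
  case empty
  show ?case using nonneg_powser_const[of 0] by auto
next
  case (insert s S)
  then show ?case using nonneg_powser_add by (simp add: insert.hyps) blast
qed

definition ntk_profile :: "nat \<Rightarrow> real \<Rightarrow> real" where
  "ntk_profile L u = (\<Sum>r = 0..L. (kappa1 ^^ r) u * (\<Prod>s\<in>{r..<L}. kappa0 ((kappa1 ^^ s) u)))"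

lemma kappa0_nonneg_ge_half: "0 \<le> u \<Longrightarrow> u \<le> 1 \<Longrightarrow> kappa0 u \<ge> 1 / 2"
  using kappa0_eq[of u] arcsin_le_mono[of 0 u] by simp

text \<open>All summands have nonnegative coefficients, so the summand r = 0 alone gives the lower
  bound. For L >= 1 it is u * kappa0(u) times a product \<open>R\<close> of later factors: the
  factor u turns the odd degrees of \<open>kappa0\<close> into even ones, and \<open>R 0 > 0\<close>
  costs only a constant. Even degrees are the ones wanted later, since even powers of an inner
  product cannot be negative.\<close>

lemma ntk_profile_nonneg_powser:
  assumes L: "L \<ge> 1"
  shows "\<exists>a c. 0 < c \<and> nonneg_powser a (ntk_profile L) \<and> (\<forall>k\<ge>1. a (2 * k) \<ge> c * real k powr (-3/2))"
proof -
  obtain a0 where a0: "nonneg_powser a0 kappa0"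
    and a0_ge: "\<And>k. k \<ge> 1 \<Longrightarrow> a0 (2 * k - 1) \<ge> 1 / (4 * pi) * real k powr (-3/2)"
    using kappa0_nonneg_powser by blast
  define R where "R u = (\<Prod>s\<in>{1..<L}. kappa0 ((kappa1 ^^ s) u))" for u
  obtain b where b: "nonneg_powser b R"
    using nonneg_powser_prod[of "{1..<L}" "\<lambda>s u. kappa0 ((kappa1 ^^ s) u)"] kappa0_compose_nonneg_powser
    by (auto simp: R_def[abs_def])
  obtain d where d: "nonneg_powser d (\<lambda>u. \<Sum>r = 1..L. (kappa1 ^^ r) u * (\<Prod>s\<in>{r..<L}. kappa0 ((kappa1 ^^ s) u)))"
  proof -
    have "\<exists>d. nonneg_powser d (\<lambda>u. (kappa1 ^^ r) u * (\<Prod>s\<in>{r..<L}. kappa0 ((kappa1 ^^ s) u)))" for r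
      using nonneg_powser_mult kappa1_funpow_nonneg_powser[of r]
        nonneg_powser_prod[of "{r..<L}" "\<lambda>s u. kappa0 ((kappa1 ^^ s) u)"] kappa0_compose_nonneg_powser
      by blast
    then show ?thesis using nonneg_powser_sum[of "{1..L}"] that by fast
  qed
  define e where "e n = (\<Sum>i\<le>n. (if i = 1 then 1 else 0) * a0 (n - i))" for n
  have e: "nonneg_powser e (\<lambda>u. u * kappa0 u)"
    unfolding e_def by (rule nonneg_powser_mult[OF nonneg_powser_ident a0])
  define a where "a n = (\<Sum>i\<le>n. e i * b (n - i)) + d n" for n
  have "nonneg_powser a (\<lambda>u. u * kappa0 u * R u + (\<Sum>r = 1..L. (kappa1 ^^ r) u * (\<Prod>s\<in>{r..<L}. kappa0 ((kappa1 ^^ s) u))))"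
    unfolding a_def by (intro nonneg_powser_add nonneg_powser_mult e b d)
  moreover have "u * kappa0 u * R u + (\<Sum>r = 1..L. (kappa1 ^^ r) u * (\<Prod>s\<in>{r..<L}. kappa0 ((kappa1 ^^ s) u))) = ntk_profile L u" for u
    using L by (simp add: ntk_profile_def R_def sum.atLeast_Suc_atMost prod.atLeast_Suc_lessThan)
  ultimately have a: "nonneg_powser a (ntk_profile L)" by (simp add: fun_eq_iff[symmetric])
  have R0: "R 0 > 0"
  proof -
    have "kappa0 ((kappa1 ^^ s) 0) > 0" for s
    proof -
      obtain c where "nonneg_powser c (kappa1 ^^ s)" using kappa1_funpow_nonneg_powser by blast
      then have "0 \<le> (kappa1 ^^ s) 0" using nonneg_powser_zero nonneg_powser_nonneg by metis
      then show ?thesis using kappa0_nonneg_ge_half[of "(kappa1 ^^ s) 0"] kappa1_funpow_abs_le[of 0 s] by simp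
    qed
    then show ?thesis by (simp add: R_def prod_pos)
  qed
  have "a (2 * k) \<ge> (R 0 / (4 * pi)) * real k powr (-3/2)" if k: "k \<ge> 1" for k
  proof -
    have "e (2 * k) \<ge> a0 (2 * k - 1)"
    proof -
      have "(if (1::nat) = 1 then 1 else 0) * a0 (2 * k - 1) \<le> e (2 * k)"
        unfolding e_def by (rule member_le_sum[of 1]) (use k nonneg_powser_nonneg[OF a0] in auto)
      then show ?thesis by simp
    qed
    then have "1 / (4 * pi) * real k powr (-3/2) * R 0 \<le> e (2 * k) * R 0"
      using a0_ge[OF k] R0 by (intro mult_right_mono) auto
    also have "\<dots> \<le> (\<Sum>i\<le>2*k. e i * b (2 * k - i))" by (rule nonneg_powser_mult_coeff_ge[OF e b])
    also have "\<dots> \<le> a (2 * k)" using nonneg_powser_nonneg[OF d] by (simp add: a_def)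
    finally show ?thesis by (simp add: mult.commute)
  qed
  with a R0 show ?thesis by (intro exI[of _ a] exI[of _ "R 0 / (4 * pi)"]) auto
qed

section \<open>Modulus of continuity of the profile at u = 1\<close>

lemma mult_cos_le_sin:
  fixes v :: real
  assumes "0 \<le> v" "v \<le> pi"
  shows "v * cos v \<le> sin v"
proof -
  have "(sin 0 - 0 * cos 0 :: real) \<le> sin v - v * cos v"
  proof (rule DERIV_nonneg_imp_nondecreasing[OF assms(1)])
    fix x :: real assume "0 \<le> x" "x \<le> v"
    then have "((\<lambda>x. sin x - x * cos x) has_real_derivative x * sin x) (at x)" "x * sin x \<ge> 0"
      using assms by (auto intro!: derivative_eq_intros mult_nonneg_nonneg sin_ge_zero simp: algebra_simps)
    then show "\<exists>y. ((\<lambda>x. sin x - x * cos x) has_real_derivative y) (at x) \<and> 0 \<le> y" by blast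
  qed
  then show ?thesis by simp
qed

text \<open>With u = cos v one has pi * kappa1(u) = sin v + (pi - v) cos v, so the claim is v cos v
  <= sin v. Consequently no iterate of \<open>kappa1\<close> is farther from 1 than u, whatever its
  depth.\<close>

lemma one_minus_kappa1_le:
  assumes "\<bar>u\<bar> \<le> 1"
  shows "1 - kappa1 u \<le> 1 - u"
proof -
  define v where "v = arccos u"
  have v: "0 \<le> v" "v \<le> pi" "u = cos v" using assms by (auto simp: v_def abs_le_iff arccos_lbound arccos_ubound)
  have "sqrt (1 - u\<^sup>2) = sin v"
    using sin_arccos_abs[of u] assms by (simp add: v_def)
  moreover have "v * cos v \<le> sin v" using mult_cos_le_sin v by simp
  ultimately have "pi * u \<le> sqrt (1 - u\<^sup>2) + u * (pi - arccos u)"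
    unfolding v_def[symmetric] by (simp add: v(3)[symmetric] algebra_simps)
  then show ?thesis by (simp add: kappa1_def field_simps)
qed

lemma one_minus_kappa1_funpow_le: "\<bar>u\<bar> \<le> 1 \<Longrightarrow> 1 - (kappa1 ^^ r) u \<le> 1 - u"
proof (induction r)
  case (Suc r)
  then show ?case using one_minus_kappa1_le[OF kappa1_funpow_abs_le[OF Suc.prems, of r]] by simp
qed simp

text \<open>With u = cos 2v the left side is 2v/pi and the right side is sqrt 2 * sin v, so the
  claim follows from Jordan's inequality. The latter holds because sin x / x decreases on (0,
  pi/2].\<close>

lemma one_minus_kappa0_le:
  assumes "\<bar>u\<bar> \<le> 1"
  shows "1 - kappa0 u \<le> sqrt (1 - u)"
proof -
  define v where "v = arccos u / 2"
  have v: "0 \<le> v" "v \<le> pi / 2" using assms by (auto simp: v_def abs_le_iff arccos_lbound arccos_ubound)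
  have "u = cos (2 * v)" using assms by (simp add: v_def abs_le_iff)
  then have "1 - u = 2 * (sin v)\<^sup>2" by (simp add: cos_double_sin)
  moreover have "sin v \<ge> 0" using v by (intro sin_ge_zero) auto
  ultimately have sq: "sqrt (1 - u) = sqrt 2 * sin v" by (simp add: real_sqrt_mult)
  have "2 / pi * v \<le> sin v"
  proof (cases "v = 0")
    case False
    have "sin (pi / 2) / (pi / 2) \<le> sin v / v"
    proof (rule DERIV_nonpos_imp_nonincreasing[OF v(2)])
      fix x assume x: "v \<le> x" "x \<le> pi / 2"
      with v False have "x > 0" by simp
      then have "((\<lambda>x. sin x / x) has_real_derivative (x * cos x - sin x) / x\<^sup>2) (at x)"
        by (auto intro!: derivative_eq_intros simp: power2_eq_square algebra_simps)
      moreover have "(x * cos x - sin x) / x\<^sup>2 \<le> 0"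
        using mult_cos_le_sin[of x] x \<open>x > 0\<close> by (simp add: divide_le_0_iff)
      ultimately show "\<exists>y. ((\<lambda>x. sin x / x) has_real_derivative y) (at x) \<and> y \<le> 0" by blast
    qed
    then show ?thesis using v False by (simp add: field_simps)
  qed simp
  have "1 - kappa0 u = 2 / pi * v" by (simp add: kappa0_def v_def field_simps)
  also have "\<dots> \<le> 1 * sin v" using \<open>2 / pi * v \<le> sin v\<close> by simp
  also have "\<dots> \<le> sqrt 2 * sin v" using \<open>sin v \<ge> 0\<close> by (intro mult_right_mono) auto
  finally show ?thesis using sq by simp
qed

text \<open>One-sided defects from 1 add up under multiplication: 1 - ab = (1 - a) + a(1 - b).
  Neither factor has to be nonnegative.\<close>

lemma one_minus_mult_le:
  fixes a b :: real
  assumes "\<bar>a\<bar> \<le> 1" "a \<ge> 1 - x" "b \<ge> 1 - y" "b \<le> 1"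
  shows "1 - a * b \<le> x + y"
proof -
  have "1 - a * b = (1 - a) + a * (1 - b)" by (simp add: algebra_simps)
  also have "a * (1 - b) \<le> 1 * (1 - b)" using assms by (intro mult_right_mono) auto
  finally show ?thesis using assms by simp
qed

text \<open>Write t = sqrt(1 - u). In each of the L + 1 summands every factor \<open>kappa0\<close>
  has defect at most t, and there are at most L of them; the iterate of \<open>kappa1\<close> has
  defect at most t^2, which is at most 2t since 1 - u <= 2. This makes L + 2 for one
  summand.\<close>

lemma ntk_profile_half_holder:
  assumes u: "\<bar>u\<bar> \<le> 1"
  shows "ntk_profile L 1 - ntk_profile L u \<le> (L + 1) * (L + 2) * sqrt (1 - u)"
proof -
  let ?t = "sqrt (1 - u)"
  have t0: "0 \<le> ?t" using u by simp
  have k0: "1 - kappa0 ((kappa1 ^^ s) u) \<le> ?t" for s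
  proof -
    have "1 - kappa0 ((kappa1 ^^ s) u) \<le> sqrt (1 - (kappa1 ^^ s) u)"
      by (rule one_minus_kappa0_le[OF kappa1_funpow_abs_le[OF u]])
    also have "\<dots> \<le> ?t" by (intro real_sqrt_le_mono one_minus_kappa1_funpow_le u)
    finally show ?thesis .
  qed
  obtain a where "nonneg_powser a kappa0" using kappa0_nonneg_powser by blast
  then have k0_le: "\<bar>kappa0 ((kappa1 ^^ s) u)\<bar> \<le> 1" for s
    using nonneg_powser_abs_le[OF _ kappa1_funpow_abs_le[OF u]] kappa0_one by metis
  have prod: "\<bar>\<Prod>s\<in>{r..<L}. kappa0 ((kappa1 ^^ s) u)\<bar> \<le> 1" for r
    unfolding abs_prod using k0_le by (intro prod_le_1) auto
  have prod1: "1 - (\<Prod>s\<in>S. kappa0 ((kappa1 ^^ s) u)) \<le> card S * ?t" if "finite S" for S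
    using that
  proof (induction S rule: finite_induct)
    case (insert s S)
    have "\<bar>\<Prod>s\<in>S. kappa0 ((kappa1 ^^ s) u)\<bar> \<le> 1"
      unfolding abs_prod using k0_le by (intro prod_le_1) auto
    then have "1 - kappa0 ((kappa1 ^^ s) u) * (\<Prod>s\<in>S. kappa0 ((kappa1 ^^ s) u)) \<le> ?t + card S * ?t"
      using k0[of s] k0_le[of s] insert.IH by (intro one_minus_mult_le) auto
    then show ?case using insert.hyps by (simp add: algebra_simps)
  qed simp
  have summand: "1 - (kappa1 ^^ r) u * (\<Prod>s\<in>{r..<L}. kappa0 ((kappa1 ^^ s) u)) \<le> (L + 2) * ?t" for r
  proof -
    have "1 - (kappa1 ^^ r) u \<le> ?t * ?t"
      using one_minus_kappa1_funpow_le[OF u, of r] u by simp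
    also have "\<dots> \<le> 2 * ?t"
    proof (rule mult_right_mono[OF _ t0])
      have "?t \<le> sqrt (2\<^sup>2)" using u by (intro real_sqrt_le_mono) auto
      then show "?t \<le> 2" by simp
    qed
    finally have "1 - (kappa1 ^^ r) u * (\<Prod>s\<in>{r..<L}. kappa0 ((kappa1 ^^ s) u))
        \<le> 2 * ?t + card {r..<L} * ?t"
      using kappa1_funpow_abs_le[OF u, of r] prod[of r] prod1[of "{r..<L}"]
      by (intro one_minus_mult_le) auto
    also have "\<dots> \<le> (L + 2) * ?t"
      using mult_right_mono[OF _ t0, of "real (card {r..<L})" "real L"] by (simp add: algebra_simps)
    finally show ?thesis .
  qed
  have "ntk_profile L 1 - ntk_profile L u
      = (\<Sum>r = 0..L. 1 - (kappa1 ^^ r) u * (\<Prod>s\<in>{r..<L}. kappa0 ((kappa1 ^^ s) u)))"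
    by (simp add: ntk_profile_def sum_subtractf)
  also have "\<dots> \<le> (\<Sum>r = 0..L. (L + 2) * ?t)" by (intro sum_mono summand)
  also have "\<dots> = (L + 1) * (L + 2) * ?t" by (simp add: algebra_simps)
  finally show ?thesis by (simp add: algebra_simps)
qed

section \<open>Square integrable functions\<close>

text \<open>Functions and not classes modulo null sets, in accordance with
  \<open>int_op_eigenvalue\<close>. Hence \<open>ip\<close> is only positive semidefinite, and
  functions of norm zero need separate treatment wherever one normalises.\<close>

definition l2 :: "'a measure \<Rightarrow> ('a \<Rightarrow> real) set" where
  "l2 M = {f. f \<in> borel_measurable M \<and> integrable M (\<lambda>x. (f x)\<^sup>2)}"

definition ip :: "'a measure \<Rightarrow> ('a \<Rightarrow> real) \<Rightarrow> ('a \<Rightarrow> real) \<Rightarrow> real" where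
  "ip M f g = (\<integral>x. f x * g x \<partial>M)"

lemma l2_measurable: "f \<in> l2 M \<Longrightarrow> f \<in> borel_measurable M"
  by (simp add: l2_def)

lemma l2_integrable_square: "f \<in> l2 M \<Longrightarrow> integrable M (\<lambda>x. (f x)\<^sup>2)"
  by (simp add: l2_def)

lemma l2_integrable_mult:
  assumes "f \<in> l2 M" "g \<in> l2 M"
  shows "integrable M (\<lambda>x. f x * g x)"
proof (rule Bochner_Integration.integrable_bound)
  show "integrable M (\<lambda>x. (f x)\<^sup>2 + (g x)\<^sup>2)"
    using assms by (auto simp: l2_def)
  show "(\<lambda>x. f x * g x) \<in> borel_measurable M" using assms by (auto simp: l2_def)
  have "\<bar>a * b\<bar> \<le> a\<^sup>2 + b\<^sup>2" for a b :: real
  proof -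
    have "2 * (\<bar>a\<bar> * \<bar>b\<bar>) \<le> \<bar>a\<bar>\<^sup>2 + \<bar>b\<bar>\<^sup>2"
      using sum_squares_bound[of "\<bar>a\<bar>" "\<bar>b\<bar>"] by simp
    moreover have "0 \<le> \<bar>a\<bar> * \<bar>b\<bar>" by simp
    ultimately show ?thesis unfolding abs_mult power2_abs by linarith
  qed
  then show "AE x in M. norm (f x * g x) \<le> norm ((f x)\<^sup>2 + (g x)\<^sup>2)" by simp
qed

lemma l2_bound:
  assumes "g \<in> l2 M" "f \<in> borel_measurable M" "\<And>x. \<bar>f x\<bar> \<le> \<bar>g x\<bar>"
  shows "f \<in> l2 M"
proof -
  have "integrable M (\<lambda>x. (f x)\<^sup>2)"
    by (rule Bochner_Integration.integrable_bound[OF l2_integrable_square[OF assms(1)]])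
      (use assms in \<open>auto simp: abs_le_square_iff\<close>)
  then show ?thesis using assms(2) by (simp add: l2_def)
qed

lemma l2_cmult [simp]: "f \<in> l2 M \<Longrightarrow> (\<lambda>x. c * f x) \<in> l2 M"
  by (auto simp: l2_def power_mult_distrib)

lemma l2_add [simp]:
  assumes "f \<in> l2 M" "g \<in> l2 M"
  shows "(\<lambda>x. f x + g x) \<in> l2 M"
  using assms l2_integrable_mult[OF assms] by (auto simp: l2_def power2_sum mult.assoc)

lemma l2_diff [simp]:
  assumes "f \<in> l2 M" "g \<in> l2 M"
  shows "(\<lambda>x. f x - g x) \<in> l2 M"
  using l2_add[OF assms(1) l2_cmult[OF assms(2), of "-1"]] by simp

lemma l2_zero [simp]: "(\<lambda>x. 0) \<in> l2 M"
  by (simp add: l2_def)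

lemma l2_sum [simp]: "(\<And>j. j \<in> J \<Longrightarrow> f j \<in> l2 M) \<Longrightarrow> (\<lambda>x. \<Sum>j\<in>J. f j x) \<in> l2 M"
  by (induction J rule: infinite_finite_induct) auto

lemma ip_commute: "ip M f g = ip M g f"
  by (simp add: ip_def mult.commute)

lemma ip_add_left: "f \<in> l2 M \<Longrightarrow> g \<in> l2 M \<Longrightarrow> h \<in> l2 M \<Longrightarrow> ip M (\<lambda>x. f x + g x) h = ip M f h + ip M g h"
  by (simp add: ip_def distrib_right l2_integrable_mult)

lemma ip_diff_left: "f \<in> l2 M \<Longrightarrow> g \<in> l2 M \<Longrightarrow> h \<in> l2 M \<Longrightarrow> ip M (\<lambda>x. f x - g x) h = ip M f h - ip M g h"
  by (simp add: ip_def left_diff_distrib l2_integrable_mult)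

lemma ip_cmult_left: "ip M (\<lambda>x. c * f x) g = c * ip M f g"
  by (simp add: ip_def mult.assoc)

lemma ip_sum_left:
  "(\<And>j. j \<in> J \<Longrightarrow> f j \<in> l2 M) \<Longrightarrow> g \<in> l2 M \<Longrightarrow> ip M (\<lambda>x. \<Sum>j\<in>J. f j x) g = (\<Sum>j\<in>J. ip M (f j) g)"
  by (simp add: ip_def sum_distrib_right l2_integrable_mult)

lemma ip_add_right: "f \<in> l2 M \<Longrightarrow> g \<in> l2 M \<Longrightarrow> h \<in> l2 M \<Longrightarrow> ip M h (\<lambda>x. f x + g x) = ip M h f + ip M h g"
  using ip_add_left[of f M g h] by (simp only: ip_commute[of M h])

lemma ip_diff_right: "f \<in> l2 M \<Longrightarrow> g \<in> l2 M \<Longrightarrow> h \<in> l2 M \<Longrightarrow> ip M h (\<lambda>x. f x - g x) = ip M h f - ip M h g"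
  using ip_diff_left[of f M g h] by (simp only: ip_commute[of M h])

lemma ip_cmult_right: "ip M g (\<lambda>x. c * f x) = c * ip M g f"
  using ip_cmult_left[of M c f g] by (simp only: ip_commute[of M g])

lemma ip_sum_right:
  "(\<And>j. j \<in> J \<Longrightarrow> f j \<in> l2 M) \<Longrightarrow> g \<in> l2 M \<Longrightarrow> ip M g (\<lambda>x. \<Sum>j\<in>J. f j x) = (\<Sum>j\<in>J. ip M g (f j))"
  using ip_sum_left[of J f M g] by (simp only: ip_commute[of M g])

lemmas ip_linear = ip_add_left ip_diff_left ip_cmult_left ip_add_right ip_diff_right ip_cmult_right

lemma ip_self_nonneg [simp]: "0 \<le> ip M f f"
  by (simp add: ip_def)

lemma ip_self_pos: "ip M f f \<noteq> 0 \<Longrightarrow> 0 < ip M f f"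
  by (metis ip_self_nonneg less_le)

text \<open>Stated for numbers, since the Cauchy-Schwarz inequality is used for two semidefinite
  forms: \<open>ip\<close> itself, and the form of s - T in
  \<open>eigenfunction_step\<close>.\<close>

lemma discriminant_le:
  fixes a b c :: real
  assumes "\<And>t. 0 \<le> a + 2 * t * b + t\<^sup>2 * c" "0 \<le> c"
  shows "b\<^sup>2 \<le> a * c"
proof (cases "c = 0")
  case True
  have "b = 0"
  proof (rule ccontr)
    assume "b \<noteq> 0"
    then have "2 * (- (a + 1) / (2 * b)) * b = - (a + 1)" by simp
    then show False using assms(1)[of "- (a + 1) / (2 * b)"] True by simp
  qed
  then show ?thesis using True by simp
next
  case False
  have "0 \<le> a + 2 * (- b / c) * b + (- b / c)\<^sup>2 * c" by (rule assms(1))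
  also have "\<dots> = a - b\<^sup>2 / c" using False by (simp add: power2_eq_square)
  finally show ?thesis using False assms(2) by (simp add: field_simps)
qed

lemma ip_Cauchy_Schwarz:
  assumes "f \<in> l2 M" "g \<in> l2 M"
  shows "(ip M f g)\<^sup>2 \<le> ip M f f * ip M g g"
proof (rule discriminant_le)
  fix t
  have "0 \<le> ip M (\<lambda>x. f x + t * g x) (\<lambda>x. f x + t * g x)" by simp
  also have "\<dots> = ip M f f + 2 * t * ip M f g + t\<^sup>2 * ip M g g"
    using assms ip_commute[of M g f] by (simp add: ip_linear algebra_simps power2_eq_square)
  finally show "0 \<le> ip M f f + 2 * t * ip M f g + t\<^sup>2 * ip M g g" .
qed simp

lemma ip_tendsto_zero:
  assumes "\<And>n. h n \<in> l2 M" "u \<in> l2 M" "(\<lambda>n. ip M (h n) (h n)) \<longlonglongrightarrow> 0"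
  shows "(\<lambda>n. ip M (h n) u) \<longlonglongrightarrow> 0"
proof -
  have "(\<lambda>n. (ip M (h n) u)\<^sup>2) \<longlonglongrightarrow> 0"
  proof (rule tendsto_sandwich[OF _ _ tendsto_const])
    show "(\<lambda>n. ip M (h n) (h n) * ip M u u) \<longlonglongrightarrow> 0"
      using tendsto_mult_right[OF assms(3), of "ip M u u"] by simp
    show "\<forall>\<^sub>F n in sequentially. (ip M (h n) u)\<^sup>2 \<le> ip M (h n) (h n) * ip M u u"
      by (intro always_eventually allI ip_Cauchy_Schwarz assms)
  qed auto
  then have "(\<lambda>n. sqrt ((ip M (h n) u)\<^sup>2)) \<longlonglongrightarrow> sqrt 0" by (rule tendsto_real_sqrt)
  then show ?thesis by (simp add: tendsto_rabs_zero_iff)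
qed

section \<open>Orthonormal systems and homogeneous linear equations\<close>

definition orthonormal :: "'a measure \<Rightarrow> nat \<Rightarrow> (nat \<Rightarrow> 'a \<Rightarrow> real) \<Rightarrow> bool" where
  "orthonormal M n g \<longleftrightarrow> (\<forall>i<n. g i \<in> l2 M) \<and> (\<forall>i<n. \<forall>j<n. ip M (g i) (g j) = (if i = j then 1 else 0))"

lemma orthonormal_0 [simp]: "orthonormal M 0 g"
  by (simp add: orthonormal_def)

lemma orthonormal_extend:
  assumes "orthonormal M n g" "v \<in> l2 M" "ip M v v = 1" "\<And>j. j < n \<Longrightarrow> ip M v (g j) = 0"
  shows "orthonormal M (Suc n) (g(n := v))"
proof -
  have "ip M (g j) v = 0" if "j < n" for j using assms(4)[OF that] ip_commute[of M v "g j"] by simp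
  then show ?thesis using assms by (auto simp: orthonormal_def less_Suc_eq)
qed

lemma Bessel_inequality:
  assumes "orthonormal M n g" "h \<in> l2 M"
  shows "(\<Sum>l<n. (ip M h (g l))\<^sup>2) \<le> ip M h h"
proof -
  define p where "p x = (\<Sum>l<n. ip M h (g l) * g l x)" for x
  have gl: "g l \<in> l2 M" if "l < n" for l using assms(1) that by (simp add: orthonormal_def)
  have p: "p \<in> l2 M" unfolding p_def[abs_def] by (intro l2_sum l2_cmult gl) auto
  have hp: "ip M h p = (\<Sum>l<n. (ip M h (g l))\<^sup>2)"
    unfolding p_def[abs_def] by (subst ip_sum_right) (auto simp: gl assms(2) ip_cmult_right power2_eq_square)
  have pg: "ip M p (g l) = ip M h (g l)" if "l < n" for l
  proof -
    have "ip M p (g l) = (\<Sum>j<n. ip M h (g j) * ip M (g j) (g l))"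
      unfolding p_def[abs_def] by (subst ip_sum_left) (auto simp: gl that ip_cmult_left)
    also have "\<dots> = (\<Sum>j<n. if j = l then ip M h (g j) else 0)"
      using assms(1) that by (intro sum.cong) (auto simp: orthonormal_def)
    also have "\<dots> = ip M h (g l)" using that by simp
    finally show ?thesis .
  qed
  have pp: "ip M p p = (\<Sum>l<n. (ip M h (g l))\<^sup>2)"
  proof -
    have "ip M p p = (\<Sum>l<n. ip M h (g l) * ip M p (g l))"
      by (subst (2) p_def[abs_def], subst ip_sum_right) (auto simp: gl p ip_cmult_right)
    then show ?thesis by (simp add: pg power2_eq_square)
  qed
  have "0 \<le> ip M (\<lambda>x. h x - p x) (\<lambda>x. h x - p x)" by simp
  also have "\<dots> = ip M h h - (\<Sum>l<n. (ip M h (g l))\<^sup>2)"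
    using p assms(2) hp pp ip_commute[of M p h] by (simp add: ip_linear)
  finally show ?thesis by simp
qed

text \<open>Gaussian elimination, one equation per induction step. It replaces dimension counts: a
  span of many functions contains a nontrivial combination orthogonal to fewer given ones.\<close>

lemma exists_nontrivial_solution:
  fixes A :: "'r \<Rightarrow> 'j \<Rightarrow> real"
  assumes "finite R" "finite J" "card R < card J"
  shows "\<exists>c. (\<exists>j\<in>J. c j \<noteq> 0) \<and> (\<forall>r\<in>R. (\<Sum>j\<in>J. A r j * c j) = 0)"
  using assms
proof (induction R arbitrary: J A rule: finite_induct)
  case empty
  then show ?case by (intro exI[of _ "\<lambda>_. 1"]) (auto simp: card_gt_0_iff)
next
  case (insert r R)
  show ?case
  proof (cases "\<forall>j\<in>J. A r j = 0")
    case True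
    have "card R < card J" using insert.prems insert.hyps by simp
    from insert.IH[OF insert.prems(1) this, of A] True show ?thesis by auto
  next
    case False
    then obtain p where p: "p \<in> J" "A r p \<noteq> 0" by auto
    have "card R < card (J - {p})" using insert.prems insert.hyps p by simp
    from insert.IH[OF _ this, of "\<lambda>q j. A q j - A q p * A r j / A r p"] insert.prems(1)
    obtain c where c: "\<exists>j\<in>J - {p}. c j \<noteq> 0"
      "\<And>q. q \<in> R \<Longrightarrow> (\<Sum>j\<in>J - {p}. (A q j - A q p * A r j / A r p) * c j) = 0" by blast
    define S where "S q = (\<Sum>j\<in>J - {p}. A q j * c j)" for q
    \<comment> \<open>The value at the pivot solves the equation \<open>r\<close>; for the other
      equations the elimination by row \<open>r\<close> has already accounted for this
      value.\<close>
    define c' where "c' = c(p := - S r / A r p)"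
    have sum: "(\<Sum>j\<in>J. A q j * c' j) = A q p * (- S r / A r p) + S q" for q
      using p insert.prems(1) by (simp add: sum.remove[of J p] c'_def S_def)
    have "(\<Sum>j\<in>J. A q j * c' j) = 0" if "q \<in> R" for q
    proof -
      have "0 = (\<Sum>j\<in>J - {p}. A q j * c j - A q p / A r p * (A r j * c j))"
        using c(2)[OF that] by (simp add: left_diff_distrib mult.assoc)
      also have "\<dots> = S q - A q p / A r p * S r"
        by (simp add: sum_subtractf S_def sum_distrib_left)
      finally show ?thesis by (simp add: sum)
    qed
    moreover have "(\<Sum>j\<in>J. A r j * c' j) = 0" using p by (simp add: sum)
    moreover have "\<exists>j\<in>J. c' j \<noteq> 0" using c(1) by (auto simp: c'_def)
    ultimately show ?thesis by auto
  qed
qed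

section \<open>Eigenfunctions of compact symmetric kernels\<close>

text \<open>The product bound is required at every point, so \<open>T f x\<close> is a convergent
  integral for every x and eigenvalue equations can hold everywhere, not just almost everywhere.
  Together with \<open>W_l2\<close> it makes the operator Hilbert-Schmidt, with norm at most the
  squared norm \<open>R\<close> of \<open>W\<close>.\<close>

locale hs_kernel = sigma_finite_measure M for M :: "'a measure" +
  fixes k :: "'a \<Rightarrow> 'a \<Rightarrow> real" and W :: "'a \<Rightarrow> real"
  assumes space_UNIV: "space M = UNIV"
    and kernel_measurable: "(\<lambda>(x, y). k x y) \<in> borel_measurable (M \<Otimes>\<^sub>M M)"
    and kernel_commute: "k x y = k y x"
    and kernel_bound: "\<bar>k x y\<bar> \<le> W x * W y"
    and W_l2: "W \<in> l2 M"
    and W_nonneg: "0 \<le> W x"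
begin

definition T :: "('a \<Rightarrow> real) \<Rightarrow> 'a \<Rightarrow> real" where
  "T f x = (\<integral>y. k x y * f y \<partial>M)"

lemma kernel_measurable_right: "(\<lambda>y. k x y) \<in> borel_measurable M"
  using measurable_Pair2[OF kernel_measurable, of x] by (simp add: space_UNIV)

lemma T_integrable:
  assumes f: "f \<in> l2 M"
  shows "integrable M (\<lambda>y. k x y * f y)"
proof (rule Bochner_Integration.integrable_bound)
  show "integrable M (\<lambda>y. W x * (W y * f y))"
    using l2_integrable_mult[OF W_l2 f] by simp
  show "(\<lambda>y. k x y * f y) \<in> borel_measurable M"
    using kernel_measurable_right l2_measurable[OF f] by simp
  have "\<bar>k x y * f y\<bar> \<le> \<bar>W x * (W y * f y)\<bar>" for y
    using mult_right_mono[OF kernel_bound, of "\<bar>f y\<bar>" x y] W_nonneg by (simp add: abs_mult mult.assoc)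
  then show "AE y in M. norm (k x y * f y) \<le> norm (W x * (W y * f y))" by simp
qed

lemma T_add: "f \<in> l2 M \<Longrightarrow> g \<in> l2 M \<Longrightarrow> T (\<lambda>x. f x + g x) = (\<lambda>x. T f x + T g x)"
  by (simp add: T_def fun_eq_iff distrib_left T_integrable)

lemma T_diff: "f \<in> l2 M \<Longrightarrow> g \<in> l2 M \<Longrightarrow> T (\<lambda>x. f x - g x) = (\<lambda>x. T f x - T g x)"
  by (simp add: T_def fun_eq_iff right_diff_distrib T_integrable)

lemma T_cmult: "T (\<lambda>x. c * f x) = (\<lambda>x. c * T f x)"
  by (simp add: T_def fun_eq_iff mult.left_commute)

lemma T_sum: "(\<And>j. j \<in> J \<Longrightarrow> f j \<in> l2 M) \<Longrightarrow> T (\<lambda>x. \<Sum>j\<in>J. f j x) = (\<lambda>x. \<Sum>j\<in>J. T (f j) x)"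
  by (simp add: T_def fun_eq_iff sum_distrib_left T_integrable)

definition R :: real where "R = ip M W W"

lemma R_nonneg [simp]: "0 \<le> R"
  by (simp add: R_def)

lemma T_abs_le:
  assumes f: "f \<in> l2 M"
  shows "\<bar>T f x\<bar> \<le> W x * sqrt (R * ip M f f)"
proof -
  have f': "(\<lambda>y. \<bar>f y\<bar>) \<in> l2 M"
    by (rule l2_bound[OF f]) (use l2_measurable[OF f] in auto)
  have "\<bar>T f x\<bar> \<le> (\<integral>y. \<bar>k x y * f y\<bar> \<partial>M)"
    unfolding T_def by (rule integral_abs_bound)
  also have "\<dots> \<le> (\<integral>y. W x * (W y * \<bar>f y\<bar>) \<partial>M)"
  proof (rule integral_mono)
    show "integrable M (\<lambda>y. \<bar>k x y * f y\<bar>)" using T_integrable[OF f] by simp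
    show "integrable M (\<lambda>y. W x * (W y * \<bar>f y\<bar>))" using l2_integrable_mult[OF W_l2 f'] by simp
    show "\<bar>k x y * f y\<bar> \<le> W x * (W y * \<bar>f y\<bar>)" for y
      using mult_right_mono[OF kernel_bound, of "\<bar>f y\<bar>" x y] by (simp add: abs_mult mult.assoc)
  qed
  also have "\<dots> = W x * ip M W (\<lambda>y. \<bar>f y\<bar>)" by (simp add: ip_def)
  also have "\<dots> \<le> W x * sqrt (R * ip M f f)"
  proof (rule mult_left_mono[OF _ W_nonneg], rule real_le_rsqrt)
    show "(ip M W (\<lambda>y. \<bar>f y\<bar>))\<^sup>2 \<le> R * ip M f f"
      using ip_Cauchy_Schwarz[OF W_l2 f'] by (simp add: R_def ip_def)
  qed
  finally show ?thesis .
qed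

lemma T_measurable:
  assumes "f \<in> borel_measurable M"
  shows "T f \<in> borel_measurable M"
proof -
  have "(\<lambda>(x, y). k x y * f y) \<in> borel_measurable (M \<Otimes>\<^sub>M M)"
    using borel_measurable_times[OF kernel_measurable measurable_compose[OF measurable_snd assms]]
    by (simp add: case_prod_unfold)
  then show ?thesis unfolding T_def[abs_def] by (rule borel_measurable_lebesgue_integral)
qed

lemma T_l2:
  assumes f: "f \<in> l2 M"
  shows "T f \<in> l2 M"
proof (rule l2_bound)
  show "(\<lambda>x. sqrt (R * ip M f f) * W x) \<in> l2 M" using W_l2 by simp
  show "\<bar>T f x\<bar> \<le> \<bar>sqrt (R * ip M f f) * W x\<bar>" for x
    using T_abs_le[OF f, of x] by (simp add: mult.commute)
qed (use f T_measurable l2_measurable in auto)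

lemma ip_T_T_le:
  assumes f: "f \<in> l2 M"
  shows "ip M (T f) (T f) \<le> R\<^sup>2 * ip M f f"
proof -
  define c where "c = sqrt (R * ip M f f)"
  have c2: "c * c = R * ip M f f" by (simp add: c_def)
  have cW: "(\<lambda>x. c * W x) \<in> l2 M" using W_l2 by simp
  have "ip M (T f) (T f) \<le> ip M (\<lambda>x. c * W x) (\<lambda>x. c * W x)"
    unfolding ip_def
  proof (rule integral_mono)
    fix x
    have "\<bar>T f x\<bar> \<le> \<bar>c * W x\<bar>"
      using T_abs_le[OF f, of x] by (simp add: c_def mult.commute)
    then show "T f x * T f x \<le> c * W x * (c * W x)"
      unfolding abs_le_square_iff power2_eq_square .
  qed (rule l2_integrable_mult[OF T_l2[OF f] T_l2[OF f]], rule l2_integrable_mult[OF cW cW])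
  also have "\<dots> = c * c * R" by (simp only: ip_cmult_left ip_cmult_right R_def mult.assoc)
  also have "\<dots> = R\<^sup>2 * ip M f f" unfolding c2 by (simp add: power2_eq_square)
  finally show ?thesis .
qed

lemma ip_T_abs_le:
  assumes f: "f \<in> l2 M"
  shows "\<bar>ip M (T f) f\<bar> \<le> R * ip M f f"
proof (rule power2_le_imp_le)
  have "(ip M (T f) f)\<^sup>2 \<le> ip M (T f) (T f) * ip M f f"
    by (rule ip_Cauchy_Schwarz[OF T_l2[OF f] f])
  also have "\<dots> \<le> R\<^sup>2 * ip M f f * ip M f f"
    by (intro mult_right_mono ip_T_T_le f) simp
  finally show "\<bar>ip M (T f) f\<bar>\<^sup>2 \<le> (R * ip M f f)\<^sup>2" by (simp add: power2_eq_square algebra_simps)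
qed simp

lemma T_self_adjoint:
  assumes f: "f \<in> l2 M" and g: "g \<in> l2 M"
  shows "ip M (T f) g = ip M f (T g)"
proof -
  interpret P: pair_sigma_finite M M ..
  have mf: "f \<in> borel_measurable M" and mg: "g \<in> borel_measurable M" using f g by (auto simp: l2_measurable)
  have meas: "(\<lambda>(x, y). k x y * f y * g x) \<in> borel_measurable (M \<Otimes>\<^sub>M M)"
    using borel_measurable_times[OF borel_measurable_times[OF kernel_measurable
        measurable_compose[OF measurable_snd mf]] measurable_compose[OF measurable_fst mg]]
    by (simp add: case_prod_unfold)
  have f': "(\<lambda>y. \<bar>f y\<bar>) \<in> l2 M" and g': "(\<lambda>y. \<bar>g y\<bar>) \<in> l2 M"
    using l2_bound[OF f, of "\<lambda>y. \<bar>f y\<bar>"] l2_bound[OF g, of "\<lambda>y. \<bar>g y\<bar>"] mf mg by auto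
  have "integrable (M \<Otimes>\<^sub>M M) (\<lambda>(x, y). k x y * f y * g x)"
  proof (rule P.Fubini_integrable[OF meas])
    show "AE x in M. integrable M (\<lambda>y. case (x, y) of (x, y) \<Rightarrow> k x y * f y * g x)"
      using T_integrable[OF f] by simp
    show "integrable M (\<lambda>x. \<integral>y. norm (case (x, y) of (x, y) \<Rightarrow> k x y * f y * g x) \<partial>M)"
    proof (rule Bochner_Integration.integrable_bound)
      show "integrable M (\<lambda>x. ip M W (\<lambda>y. \<bar>f y\<bar>) * (W x * \<bar>g x\<bar>))"
        using l2_integrable_mult[OF W_l2 g'] by simp
      show "(\<lambda>x. \<integral>y. norm (case (x, y) of (x, y) \<Rightarrow> k x y * f y * g x) \<partial>M) \<in> borel_measurable M"
        using meas by (intro borel_measurable_lebesgue_integral) (simp add: case_prod_unfold)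
      have "(\<integral>y. \<bar>k x y * f y * g x\<bar> \<partial>M) \<le> \<bar>ip M W (\<lambda>y. \<bar>f y\<bar>) * (W x * \<bar>g x\<bar>)\<bar>" for x
      proof -
        have "(\<integral>y. \<bar>k x y * f y * g x\<bar> \<partial>M) \<le> (\<integral>y. W x * \<bar>g x\<bar> * (W y * \<bar>f y\<bar>) \<partial>M)"
        proof (rule integral_mono)
          show "integrable M (\<lambda>y. \<bar>k x y * f y * g x\<bar>)" using T_integrable[OF f] by simp
          show "integrable M (\<lambda>y. W x * \<bar>g x\<bar> * (W y * \<bar>f y\<bar>))" using l2_integrable_mult[OF W_l2 f'] by simp
          show "\<bar>k x y * f y * g x\<bar> \<le> W x * \<bar>g x\<bar> * (W y * \<bar>f y\<bar>)" for y
            using mult_right_mono[OF kernel_bound, of "\<bar>f y\<bar> * \<bar>g x\<bar>" x y]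
            by (simp add: abs_mult algebra_simps)
        qed
        also have "\<dots> = ip M W (\<lambda>y. \<bar>f y\<bar>) * (W x * \<bar>g x\<bar>)" by (simp add: ip_def)
        finally show ?thesis by simp
      qed
      then show "AE x in M. norm (\<integral>y. norm (case (x, y) of (x, y) \<Rightarrow> k x y * f y * g x) \<partial>M)
          \<le> norm (ip M W (\<lambda>y. \<bar>f y\<bar>) * (W x * \<bar>g x\<bar>))" by simp
    qed
  qed
  then have "(\<integral>y. (\<integral>x. k x y * f y * g x \<partial>M) \<partial>M) = (\<integral>x. (\<integral>y. k x y * f y * g x \<partial>M) \<partial>M)"
    by (rule P.Fubini_integral)
  moreover have "(\<integral>y. (\<integral>x. k x y * f y * g x \<partial>M) \<partial>M) = ip M f (T g)"
  proof -
    have "(\<integral>x. k x y * f y * g x \<partial>M) = f y * T g y" for y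
    proof -
      have "(\<integral>x. k x y * f y * g x \<partial>M) = (\<integral>x. f y * (k y x * g x) \<partial>M)"
        by (simp add: kernel_commute[of _ y] algebra_simps)
      then show ?thesis by (simp add: T_def)
    qed
    then show ?thesis by (simp add: ip_def)
  qed
  moreover have "(\<integral>x. (\<integral>y. k x y * f y * g x \<partial>M) \<partial>M) = ip M (T f) g"
    by (simp add: ip_def T_def)
  ultimately show ?thesis by simp
qed

end

text \<open>Compactness is phrased by pointwise convergence. Since all \<open>T (F n)\<close> are
  dominated by the square integrable function \<open>W x * sqrt R\<close>, dominated convergence
  upgrades it to convergence in norm.\<close>

locale compact_kernel = hs_kernel +
  assumes compactness: "\<And>F. (\<And>n. F n \<in> l2 M) \<Longrightarrow> (\<And>n. ip M (F n) (F n) \<le> 1) \<Longrightarrow>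
    \<exists>r g. strict_mono (r :: nat \<Rightarrow> nat) \<and> (\<forall>x. (\<lambda>n. T (F (r n)) x) \<longlonglongrightarrow> g x)"
begin

text \<open>The Rayleigh quotient is maximised on the orthogonal complement \<open>P\<close> of the
  eigenfunctions found so far. The function \<open>v\<close> shows that the supremum
  \<open>s\<close> is at least \<open>t\<close>; the new eigenvalue is \<open>s\<close> itself and
  may exceed \<open>t\<close>. Positivity of \<open>s\<close> is what turns convergence of the
  images \<open>T (F n)\<close> into convergence of \<open>F n\<close>.\<close>

lemma eigenfunction_step:
  assumes on: "orthonormal M l e" and eig: "\<And>j x. j < l \<Longrightarrow> T (e j) x = lam j * e j x"
    and t: "0 < t" and v: "v \<in> l2 M" "\<And>j. j < l \<Longrightarrow> ip M v (e j) = 0" "0 < ip M v v"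
    and vt: "t * ip M v v \<le> ip M (T v) v"
  shows "\<exists>u s. t \<le> s \<and> u \<in> l2 M \<and> ip M u u = 1 \<and> (\<forall>j<l. ip M u (e j) = 0) \<and> (\<forall>x. T u x = s * u x)"
proof -
  define P where "P = {f \<in> l2 M. \<forall>j<l. ip M f (e j) = 0}"
  have e: "e j \<in> l2 M" if "j < l" for j using on that by (simp add: orthonormal_def)
  have P_add: "(\<lambda>x. f x + c * g x) \<in> P" if "f \<in> P" "g \<in> P" for f g c
    using that e by (simp add: P_def ip_linear)
  have P_cmult: "(\<lambda>x. c * f x) \<in> P" if "f \<in> P" for f c
    using that by (simp add: P_def ip_cmult_left)
  have P_l2: "f \<in> l2 M" if "f \<in> P" for f using that by (simp add: P_def)
  have P_T: "T f \<in> P" if f: "f \<in> P" for f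
  proof -
    have "ip M (T f) (e j) = 0" if j: "j < l" for j
    proof -
      have "T (e j) = (\<lambda>x. lam j * e j x)" using eig[OF j] by auto
      then show ?thesis using T_self_adjoint[OF P_l2[OF f] e[OF j]] f j by (simp add: ip_cmult_right P_def)
    qed
    then show ?thesis using T_l2[OF P_l2[OF f]] by (simp add: P_def)
  qed
  define A where "A = {ip M (T f) f | f. f \<in> P \<and> ip M f f = 1}"
  have normalise: "ip M (T f) f / ip M f f \<in> A" if f: "f \<in> P" "0 < ip M f f" for f
  proof -
    let ?c = "1 / sqrt (ip M f f)"
    have cc: "?c * ?c = 1 / ip M f f" using f(2) by simp
    have "ip M (\<lambda>x. ?c * f x) (\<lambda>x. ?c * f x) = ?c * ?c * ip M f f"
      by (simp only: ip_cmult_left ip_cmult_right mult.assoc)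
    moreover have "ip M (T (\<lambda>x. ?c * f x)) (\<lambda>x. ?c * f x) = ?c * ?c * ip M (T f) f"
      by (simp only: T_cmult ip_cmult_left ip_cmult_right mult.assoc)
    ultimately show ?thesis
      unfolding A_def cc using P_cmult[OF f(1), of ?c] f(2) by (intro CollectI exI[of _ "\<lambda>x. ?c * f x"]) auto
  qed
  have A_bdd: "bdd_above A"
    unfolding A_def using ip_T_abs_le P_l2 by (intro bdd_aboveI[of _ R]) fastforce
  have vP: "v \<in> P" using v by (simp add: P_def)
  define s where "s = Sup A"
  have "t \<le> ip M (T v) v / ip M v v" using v(3) vt by (simp add: pos_le_divide_eq)
  also have "\<dots> \<le> s" unfolding s_def by (intro cSup_upper normalise vP v A_bdd)
  finally have ts: "t \<le> s" .
  have s0: "s > 0" using ts t by simp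
  \<comment> \<open>Functions of norm zero cannot be normalised; for them the form vanishes by
    \<open>ip_T_abs_le\<close>.\<close>
  have form_le: "ip M (T f) f \<le> s * ip M f f" if f: "f \<in> P" for f
  proof (cases "ip M f f = 0")
    case True
    then show ?thesis using ip_T_abs_le[OF P_l2[OF f]] by simp
  next
    case False
    then have pos: "0 < ip M f f" by (rule ip_self_pos)
    have "ip M (T f) f / ip M f f \<le> s" unfolding s_def by (intro cSup_upper normalise f pos A_bdd)
    then show ?thesis using pos by (simp add: pos_divide_le_eq)
  qed
  have "\<exists>f. f \<in> P \<and> ip M f f = 1 \<and> s - 1 / Suc n < ip M (T f) f" for n
  proof -
    have "A \<noteq> {}" using normalise[OF vP v(3)] by blast
    then have "\<exists>a\<in>A. s - 1 / Suc n < a"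
      using less_cSup_iff[OF _ A_bdd, of "s - 1 / Suc n"] by (simp add: s_def)
    then show ?thesis by (auto simp: A_def)
  qed
  then obtain F where F: "\<And>n. F n \<in> P" "\<And>n. ip M (F n) (F n) = 1"
    "\<And>n. s - 1 / Suc n < ip M (T (F n)) (F n)" by metis
  have Fl2: "F n \<in> l2 M" for n using F(1) P_l2 by blast
  define d where "d n x = s * F n x - T (F n) x" for n x
  have d_P: "d n \<in> P" for n
  proof -
    have "d n = (\<lambda>x. s * F n x + (- 1) * T (F n) x)" by (simp add: d_def fun_eq_iff)
    then show ?thesis using P_add[OF P_cmult[OF F(1)[of n], of s] P_T[OF F(1)[of n]], of "- 1"] by (simp only:)
  qed
  \<comment> \<open>The form of s - T is nonnegative on \<open>P\<close> and \<open>d n\<close>, the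
    image of \<open>F n\<close> under s - T, lies in \<open>P\<close>. The Cauchy-Schwarz inequality
    for this form bounds the squared norm of \<open>d n\<close> by s + R times the defect of
    \<open>F n\<close> from the supremum, which is less than \<open>1 / Suc n\<close>.\<close>
  have d_small: "ip M (d n) (d n) \<le> (s + R) * (1 / Suc n)" for n
  proof -
    let ?v = "d n" and ?f = "F n"
    have l: "?v \<in> l2 M" "?f \<in> l2 M" "T ?v \<in> l2 M" "T ?f \<in> l2 M"
      using d_P P_l2 Fl2 T_l2 by auto
    define a where "a = s * ip M ?f ?f - ip M (T ?f) ?f"
    define c where "c = s * ip M ?v ?v - ip M (T ?v) ?v"
    have b: "s * ip M ?f ?v - ip M (T ?f) ?v = ip M ?v ?v"
    proof -
      have "ip M ?v ?v = ip M (\<lambda>x. s * ?f x - T ?f x) ?v" by (simp add: d_def[abs_def])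
      then show ?thesis using l by (simp add: ip_linear)
    qed
    have "(ip M ?v ?v)\<^sup>2 \<le> a * c"
    proof (rule discriminant_le)
      fix \<tau>
      have "0 \<le> s * ip M (\<lambda>x. ?f x + \<tau> * ?v x) (\<lambda>x. ?f x + \<tau> * ?v x)
          - ip M (T (\<lambda>x. ?f x + \<tau> * ?v x)) (\<lambda>x. ?f x + \<tau> * ?v x)"
        using form_le[OF P_add[OF F(1) d_P]] by simp
      also have "\<dots> = a + 2 * \<tau> * (s * ip M ?f ?v - ip M (T ?f) ?v) + \<tau>\<^sup>2 * c"
        using l ip_commute[of M ?v ?f] T_self_adjoint[OF l(1,2)] ip_commute[of M "T ?f" ?v]
        by (simp add: T_add T_cmult ip_linear a_def c_def algebra_simps power2_eq_square)
      finally show "0 \<le> a + 2 * \<tau> * ip M ?v ?v + \<tau>\<^sup>2 * c" unfolding b .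
    qed (use form_le[OF d_P] in \<open>simp add: c_def\<close>)
    also have "\<dots> \<le> a * ((s + R) * ip M ?v ?v)"
    proof (rule mult_left_mono)
      show "c \<le> (s + R) * ip M ?v ?v"
        using ip_T_abs_le[OF l(1)] by (simp add: c_def algebra_simps abs_le_iff)
      show "0 \<le> a" using form_le[OF F(1)] by (simp add: a_def)
    qed
    finally have *: "ip M ?v ?v * ip M ?v ?v \<le> (a * (s + R)) * ip M ?v ?v"
      by (simp add: power2_eq_square algebra_simps)
    have "0 \<le> a" using form_le[OF F(1)] by (simp add: a_def)
    then have "ip M ?v ?v \<le> a * (s + R)"
    proof (cases "ip M ?v ?v = 0")
      case False
      then have "0 < ip M ?v ?v" by (rule ip_self_pos)
      then show ?thesis using * by (rule mult_right_le_imp_le[rotated])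
    qed (use s0 in auto)
    also have "\<dots> \<le> (1 / Suc n) * (s + R)"
      using F(2,3)[of n] s0 by (intro mult_right_mono) (auto simp: a_def)
    finally show ?thesis by (simp add: mult.commute)
  qed
  obtain r g where r: "strict_mono (r :: nat \<Rightarrow> nat)" and g: "\<And>x. (\<lambda>n. T (F (r n)) x) \<longlonglongrightarrow> g x"
    using compactness[of F] Fl2 F(2) by (metis order_refl)
  have TF_le: "\<bar>T (F n) x\<bar> \<le> W x * sqrt R" for n x
    using T_abs_le[OF Fl2] F(2) by simp
  have g_le: "\<bar>g x\<bar> \<le> W x * sqrt R" for x
    by (rule tendsto_upperbound[OF tendsto_rabs[OF g]]) (use TF_le in auto)
  have g_meas: "g \<in> borel_measurable M"
    by (rule borel_measurable_LIMSEQ_real[OF g]) (use T_l2[OF Fl2] l2_measurable in auto)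
  have gl2: "g \<in> l2 M"
    by (rule l2_bound[OF l2_cmult[OF W_l2, of "sqrt R"] g_meas])
      (use g_le W_nonneg in \<open>simp add: abs_mult mult.commute\<close>)
  define h where "h n x = s * F (r n) x - g x" for n x
  have hl2: "h n \<in> l2 M" for n using Fl2 gl2 by (simp add: h_def[abs_def])
  have conv1: "(\<lambda>n. ip M (d (r n)) (d (r n))) \<longlonglongrightarrow> 0"
  proof (rule tendsto_sandwich[OF _ _ tendsto_const])
    have "(\<lambda>n. (s + R) * (1 / Suc n)) \<longlonglongrightarrow> (s + R) * 0"
      by (intro tendsto_mult_left) (rule LIMSEQ_inverse_real_of_nat[unfolded inverse_eq_divide])
    then have "((\<lambda>n. (s + R) * (1 / Suc n)) \<circ> r) \<longlonglongrightarrow> (s + R) * 0"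
      by (rule LIMSEQ_subseq_LIMSEQ[OF _ r])
    then show "(\<lambda>n. (s + R) * (1 / Suc (r n))) \<longlonglongrightarrow> 0" by (simp add: o_def)
    show "\<forall>\<^sub>F n in sequentially. ip M (d (r n)) (d (r n)) \<le> (s + R) * (1 / Suc (r n))"
      by (intro always_eventually allI d_small)
  qed simp
  have conv2: "(\<lambda>n. ip M (\<lambda>x. T (F (r n)) x - g x) (\<lambda>x. T (F (r n)) x - g x)) \<longlonglongrightarrow> 0"
  proof -
    have "(\<lambda>n. \<integral>x. (T (F (r n)) x - g x) * (T (F (r n)) x - g x) \<partial>M) \<longlonglongrightarrow> (\<integral>x. 0 \<partial>M)"
    proof (rule integral_dominated_convergence)
      show "integrable M (\<lambda>x. (2 * sqrt R * W x)\<^sup>2)"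
        by (rule l2_integrable_square) (use l2_cmult[OF W_l2] in auto)
      show "AE x in M. (\<lambda>n. (T (F (r n)) x - g x) * (T (F (r n)) x - g x)) \<longlonglongrightarrow> 0"
      proof (rule AE_I2)
        fix x
        have "(\<lambda>n. (T (F (r n)) x - g x) * (T (F (r n)) x - g x)) \<longlonglongrightarrow> (g x - g x) * (g x - g x)"
          by (intro tendsto_intros g)
        then show "(\<lambda>n. (T (F (r n)) x - g x) * (T (F (r n)) x - g x)) \<longlonglongrightarrow> 0" by simp
      qed
      show "AE x in M. norm ((T (F (r n)) x - g x) * (T (F (r n)) x - g x)) \<le> (2 * sqrt R * W x)\<^sup>2" for n
      proof (rule AE_I2)
        fix x
        have "\<bar>T (F (r n)) x - g x\<bar> \<le> \<bar>2 * sqrt R * W x\<bar>"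
          using TF_le[of "r n" x] g_le[of x] W_nonneg[of x] by (simp add: abs_mult algebra_simps)
        then show "norm ((T (F (r n)) x - g x) * (T (F (r n)) x - g x)) \<le> (2 * sqrt R * W x)\<^sup>2"
          unfolding abs_le_square_iff by (simp add: power2_eq_square)
      qed
      show "(\<lambda>x. (T (F (r n)) x - g x) * (T (F (r n)) x - g x)) \<in> borel_measurable M" for n
        by (intro borel_measurable_times borel_measurable_diff g_meas l2_measurable[OF T_l2[OF Fl2]])
    qed simp
    then show ?thesis by (simp add: ip_def)
  qed
  \<comment> \<open>\<open>h n\<close> is the sum of \<open>d (r n)\<close> and of
    \<open>T (F (r n)) - g\<close>, both of which tend to 0 in norm.\<close>
  have hh: "(\<lambda>n. ip M (h n) (h n)) \<longlonglongrightarrow> 0"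
  proof (rule tendsto_sandwich[OF _ _ tendsto_const])
    let ?q = "\<lambda>n x. T (F (r n)) x - g x"
    show "(\<lambda>n. 2 * ip M (d (r n)) (d (r n)) + 2 * ip M (?q n) (?q n)) \<longlonglongrightarrow> 0"
      using tendsto_add[OF tendsto_mult_left[OF conv1, of 2] tendsto_mult_left[OF conv2, of 2]] by simp
    have "ip M (h n) (h n) \<le> 2 * ip M (d (r n)) (d (r n)) + 2 * ip M (?q n) (?q n)" for n
    proof -
      have l: "d (r n) \<in> l2 M" "?q n \<in> l2 M" using d_P P_l2 T_l2[OF Fl2] gl2 by auto
      have "h n = (\<lambda>x. d (r n) x + ?q n x)" by (simp add: h_def d_def fun_eq_iff)
      then have "ip M (h n) (h n) = ip M (d (r n)) (d (r n)) + 2 * ip M (d (r n)) (?q n) + ip M (?q n) (?q n)"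
        using ip_add_left[OF l l2_add[OF l]] ip_add_right[OF l l(1)] ip_add_right[OF l l(2)]
          ip_commute[of M "?q n" "d (r n)"] by simp
      moreover have "0 \<le> ip M (\<lambda>x. d (r n) x - ?q n x) (\<lambda>x. d (r n) x - ?q n x)" by simp
      then have "0 \<le> ip M (d (r n)) (d (r n)) - 2 * ip M (d (r n)) (?q n) + ip M (?q n) (?q n)"
        using ip_diff_left[OF l l2_diff[OF l]] ip_diff_right[OF l l(1)] ip_diff_right[OF l l(2)]
          ip_commute[of M "?q n" "d (r n)"] by simp
      ultimately show ?thesis by simp
    qed
    then show "\<forall>\<^sub>F n in sequentially. ip M (h n) (h n) \<le> 2 * ip M (d (r n)) (d (r n)) + 2 * ip M (?q n) (?q n)"
      by simp
  qed simp
  have g_perp: "ip M g (e j) = 0" if j: "j < l" for j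
  proof -
    have "ip M (h n) (e j) = - ip M g (e j)" for n
      unfolding h_def[abs_def] using F(1)[of "r n"] j gl2 Fl2[of "r n"] e[OF j] by (simp add: ip_linear P_def)
    then have "(\<lambda>n. - ip M g (e j)) \<longlonglongrightarrow> 0"
      using ip_tendsto_zero[OF hl2 e[OF j] hh] by simp
    then show ?thesis by (simp add: LIMSEQ_const_iff)
  qed
  \<comment> \<open>\<open>g\<close> is the norm limit of \<open>s * F (r n)\<close> with normalised
    \<open>F (r n)\<close>. In particular the limit does not vanish, and dividing it by
    \<open>s\<close> normalises it.\<close>
  have gg: "ip M g g = s\<^sup>2"
  proof -
    have "s\<^sup>2 = ip M (h n) (h n) + 2 * ip M (h n) g + ip M g g" for n
    proof -
      have "(\<lambda>x. s * F (r n) x) = (\<lambda>x. h n x + g x)" by (simp add: h_def fun_eq_iff)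
      then have "ip M (\<lambda>x. s * F (r n) x) (\<lambda>x. s * F (r n) x) = ip M (\<lambda>x. h n x + g x) (\<lambda>x. h n x + g x)"
        by simp
      then show ?thesis
        using hl2[of n] gl2 ip_commute[of M g "h n"] F(2)[of "r n"]
        by (simp add: ip_linear power2_eq_square)
    qed
    moreover have "(\<lambda>n. ip M (h n) (h n) + 2 * ip M (h n) g + ip M g g) \<longlonglongrightarrow> 0 + 2 * 0 + ip M g g"
      by (intro tendsto_intros hh ip_tendsto_zero[OF hl2 gl2 hh])
    ultimately have "(\<lambda>n::nat. s\<^sup>2) \<longlonglongrightarrow> ip M g g" by simp
    then show ?thesis by (simp add: LIMSEQ_const_iff)
  qed
  \<comment> \<open>Norm convergence of \<open>h n\<close> to 0 implies pointwise convergence of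
    \<open>T (h n)\<close> by \<open>T_abs_le\<close>, so the equation holds at every x.\<close>
  have Tg: "T g x = s * g x" for x
  proof -
    have "(\<lambda>n. T (h n) x) \<longlonglongrightarrow> 0"
    proof (rule Lim_null_comparison)
      have "(\<lambda>n. W x * sqrt (R * ip M (h n) (h n))) \<longlonglongrightarrow> W x * sqrt (R * 0)"
        by (intro tendsto_intros hh)
      then show "(\<lambda>n. W x * sqrt (R * ip M (h n) (h n))) \<longlonglongrightarrow> 0" by simp
      show "\<forall>\<^sub>F n in sequentially. norm (T (h n) x) \<le> W x * sqrt (R * ip M (h n) (h n))"
        using T_abs_le[OF hl2] by simp
    qed
    moreover have "T (h n) x = s * T (F (r n)) x - T g x" for n
      unfolding h_def[abs_def] using Fl2 gl2 by (simp add: T_diff T_cmult)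
    moreover have "(\<lambda>n. s * T (F (r n)) x - T g x) \<longlonglongrightarrow> s * g x - T g x"
      by (intro tendsto_intros g)
    ultimately have "s * g x - T g x = 0" using LIMSEQ_unique by fastforce
    then show ?thesis by simp
  qed
  define u where "u x = (1 / s) * g x" for x
  have "u \<in> l2 M" unfolding u_def[abs_def] by (intro l2_cmult gl2)
  moreover have "ip M u u = 1"
    unfolding u_def[abs_def] ip_cmult_left ip_cmult_right gg using s0 by (simp add: power2_eq_square)
  moreover have "\<forall>j<l. ip M u (e j) = 0"
    unfolding u_def[abs_def] ip_cmult_left using g_perp by simp
  moreover have "\<forall>x. T u x = s * u x"
    unfolding u_def[abs_def] T_cmult Tg by simp
  ultimately show ?thesis using ts by blast
qed

end

section \<open>Eigenvalue thresholds and the two halves of the min-max principle\<close>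

definition eigenvalue_bounds :: "('a \<Rightarrow> 'a \<Rightarrow> real) \<Rightarrow> 'a measure \<Rightarrow> nat \<Rightarrow> real set" where
  "eigenvalue_bounds k M i = {t. t > 0 \<and> (\<exists>(f :: nat \<Rightarrow> 'a \<Rightarrow> real) (lam :: nat \<Rightarrow> real).
            (\<forall>j<i. f j \<in> borel_measurable M \<and> integrable M (\<lambda>x. (f j x)\<^sup>2) \<and> lam j \<ge> t \<and>
               (AE x in M. integrable M (\<lambda>y. k x y * f j y) \<and>
                           (\<integral>y. k x y * f j y \<partial>M) = lam j * f j x)) \<and>
            (\<forall>c :: nat \<Rightarrow> real. (AE x in M. (\<Sum>j<i. c j * f j x) = 0) \<longrightarrow> (\<forall>j<i. c j = 0)))}"

lemma int_op_eigenvalue_eq: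
  "int_op_eigenvalue k M i = (if eigenvalue_bounds k M i = {} then 0 else Sup (eigenvalue_bounds k M i))"
  unfolding int_op_eigenvalue_def eigenvalue_bounds_def Let_def ..

lemma int_op_eigenvalue_le:
  assumes "\<And>s. s \<in> eigenvalue_bounds k M i \<Longrightarrow> s \<le> u" "0 \<le> u"
  shows "int_op_eigenvalue k M i \<le> u"
  using assms by (auto simp: int_op_eigenvalue_eq intro: cSup_least)

text \<open>The bound \<open>u\<close> is there because \<open>Sup\<close> says nothing about a set
  of reals that is unbounded above.\<close>

lemma int_op_eigenvalue_ge:
  assumes "t \<in> eigenvalue_bounds k M i" "\<And>s. s \<in> eigenvalue_bounds k M i \<Longrightarrow> s \<le> u"
  shows "t \<le> int_op_eigenvalue k M i"
  using assms by (auto simp: int_op_eigenvalue_eq intro!: cSup_upper bdd_aboveI[of _ u])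

lemma ip_sum_sum:
  assumes "\<And>j. j \<in> J \<Longrightarrow> f j \<in> l2 M" "\<And>j. j \<in> J \<Longrightarrow> h j \<in> l2 M"
  shows "ip M (\<lambda>x. \<Sum>j\<in>J. c j * f j x) (\<lambda>x. \<Sum>l\<in>J. d l * h l x)
    = (\<Sum>j\<in>J. \<Sum>l\<in>J. c j * d l * ip M (f j) (h l))"
proof -
  have "ip M (\<lambda>x. \<Sum>j\<in>J. c j * f j x) (\<lambda>x. \<Sum>l\<in>J. d l * h l x)
      = (\<Sum>j\<in>J. ip M (\<lambda>x. c j * f j x) (\<lambda>x. \<Sum>l\<in>J. d l * h l x))"
    using assms by (intro ip_sum_left l2_sum l2_cmult)
  also have "\<dots> = (\<Sum>j\<in>J. \<Sum>l\<in>J. ip M (\<lambda>x. c j * f j x) (\<lambda>x. d l * h l x))"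
    using assms by (intro sum.cong refl ip_sum_right l2_cmult)
  also have "\<dots> = (\<Sum>j\<in>J. \<Sum>l\<in>J. c j * d l * ip M (f j) (h l))"
    by (simp only: ip_cmult_left ip_cmult_right mult.assoc)
  finally show ?thesis .
qed

lemma orthonormal_independent:
  assumes on: "orthonormal M n e" and AE: "AE x in M. (\<Sum>j<n. c j * e j x) = 0" and j: "j < n"
  shows "c j = 0"
proof -
  have e: "e l \<in> l2 M" if "l < n" for l using on that by (simp add: orthonormal_def)
  have "ip M (\<lambda>x. \<Sum>l<n. c l * e l x) (e j) = (\<Sum>l<n. c l * ip M (e l) (e j))"
    by (subst ip_sum_left) (auto simp: e j ip_cmult_left)
  also have "\<dots> = (\<Sum>l<n. if l = j then c l else 0)"
    using on j by (intro sum.cong) (auto simp: orthonormal_def)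
  also have "\<dots> = c j" using j by simp
  finally have "c j = (\<integral>x. (\<Sum>l<n. c l * e l x) * e j x \<partial>M)" by (simp add: ip_def)
  also have "\<dots> = (\<integral>x. 0 \<partial>M)"
  proof (rule integral_cong_AE)
    have "(\<lambda>x. \<Sum>l<n. c l * e l x) \<in> l2 M" by (intro l2_sum l2_cmult e) auto
    then show "(\<lambda>x. (\<Sum>l<n. c l * e l x) * e j x) \<in> borel_measurable M"
      by (intro borel_measurable_times l2_measurable e j)
    show "AE x in M. (\<Sum>l<n. c l * e l x) * e j x = 0" using AE by eventually_elim simp
  qed simp
  finally show ?thesis by simp
qed

lemma ip_self_eq_zero_AE:
  assumes "f \<in> l2 M" "ip M f f = 0"
  shows "AE x in M. f x = 0"
proof -
  have "AE x in M. f x * f x = 0"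
    using assms l2_integrable_mult[OF assms(1,1)]
    by (subst integral_nonneg_eq_0_iff_AE[symmetric]) (auto simp: ip_def)
  then show ?thesis by eventually_elim simp
qed

lemma ip_cong_AE_left:
  assumes "f \<in> l2 M" "f' \<in> l2 M" "g \<in> l2 M" "AE x in M. f x = f' x"
  shows "ip M f g = ip M f' g"
  unfolding ip_def
proof (rule integral_cong_AE)
  show "AE x in M. f x * g x = f' x * g x" using assms(4) by eventually_elim simp
  show "(\<lambda>x. f x * g x) \<in> borel_measurable M" "(\<lambda>x. f' x * g x) \<in> borel_measurable M"
    by (intro borel_measurable_times l2_measurable assms)+
qed

context compact_kernel
begin

text \<open>The half of the min-max principle for lower bounds. Eigenfunctions are produced one
  after the other: as long as fewer than \<open>card J\<close> are known, the span of
  \<open>v\<close> contains a combination orthogonal to all of them, and this feeds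
  \<open>eigenfunction_step\<close>. The assumption \<open>pos\<close> is linear independence of
  \<open>v\<close> modulo null sets.\<close>

lemma eigenvalue_bounds_memI:
  fixes v :: "'j \<Rightarrow> 'a \<Rightarrow> real"
  assumes J: "finite J" and t: "0 < t" and v: "\<And>j. j \<in> J \<Longrightarrow> v j \<in> l2 M"
    and pos: "\<And>c. \<exists>j\<in>J. c j \<noteq> 0 \<Longrightarrow> 0 < ip M (\<lambda>x. \<Sum>j\<in>J. c j * v j x) (\<lambda>x. \<Sum>j\<in>J. c j * v j x)"
    and form: "\<And>c. t * ip M (\<lambda>x. \<Sum>j\<in>J. c j * v j x) (\<lambda>x. \<Sum>j\<in>J. c j * v j x)
      \<le> ip M (T (\<lambda>x. \<Sum>j\<in>J. c j * v j x)) (\<lambda>x. \<Sum>j\<in>J. c j * v j x)"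
    and i: "i \<le> card J"
  shows "t \<in> eigenvalue_bounds k M i"
proof -
  have "\<exists>e lam. orthonormal M l e \<and> (\<forall>j<l. t \<le> lam j \<and> (\<forall>x. T (e j) x = lam j * e j x))" if "l \<le> i" for l
    using that
  proof (induction l)
    case 0
    show ?case by simp
  next
    case (Suc l)
    then obtain e lam where e: "orthonormal M l e"
      and lam: "\<And>j. j < l \<Longrightarrow> t \<le> lam j" "\<And>j x. j < l \<Longrightarrow> T (e j) x = lam j * e j x" by auto
    have el: "e j \<in> l2 M" if "j < l" for j using e that by (simp add: orthonormal_def)
    have "card {..<l} < card J" using Suc.prems i by simp
    from exists_nontrivial_solution[OF _ J this, of "\<lambda>r j. ip M (v j) (e r)"]
    obtain c where c: "\<exists>j\<in>J. c j \<noteq> 0" "\<And>r. r < l \<Longrightarrow> (\<Sum>j\<in>J. ip M (v j) (e r) * c j) = 0"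
      by auto
    let ?f = "\<lambda>x. \<Sum>j\<in>J. c j * v j x"
    have f: "?f \<in> l2 M" by (intro l2_sum l2_cmult v)
    have perp: "ip M ?f (e r) = 0" if "r < l" for r
    proof -
      have "ip M ?f (e r) = (\<Sum>j\<in>J. ip M (\<lambda>x. c j * v j x) (e r))"
        by (intro ip_sum_left l2_cmult v el that)
      then show ?thesis using c(2)[OF that] by (simp add: ip_cmult_left mult.commute)
    qed
    obtain u s where u: "t \<le> s" "u \<in> l2 M" "ip M u u = 1" "\<forall>j<l. ip M u (e j) = 0" "\<forall>x. T u x = s * u x"
      using eigenfunction_step[OF e lam(2) t f perp pos[OF c(1)] form] by blast
    have "orthonormal M (Suc l) (e(l := u))"
      using u by (intro orthonormal_extend e) auto
    moreover have "\<forall>j<Suc l. t \<le> (lam(l := s)) j \<and> (\<forall>x. T ((e(l := u)) j) x = (lam(l := s)) j * (e(l := u)) j x)"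
      using lam u by (auto simp: less_Suc_eq)
    ultimately show ?case by blast
  qed
  then obtain e lam where e: "orthonormal M i e"
    and lam: "\<And>j. j < i \<Longrightarrow> t \<le> lam j" "\<And>j x. j < i \<Longrightarrow> T (e j) x = lam j * e j x" by blast
  have el: "e j \<in> l2 M" if "j < i" for j using e that by (simp add: orthonormal_def)
  have "\<forall>j<i. e j \<in> borel_measurable M \<and> integrable M (\<lambda>x. (e j x)\<^sup>2) \<and> lam j \<ge> t \<and>
      (AE x in M. integrable M (\<lambda>y. k x y * e j y) \<and> (\<integral>y. k x y * e j y \<partial>M) = lam j * e j x)"
  proof (intro allI impI conjI AE_I2)
    fix j x assume j: "j < i"
    show "e j \<in> borel_measurable M" "integrable M (\<lambda>x. (e j x)\<^sup>2)"
      using el[OF j] by (auto simp: l2_def)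
    show "t \<le> lam j" by (rule lam(1)[OF j])
    show "integrable M (\<lambda>y. k x y * e j y)" by (rule T_integrable[OF el[OF j]])
    show "(\<integral>y. k x y * e j y \<partial>M) = lam j * e j x" using lam(2)[OF j, of x] by (simp add: T_def)
  qed
  then show ?thesis
    unfolding eigenvalue_bounds_def using t orthonormal_independent[OF e] by blast
qed

end

context hs_kernel
begin

text \<open>The half of the min-max principle for upper bounds. The given eigenfunctions span a
  space of dimension i on which the form is at least t times the squared norm; each function in
  \<open>H\<close> costs one dimension, and n orthonormal functions can still be selected from the
  rest.\<close>

lemma orthonormal_of_eigenvalue_bound:
  assumes t: "t \<in> eigenvalue_bounds k M i" and H: "finite H" "H \<subseteq> l2 M" and n: "n + card H \<le> i"
  shows "\<exists>g. orthonormal M n g \<and> (\<forall>l<n. t \<le> ip M (T (g l)) (g l)) \<and> (\<forall>l<n. \<forall>h\<in>H. ip M (g l) h = 0)"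
proof -
  obtain f :: "nat \<Rightarrow> 'a \<Rightarrow> real" and lam :: "nat \<Rightarrow> real"
    where all: "\<forall>j<i. f j \<in> borel_measurable M \<and> integrable M (\<lambda>x. (f j x)\<^sup>2) \<and> lam j \<ge> t \<and>
               (AE x in M. integrable M (\<lambda>y. k x y * f j y) \<and> (\<integral>y. k x y * f j y \<partial>M) = lam j * f j x)"
    and ind: "\<forall>c :: nat \<Rightarrow> real. (AE x in M. (\<Sum>j<i. c j * f j x) = 0) \<longrightarrow> (\<forall>j<i. c j = 0)"
    using t unfolding eigenvalue_bounds_def by auto
  have f: "f j \<in> l2 M" and lam: "t \<le> lam j" if "j < i" for j
    using all that by (auto simp: l2_def)
  have eig: "AE x in M. T (f j) x = lam j * f j x" if "j < i" for j
  proof -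
    have "AE x in M. integrable M (\<lambda>y. k x y * f j y) \<and> (\<integral>y. k x y * f j y \<partial>M) = lam j * f j x"
      using all that by blast
    then show ?thesis by eventually_elim (simp add: T_def)
  qed
  define V where "V c x = (\<Sum>j<i. c j * f j x)" for c x
  have V: "V c \<in> l2 M" for c unfolding V_def[abs_def] by (intro l2_sum l2_cmult f) auto
  have Tf: "ip M (T (f j)) (f l) = lam j * ip M (f j) (f l)" if "j < i" "l < i" for j l
    using ip_cong_AE_left[OF T_l2[OF f] l2_cmult[OF f] f eig] that by (simp add: ip_cmult_left)
  have swap: "(lam j - lam l) * ip M (f j) (f l) = 0" if "j < i" "l < i" for j l
  proof -
    have "lam j * ip M (f j) (f l) = ip M (f j) (T (f l))"
      using Tf[OF that] T_self_adjoint[OF f f] that by simp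
    also have "\<dots> = lam l * ip M (f j) (f l)"
      using Tf[OF that(2,1)] ip_commute[of M "f j"] by simp
    finally show ?thesis by (simp add: algebra_simps)
  qed
  text \<open>Eigenfunctions of different eigenvalues are orthogonal, so \<open>lam\<close> may be replaced
    by its square roots on both sides.\<close>
  have form: "t * ip M (V c) (V c) \<le> ip M (T (V c)) (V c)" for c
  proof -
    define d where "d j = c j * sqrt (lam j - t)" for j
    have TV: "T (V c) = (\<lambda>x. \<Sum>j<i. c j * T (f j) x)"
    proof -
      have "T (V c) = (\<lambda>x. \<Sum>j<i. T (\<lambda>x. c j * f j x) x)"
        unfolding V_def[abs_def] by (intro T_sum l2_cmult f) auto
      then show ?thesis by (simp only: T_cmult)
    qed
    have "ip M (T (V c)) (V c) = (\<Sum>j<i. \<Sum>l<i. c j * c l * ip M (T (f j)) (f l))"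
      unfolding TV unfolding V_def[abs_def] by (intro ip_sum_sum T_l2 f) auto
    moreover have "ip M (V c) (V c) = (\<Sum>j<i. \<Sum>l<i. c j * c l * ip M (f j) (f l))"
      unfolding V_def[abs_def] by (intro ip_sum_sum f) auto
    moreover have "ip M (V d) (V d) = (\<Sum>j<i. \<Sum>l<i. d j * d l * ip M (f j) (f l))"
      unfolding V_def[abs_def] by (intro ip_sum_sum f) auto
    moreover have "c j * c l * ip M (T (f j)) (f l) = t * (c j * c l * ip M (f j) (f l)) + d j * d l * ip M (f j) (f l)"
      if jl: "j < i" "l < i" for j l
    proof (cases "ip M (f j) (f l) = 0")
      case False
      then have "lam j = lam l" using swap[OF jl] by simp
      then have "d j * d l = c j * c l * (lam j - t)"
        using lam[OF jl(1)] by (simp add: d_def)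
      then have "d j * d l * ip M (f j) (f l) = c j * c l * (lam j - t) * ip M (f j) (f l)" by simp
      then show ?thesis unfolding Tf[OF jl] by (simp add: algebra_simps)
    qed (simp add: Tf[OF jl])
    then have "(\<Sum>j<i. \<Sum>l<i. c j * c l * ip M (T (f j)) (f l))
        = t * (\<Sum>j<i. \<Sum>l<i. c j * c l * ip M (f j) (f l)) + (\<Sum>j<i. \<Sum>l<i. d j * d l * ip M (f j) (f l))"
      by (simp add: sum_distrib_left sum.distrib[symmetric])
    ultimately have "ip M (T (V c)) (V c) = t * ip M (V c) (V c) + ip M (V d) (V d)" by simp
    then show ?thesis by simp
  qed
  \<comment> \<open>Gram-Schmidt by counting: orthogonality to \<open>H\<close> and to the functions
    already selected imposes fewer than i equations on the i coefficients, so a nontrivial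
    combination remains. Independence modulo null sets makes its norm positive.\<close>
  have "\<exists>g. orthonormal M n g \<and> (\<forall>l<n. \<exists>c. g l = V c) \<and> (\<forall>l<n. \<forall>h\<in>H. ip M (g l) h = 0)"
    using n
  proof (induction n)
    case 0
    show ?case by simp
  next
    case (Suc n)
    then obtain g where g: "orthonormal M n g" "\<And>l. l < n \<Longrightarrow> \<exists>c. g l = V c"
      "\<And>l h. l < n \<Longrightarrow> h \<in> H \<Longrightarrow> ip M (g l) h = 0" by auto
    have gl: "g l \<in> l2 M" if "l < n" for l using g(1) that by (simp add: orthonormal_def)
    have "card (H \<union> g ` {..<n}) \<le> card H + card (g ` {..<n})" by (rule card_Un_le)
    also have "\<dots> \<le> card H + n" using card_image_le[of "{..<n}" g] by simp
    also have "\<dots> < card {..<i}" using Suc.prems by simp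
    finally have "card (H \<union> g ` {..<n}) < card {..<i}" .
    from exists_nontrivial_solution[OF _ _ this, of "\<lambda>r j. ip M (f j) r"] H(1)
    obtain c where c: "\<exists>j<i. c j \<noteq> 0" "\<And>r. r \<in> H \<union> g ` {..<n} \<Longrightarrow> (\<Sum>j<i. ip M (f j) r * c j) = 0"
      by auto
    have perp: "ip M (V c) r = 0" if r: "r \<in> H \<union> g ` {..<n}" for r
    proof -
      have "r \<in> l2 M" using r H(2) gl by auto
      then have "ip M (V c) r = (\<Sum>j<i. ip M (\<lambda>x. c j * f j x) r)"
        unfolding V_def[abs_def] by (intro ip_sum_left l2_cmult f) auto
      then show ?thesis using c(2)[OF r] by (simp add: ip_cmult_left mult.commute)
    qed
    have "ip M (V c) (V c) \<noteq> 0"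
    proof
      assume "ip M (V c) (V c) = 0"
      then have "AE x in M. V c x = 0" by (rule ip_self_eq_zero_AE[OF V])
      then have "\<forall>j<i. c j = 0" unfolding V_def using ind by blast
      then show False using c(1) by blast
    qed
    then have pos: "0 < ip M (V c) (V c)" by (rule ip_self_pos)
    define a where "a = 1 / sqrt (ip M (V c) (V c))"
    have aa: "a * a * ip M (V c) (V c) = 1" using pos by (simp add: a_def)
    have Va: "V (\<lambda>j. a * c j) = (\<lambda>x. a * V c x)"
      by (simp add: V_def fun_eq_iff sum_distrib_left mult.assoc)
    have one: "ip M (V (\<lambda>j. a * c j)) (V (\<lambda>j. a * c j)) = 1"
      unfolding Va ip_cmult_left ip_cmult_right using aa by (simp add: mult.assoc)
    have perp': "ip M (V (\<lambda>j. a * c j)) r = 0" if "r \<in> H \<union> g ` {..<n}" for r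
      unfolding Va ip_cmult_left using perp[OF that] by simp
    define g' where "g' = g(n := V (\<lambda>j. a * c j))"
    have "orthonormal M (Suc n) g'"
      unfolding g'_def using perp' by (intro orthonormal_extend g V one) auto
    moreover have "\<forall>l<Suc n. \<exists>c. g' l = V c"
      using g(2) by (auto simp: g'_def less_Suc_eq)
    moreover have "\<forall>l<Suc n. \<forall>h\<in>H. ip M (g' l) h = 0"
      using g(3) perp' by (auto simp: g'_def less_Suc_eq)
    ultimately show ?case by blast
  qed
  then obtain g where g: "orthonormal M n g" "\<forall>l<n. \<exists>c. g l = V c" "\<forall>l<n. \<forall>h\<in>H. ip M (g l) h = 0"
    by blast
  have "t \<le> ip M (T (g l)) (g l)" if l: "l < n" for l
  proof -
    obtain c where c: "g l = V c" using g(2) l by blast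
    have "ip M (g l) (g l) = 1" using g(1) l by (simp add: orthonormal_def)
    then show ?thesis using form[of c] c by simp
  qed
  then show ?thesis using g by blast
qed

end

section \<open>Zonal kernels\<close>

lemma integral_powser_sums:
  fixes a :: "nat \<Rightarrow> real"
  assumes a: "summable (\<lambda>n. \<bar>a n\<bar>)" and meas: "\<And>n. g n \<in> borel_measurable M"
    and bound: "\<And>n x. \<bar>g n x\<bar> \<le> G x" and G: "integrable M G"
  shows "(\<lambda>n. a n * (\<integral>x. g n x \<partial>M)) sums (\<integral>x. (\<Sum>n. a n * g n x) \<partial>M)"
proof -
  have int: "integrable M (g n)" for n
  proof (rule Bochner_Integration.integrable_bound[OF G meas])
    have "norm (g n x) \<le> norm (G x)" for x using bound[of n x] by simp
    then show "AE x in M. norm (g n x) \<le> norm (G x)" by simp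
  qed
  have G0: "0 \<le> G x" for x using bound[of 0 x] by linarith
  have "(\<lambda>n. \<integral>x. a n * g n x \<partial>M) sums (\<integral>x. (\<Sum>n. a n * g n x) \<partial>M)"
  proof (rule sums_integral)
    show "integrable M (\<lambda>x. a n * g n x)" for n using int by simp
    show "AE x in M. summable (\<lambda>n. norm (a n * g n x))"
    proof (rule AE_I2)
      fix x
      show "summable (\<lambda>n. norm (a n * g n x))"
      proof (rule summable_comparison_test, intro exI allI impI)
        show "norm (norm (a n * g n x)) \<le> \<bar>a n\<bar> * G x" for n
          using mult_left_mono[OF bound, of "\<bar>a n\<bar>" n x] by (simp add: abs_mult)
        show "summable (\<lambda>n. \<bar>a n\<bar> * G x)" by (rule summable_mult2[OF a])
      qed
    qed
    show "summable (\<lambda>n. \<integral>x. norm (a n * g n x) \<partial>M)"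
    proof (rule summable_comparison_test, intro exI allI impI)
      show "norm (\<integral>x. norm (a n * g n x) \<partial>M) \<le> \<bar>a n\<bar> * (\<integral>x. G x \<partial>M)" for n
      proof -
        have "(\<integral>x. norm (a n * g n x) \<partial>M) \<le> (\<integral>x. \<bar>a n\<bar> * G x \<partial>M)"
          by (rule integral_mono)
            (use int G mult_left_mono[OF bound, of "\<bar>a n\<bar>" n] in \<open>simp_all add: abs_mult\<close>)
        then show ?thesis by simp
      qed
      show "summable (\<lambda>n. \<bar>a n\<bar> * (\<integral>x. G x \<partial>M))" by (rule summable_mult2[OF a])
    qed
  qed
  then show ?thesis by simp
qed

definition lift_norm :: "'a::euclidean_space \<Rightarrow> real" where
  "lift_norm x = norm (x, 1::real)"

definition direction :: "'a::euclidean_space \<Rightarrow> 'a \<times> real" where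
  "direction x = (1 / lift_norm x) *\<^sub>R (x, 1)"

lemma lift_norm_ge_one: "1 \<le> lift_norm x"
  using norm_snd_le[of "1::real" x] by (simp add: lift_norm_def)

lemma lift_norm_pos [simp]: "0 < lift_norm x"
  by (rule less_le_trans[OF zero_less_one lift_norm_ge_one])

lemma lift_norm_nonneg [simp]: "0 \<le> lift_norm x"
  by (simp add: less_imp_le)

lemma lift_norm_nonzero [simp]: "lift_norm x \<noteq> 0"
  by (rule less_imp_neq[OF lift_norm_pos, symmetric])

lemma abs_lift_norm [simp]: "\<bar>lift_norm x\<bar> = lift_norm x"
  by simp

lemma norm_direction [simp]: "norm (direction x) = 1"
  unfolding direction_def norm_scaleR lift_norm_def[symmetric] by simp

lemma direction_inner_self [simp]: "direction x \<bullet> direction x = 1"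
  unfolding norm_eq_1[symmetric] by (rule norm_direction)

lemma abs_inner_direction_le: "\<bar>direction x \<bullet> direction y\<bar> \<le> 1"
  using Cauchy_Schwarz_ineq2[of "direction x" "direction y"] by simp

lemma continuous_on_lift_norm [continuous_intros]:
  "continuous_on S f \<Longrightarrow> continuous_on S (\<lambda>x. lift_norm (f x))"
  unfolding lift_norm_def by (intro continuous_intros)

lemma continuous_on_direction [continuous_intros]:
  "continuous_on S f \<Longrightarrow> continuous_on S (\<lambda>x. direction (f x))"
  unfolding direction_def by (intro continuous_intros) auto

definition zonal_kernel :: "(real \<Rightarrow> real) \<Rightarrow> 'a::euclidean_space \<Rightarrow> 'a \<Rightarrow> real" where
  "zonal_kernel h x y = lift_norm x * lift_norm y * h (direction x \<bullet> direction y) + 1"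

lemma continuous_zonal_kernel:
  assumes "continuous_on {-1..1} h" "continuous_on S f" "continuous_on S g"
  shows "continuous_on S (\<lambda>z. zonal_kernel h (f z) (g z))"
proof -
  have "continuous_on S (\<lambda>z. h (direction (f z) \<bullet> direction (g z)))"
  proof (rule continuous_on_compose2[OF assms(1)])
    show "continuous_on S (\<lambda>z. direction (f z) \<bullet> direction (g z))"
      by (intro continuous_intros assms)
    show "(\<lambda>z. direction (f z) \<bullet> direction (g z)) ` S \<subseteq> {-1..1}"
    proof
      fix u assume "u \<in> (\<lambda>z. direction (f z) \<bullet> direction (g z)) ` S"
      then obtain z where "u = direction (f z) \<bullet> direction (g z)" by blast
      then show "u \<in> {-1..1}" using abs_inner_direction_le[of "f z" "g z"] by (simp add: abs_le_iff)
    qed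
  qed
  then show ?thesis unfolding zonal_kernel_def by (intro continuous_intros assms)
qed

text \<open>\<open>moment\<close> is the place where the decay of the density enters; it puts the
  weight into \<open>l2\<close>. Measurability of the identity is assumed in place of an equation
  for \<open>sets M\<close>, since the measure of the theorem lives on the completed
  sigma-algebra.\<close>

locale zonal_prob = prob_space M for M :: "'a::euclidean_space measure" +
  fixes a :: "nat \<Rightarrow> real" and h :: "real \<Rightarrow> real"
  assumes sp: "space M = UNIV" and id_measurable: "(\<lambda>x. x) \<in> borel_measurable M"
    and moment: "integrable M (\<lambda>x. (lift_norm x)\<^sup>2)"
    and powser: "nonneg_powser a h"
begin

text \<open>The profile is at most \<open>h 1\<close> in absolute value, and the additive 1 of the
  kernel is at most the product of the two weights, each being at least 1. Thus \<open>C\<close>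
  times the weight serves as the dominating function of \<open>hs_kernel\<close>.\<close>

definition C :: real where "C = sqrt (h 1 + 1)"

lemma C_square: "C * C = h 1 + 1"
  using nonneg_powser_one_nonneg[OF powser] by (simp add: C_def)

lemma C_nonneg: "0 \<le> C"
  using nonneg_powser_one_nonneg[OF powser] by (simp add: C_def)

lemma lift_norm_measurable: "lift_norm \<in> borel_measurable M"
proof -
  have "lift_norm \<in> borel_measurable (borel :: 'a measure)"
    by (intro borel_measurable_continuous_onI continuous_intros)
  then show ?thesis using measurable_compose[OF id_measurable] by blast
qed

lemma lift_norm_l2: "lift_norm \<in> l2 M"
  using lift_norm_measurable moment by (simp add: l2_def)

lemma abs_h_le: "\<bar>h (direction x \<bullet> direction y)\<bar> \<le> h 1"
  by (rule nonneg_powser_abs_le[OF powser abs_inner_direction_le])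

lemma zonal_kernel_abs_le: "\<bar>zonal_kernel h x y\<bar> \<le> (C * lift_norm x) * (C * lift_norm y)"
proof -
  have "\<bar>zonal_kernel h x y\<bar> \<le> lift_norm x * lift_norm y * \<bar>h (direction x \<bullet> direction y)\<bar> + 1"
    unfolding zonal_kernel_def
    by (rule order_trans[OF abs_triangle_ineq]) (simp add: abs_mult)
  also have "\<dots> \<le> lift_norm x * lift_norm y * h 1 + lift_norm x * lift_norm y"
  proof (rule add_mono)
    show "lift_norm x * lift_norm y * \<bar>h (direction x \<bullet> direction y)\<bar> \<le> lift_norm x * lift_norm y * h 1"
      by (intro mult_left_mono abs_h_le) simp
    show "1 \<le> lift_norm x * lift_norm y"
      using mult_mono[OF lift_norm_ge_one[of x] lift_norm_ge_one[of y]] by simp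
  qed
  also have "\<dots> = (C * C) * (lift_norm x * lift_norm y)"
    unfolding C_square by (simp add: algebra_simps)
  finally show ?thesis by (simp add: algebra_simps)
qed

lemma zonal_kernel_measurable:
  "(\<lambda>(x, y). zonal_kernel h x y) \<in> borel_measurable (M \<Otimes>\<^sub>M M)"
proof -
  have "(\<lambda>z :: 'a \<times> 'a. zonal_kernel h (fst z) (snd z)) \<in> borel_measurable borel"
    by (intro borel_measurable_continuous_onI continuous_zonal_kernel nonneg_powser_continuous[OF powser]
        continuous_intros)
  moreover have "(\<lambda>z. (fst z, snd z)) \<in> M \<Otimes>\<^sub>M M \<rightarrow>\<^sub>M (borel :: ('a \<times> 'a) measure)"
    by (intro borel_measurable_Pair measurable_compose[OF measurable_fst id_measurable]
        measurable_compose[OF measurable_snd id_measurable])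
  ultimately show ?thesis using measurable_compose by (fastforce simp: case_prod_unfold)
qed

sublocale hs_kernel M "zonal_kernel h" "\<lambda>x. C * lift_norm x"
proof
  show "zonal_kernel h x y = zonal_kernel h y x" for x y
    by (simp add: zonal_kernel_def inner_commute mult.commute)
  show "\<bar>zonal_kernel h x y\<bar> \<le> C * lift_norm x * (C * lift_norm y)" for x y
    by (rule zonal_kernel_abs_le)
  show "(\<lambda>x. C * lift_norm x) \<in> l2 M" by (rule l2_cmult[OF lift_norm_l2])
  show "0 \<le> C * lift_norm x" for x using C_nonneg by simp
qed (rule sp zonal_kernel_measurable)+

text \<open>Arzela-Ascoli without uniformity: a diagonal subsequence converges on a countable dense
  set, and convergence spreads to every x because the kernel sections depend continuously on x in
  norm, so that the images of a bounded sequence are equicontinuous at x.\<close>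

lemma T_pointwise_subsequence:
  assumes F: "\<And>n. F n \<in> l2 M" "\<And>n. ip M (F n) (F n) \<le> 1"
  shows "\<exists>r g. strict_mono (r :: nat \<Rightarrow> nat) \<and> (\<forall>x. (\<lambda>n. T (F (r n)) x) \<longlonglongrightarrow> g x)"
proof -
  let ?k = "zonal_kernel h" and ?W = "\<lambda>x. C * lift_norm x"
  have W: "?W \<in> l2 M" using lift_norm_l2 by simp
  obtain D :: "'a set" where D: "countable D" "\<And>X. p \<in> X \<Longrightarrow> open X \<Longrightarrow> \<exists>d\<in>D. d \<in> X" for p
    using countable_dense_setE by (metis all_not_in_conv)
  have Tb: "\<bar>T (F n) x\<bar> \<le> ?W x * sqrt R" for n x
  proof -
    have "sqrt (R * ip M (F n) (F n)) \<le> sqrt R" using F(2) by (simp add: mult_left_le)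
    then have "?W x * sqrt (R * ip M (F n) (F n)) \<le> ?W x * sqrt R"
      using C_nonneg by (intro mult_left_mono) auto
    then show ?thesis using T_abs_le[OF F(1), of n x] by linarith
  qed
  \<comment> \<open>Division by the weight yields a bound uniform in x, which the diagonal argument
    asks for; it is undone at each point afterwards.\<close>
  have "norm (T (F n) x / lift_norm x) \<le> C * sqrt R" for n x
    using Tb[of n x] by (simp add: divide_simps mult.assoc mult.left_commute mult.commute)
  from function_convergent_subsequence[OF D(1), of "\<lambda>n x. T (F n) x / lift_norm x", OF this]
  obtain r where r: "strict_mono (r :: nat \<Rightarrow> nat)"
    and rD: "\<And>x. x \<in> D \<Longrightarrow> \<exists>l. (\<lambda>n. T (F (r n)) x / lift_norm x) \<longlonglongrightarrow> l" by blast
  have kl2: "(\<lambda>y. ?k x y) \<in> l2 M" for x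
  proof (rule l2_bound[OF l2_cmult[OF W, of "?W x"] kernel_measurable_right])
    show "\<bar>?k x y\<bar> \<le> \<bar>?W x * ?W y\<bar>" for y using zonal_kernel_abs_le[of x y] by linarith
  qed
  have conv: "convergent (\<lambda>n. T (F (r n)) x)" for x
    unfolding Cauchy_convergent_iff[symmetric]
  proof (rule metric_CauchyI)
    fix e :: real assume e: "0 < e"
    \<comment> \<open>The squared distance of two kernel sections. It tends to 0 as q tends to x by
      dominated convergence, since the weights stay bounded along a convergent sequence.\<close>
    define \<Delta> where "\<Delta> q = ip M (\<lambda>y. ?k q y - ?k x y) (\<lambda>y. ?k q y - ?k x y)" for q
    have "\<exists>q\<in>D. \<Delta> q < (e / 4)\<^sup>2"
    proof -
      have "\<exists>d\<in>D. d \<in> ball x (1 / Suc n)" for n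
        by (rule D(2)[of x]) auto
      then obtain q where q: "\<And>n. q n \<in> D" "\<And>n. q n \<in> ball x (1 / Suc n)" by metis
      have qlim: "q \<longlonglongrightarrow> x"
      proof (rule metric_tendsto_imp_tendsto[OF LIMSEQ_inverse_real_of_nat])
        show "\<forall>\<^sub>F n in sequentially. dist (q n) x \<le> dist (inverse (real (Suc n))) 0"
          using q(2) by (auto intro!: always_eventually simp: dist_commute inverse_eq_divide less_imp_le)
      qed
      have "continuous_on UNIV (lift_norm :: 'a \<Rightarrow> real)" by (intro continuous_intros)
      then have "(\<lambda>n. lift_norm (q n)) \<longlonglongrightarrow> lift_norm x"
        using continuous_on_tendsto_compose[OF _ qlim, of UNIV lift_norm] by simp
      then have "(\<lambda>n. ?W (q n)) \<longlonglongrightarrow> ?W x" by (rule tendsto_mult_left)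
      then have "Bseq (\<lambda>n. ?W (q n))" by (rule convergent_imp_Bseq[OF convergentI])
      then obtain B where B: "\<And>n. \<bar>?W (q n)\<bar> \<le> B" unfolding Bseq_def by auto
      have "(\<lambda>n. \<Delta> (q n)) \<longlonglongrightarrow> (\<integral>y. 0 \<partial>M)"
        unfolding \<Delta>_def ip_def
      proof (rule integral_dominated_convergence)
        show "integrable M (\<lambda>y. ((B + ?W x) * ?W y)\<^sup>2)"
          by (rule l2_integrable_square) (use l2_cmult[OF W] in auto)
        show "AE y in M. (\<lambda>n. (?k (q n) y - ?k x y) * (?k (q n) y - ?k x y)) \<longlonglongrightarrow> 0"
        proof (rule AE_I2)
          fix y :: 'a
          have "continuous_on UNIV (\<lambda>x. ?k x y)"
            by (intro continuous_zonal_kernel nonneg_powser_continuous[OF powser] continuous_intros)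
          then have "(\<lambda>n. ?k (q n) y) \<longlonglongrightarrow> ?k x y"
            using continuous_on_tendsto_compose[OF _ qlim, of UNIV "\<lambda>x. ?k x y"] by simp
          then have "(\<lambda>n. (?k (q n) y - ?k x y) * (?k (q n) y - ?k x y)) \<longlonglongrightarrow> (?k x y - ?k x y) * (?k x y - ?k x y)"
            by (intro tendsto_intros)
          then show "(\<lambda>n. (?k (q n) y - ?k x y) * (?k (q n) y - ?k x y)) \<longlonglongrightarrow> 0" by simp
        qed
        show "AE y in M. norm ((?k (q n) y - ?k x y) * (?k (q n) y - ?k x y)) \<le> ((B + ?W x) * ?W y)\<^sup>2" for n
        proof (rule AE_I2)
          fix y :: 'a
          have "\<bar>?k (q n) y - ?k x y\<bar> \<le> \<bar>?k (q n) y\<bar> + \<bar>?k x y\<bar>" by (rule abs_triangle_ineq4)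
          also have "\<dots> \<le> ?W (q n) * ?W y + ?W x * ?W y"
            by (intro add_mono zonal_kernel_abs_le)
          also have "\<dots> = (?W (q n) + ?W x) * ?W y" by (rule distrib_right[symmetric])
          also have "\<dots> \<le> (B + ?W x) * ?W y"
            using B[of n] C_nonneg by (intro mult_right_mono) auto
          finally have "\<bar>?k (q n) y - ?k x y\<bar> \<le> \<bar>(B + ?W x) * ?W y\<bar>" by linarith
          then show "norm ((?k (q n) y - ?k x y) * (?k (q n) y - ?k x y)) \<le> ((B + ?W x) * ?W y)\<^sup>2"
            unfolding abs_le_square_iff by (simp add: power2_eq_square)
        qed
        show "(\<lambda>y. (?k (q n) y - ?k x y) * (?k (q n) y - ?k x y)) \<in> borel_measurable M" for n
          by (intro borel_measurable_times borel_measurable_diff kernel_measurable_right)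
      qed simp
      then have "\<forall>\<^sub>F n in sequentially. \<Delta> (q n) < (e / 4)\<^sup>2"
        by (rule order_tendstoD) (use e in simp)
      then show ?thesis using q(1) eventually_sequentially by auto
    qed
    then obtain q where q: "q \<in> D" "\<Delta> q < (e / 4)\<^sup>2" by blast
    have close: "\<bar>T (F n) q - T (F n) x\<bar> < e / 4" for n
    proof -
      have "T (F n) q - T (F n) x = ip M (\<lambda>y. ?k q y - ?k x y) (F n)"
        using T_integrable[OF F(1)] by (simp add: T_def ip_def left_diff_distrib)
      then have "(T (F n) q - T (F n) x)\<^sup>2 \<le> \<Delta> q * ip M (F n) (F n)"
        unfolding \<Delta>_def using ip_Cauchy_Schwarz[OF l2_diff[OF kl2 kl2] F(1)] by simp
      also have "\<dots> \<le> \<Delta> q * 1" using F(2) by (intro mult_left_mono) (simp_all add: \<Delta>_def)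
      also have "\<dots> < (e / 4)\<^sup>2" using q(2) by simp
      finally have "\<bar>T (F n) q - T (F n) x\<bar>\<^sup>2 < (e / 4)\<^sup>2" unfolding power2_abs .
      then show ?thesis by (rule power2_less_imp_less) (use e in simp)
    qed
    obtain l where "(\<lambda>n. T (F (r n)) q / lift_norm q) \<longlonglongrightarrow> l" using rD[OF q(1)] by blast
    then have "(\<lambda>n. lift_norm q * (T (F (r n)) q / lift_norm q)) \<longlonglongrightarrow> lift_norm q * l"
      by (rule tendsto_mult_left)
    then have "(\<lambda>n. T (F (r n)) q) \<longlonglongrightarrow> lift_norm q * l"
      using lift_norm_pos[of q] by simp
    then have "Cauchy (\<lambda>n. T (F (r n)) q)" by (rule LIMSEQ_imp_Cauchy)
    then obtain N where N: "\<And>m n. N \<le> m \<Longrightarrow> N \<le> n \<Longrightarrow> dist (T (F (r m)) q) (T (F (r n)) q) < e / 2"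
      using e unfolding Cauchy_def by (meson half_gt_zero)
    have "dist (T (F (r m)) x) (T (F (r n)) x) < e" if "N \<le> m" "N \<le> n" for m n
      using N[OF that] close[of "r m"] close[of "r n"] unfolding dist_real_def by linarith
    then show "\<exists>N. \<forall>m\<ge>N. \<forall>n\<ge>N. dist (T (F (r m)) x) (T (F (r n)) x) < e" by blast
  qed
  then have "\<forall>x. (\<lambda>n. T (F (r n)) x) \<longlonglongrightarrow> lim (\<lambda>n. T (F (r n)) x)"
    by (simp add: convergent_LIMSEQ_iff)
  with r show ?thesis
    by (intro exI[of _ r] exI[of _ "\<lambda>x. lim (\<lambda>n. T (F (r n)) x)"] conjI)
qed

sublocale compact_kernel M "zonal_kernel h" "\<lambda>x. C * lift_norm x"
  by unfold_locales (rule T_pointwise_subsequence)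

end

section \<open>Tensor-power features and the quadratic form\<close>

text \<open>The inner product of the n-fold tensor powers of u and v, written in
  coordinates.\<close>

lemma inner_power_eq_sum:
  fixes u v :: "'b::euclidean_space"
  shows "(u \<bullet> v) ^ n = (\<Sum>\<alpha>\<in>{..<n} \<rightarrow>\<^sub>E Basis. (\<Prod>i<n. u \<bullet> \<alpha> i) * (\<Prod>i<n. v \<bullet> \<alpha> i))"
proof -
  have "(u \<bullet> v) ^ n = (\<Prod>i<n. \<Sum>b\<in>Basis. (u \<bullet> b) * (v \<bullet> b))"
    by (simp add: euclidean_inner[of u v])
  also have "\<dots> = (\<Sum>\<alpha>\<in>{..<n} \<rightarrow>\<^sub>E Basis. \<Prod>i<n. (u \<bullet> \<alpha> i) * (v \<bullet> \<alpha> i))"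
    by (rule prod_sum_PiE) auto
  finally show ?thesis by (simp add: prod.distrib)
qed

context zonal_prob
begin

text \<open>Words and not multisets of basis vectors: the coordinates of the full tensor power carry
  no multinomial weights.\<close>

definition multi_indices :: "nat \<Rightarrow> (nat \<Rightarrow> 'a \<times> real) set" where
  "multi_indices n = ({..<n} \<rightarrow>\<^sub>E Basis)"

definition feature :: "nat \<Rightarrow> (nat \<Rightarrow> 'a \<times> real) \<Rightarrow> 'a \<Rightarrow> real" where
  "feature n \<alpha> x = lift_norm x * (\<Prod>i<n. direction x \<bullet> \<alpha> i)"

definition power_form :: "nat \<Rightarrow> ('a \<Rightarrow> real) \<Rightarrow> real" where
  "power_form n f = (\<Sum>\<alpha>\<in>multi_indices n. (ip M (feature n \<alpha>) f)\<^sup>2)"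

lemma finite_multi_indices [simp]: "finite (multi_indices n)"
  unfolding multi_indices_def by (intro finite_PiE) auto

lemma feature_sum:
  "(\<Sum>\<alpha>\<in>multi_indices n. feature n \<alpha> x * feature n \<alpha> y)
    = lift_norm x * lift_norm y * (direction x \<bullet> direction y) ^ n"
  unfolding feature_def multi_indices_def inner_power_eq_sum sum_distrib_left
  by (intro sum.cong) (auto simp: algebra_simps)

lemma direction_coord_abs_le:
  assumes "\<alpha> \<in> multi_indices n"
  shows "\<bar>\<Prod>i<n. direction x \<bullet> \<alpha> i\<bar> \<le> 1"
  unfolding abs_prod
proof (rule prod_le_1)
  fix i assume "i \<in> {..<n}"
  then have "\<alpha> i \<in> Basis" using assms by (auto simp: multi_indices_def)
  then show "0 \<le> \<bar>direction x \<bullet> \<alpha> i\<bar> \<and> \<bar>direction x \<bullet> \<alpha> i\<bar> \<le> 1"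
    using Basis_le_norm[of "\<alpha> i" "direction x"] by simp
qed

lemma continuous_measurable:
  fixes f :: "'a \<Rightarrow> real"
  assumes "continuous_on UNIV f"
  shows "f \<in> borel_measurable M"
  using measurable_compose[OF id_measurable borel_measurable_continuous_onI[OF assms]] by simp

lemma feature_l2:
  assumes "\<alpha> \<in> multi_indices n"
  shows "feature n \<alpha> \<in> l2 M"
proof (rule l2_bound[OF lift_norm_l2])
  show "feature n \<alpha> \<in> borel_measurable M"
    unfolding feature_def[abs_def] by (intro continuous_measurable continuous_intros)
  show "\<bar>feature n \<alpha> x\<bar> \<le> \<bar>lift_norm x\<bar>" for x
    using mult_left_mono[OF direction_coord_abs_le[OF assms, of x], of "lift_norm x"]
    by (simp add: feature_def abs_mult)
qed

lemma power_form_nonneg: "0 \<le> power_form n f"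
  by (simp add: power_form_def sum_nonneg)

lemma one_l2 [simp]: "(\<lambda>x. 1) \<in> l2 M"
  by (simp add: l2_def)

lemma powser_summable: "summable (\<lambda>n. \<bar>a n\<bar>)"
  using nonneg_powser_nonneg[OF powser] nonneg_powser_sums_one[OF powser] by (simp add: sums_iff)

lemma feature_sum_ip:
  assumes f: "f \<in> l2 M"
  shows "(\<Sum>\<alpha>\<in>multi_indices n. feature n \<alpha> x * ip M (feature n \<alpha>) f)
    = (\<integral>y. lift_norm x * lift_norm y * (direction x \<bullet> direction y) ^ n * f y \<partial>M)"
proof -
  have "(\<Sum>\<alpha>\<in>multi_indices n. feature n \<alpha> x * ip M (feature n \<alpha>) f)
      = (\<integral>y. (\<Sum>\<alpha>\<in>multi_indices n. feature n \<alpha> x * (feature n \<alpha> y * f y)) \<partial>M)"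
    unfolding ip_def using l2_integrable_mult[OF feature_l2 f] by (subst Bochner_Integration.integral_sum) auto
  also have "\<dots> = (\<integral>y. (\<Sum>\<alpha>\<in>multi_indices n. feature n \<alpha> x * feature n \<alpha> y) * f y \<partial>M)"
    by (simp add: sum_distrib_right mult.assoc)
  finally show ?thesis unfolding feature_sum .
qed

text \<open>The power series of the profile is integrated twice, in y and then in x, each time
  dominated by the weight times \<open>\<bar>f\<bar>\<close>. The degree n part of
  \<open>T f\<close> is the function \<open>G n\<close>, and pairing it with \<open>f\<close> gives
  a sum of squares. The subtracted square belongs to the additive 1 of the kernel.\<close>

lemma form_sums:
  assumes f: "f \<in> l2 M"
  shows "(\<lambda>n. a n * power_form n f) sums (ip M (T f) f - (ip M (\<lambda>x. 1) f)\<^sup>2)"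
proof -
  define G where "G n x = (\<Sum>\<alpha>\<in>multi_indices n. feature n \<alpha> x * ip M (feature n \<alpha>) f)" for n x
  have fm: "f \<in> borel_measurable M" by (rule l2_measurable[OF f])
  have f': "(\<lambda>x. \<bar>f x\<bar>) \<in> l2 M" by (rule l2_bound[OF f]) (use fm in auto)
  have G_eq: "G n x = (\<integral>y. lift_norm x * lift_norm y * (direction x \<bullet> direction y) ^ n * f y \<partial>M)" for n x
    unfolding G_def by (rule feature_sum_ip[OF f])
  have pow_le: "\<bar>lift_norm x * lift_norm y * (direction x \<bullet> direction y) ^ n * f y\<bar> \<le> lift_norm x * (lift_norm y * \<bar>f y\<bar>)" for n x y
  proof -
    have "\<bar>direction x \<bullet> direction y\<bar> ^ n \<le> 1"
      by (rule power_le_one) (auto intro: abs_inner_direction_le)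
    then have "(lift_norm x * lift_norm y * \<bar>f y\<bar>) * \<bar>direction x \<bullet> direction y\<bar> ^ n \<le> (lift_norm x * lift_norm y * \<bar>f y\<bar>) * 1"
      by (intro mult_left_mono) auto
    then show ?thesis by (simp add: abs_mult power_abs algebra_simps)
  qed
  have int_wf: "integrable M (\<lambda>y. lift_norm y * \<bar>f y\<bar>)" by (rule l2_integrable_mult[OF lift_norm_l2 f'])
  define c where "c = (\<integral>y. lift_norm y * \<bar>f y\<bar> \<partial>M)"
  have G_meas: "G n \<in> borel_measurable M" for n
  proof -
    have "G n \<in> l2 M"
      unfolding G_def[abs_def] by (intro l2_sum) (subst mult.commute, intro l2_cmult feature_l2)
    then show ?thesis by (rule l2_measurable)
  qed
  have G_le: "\<bar>G n x\<bar> \<le> lift_norm x * c" for n x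
  proof -
    let ?g = "\<lambda>y. lift_norm x * lift_norm y * (direction x \<bullet> direction y) ^ n * f y"
    have "\<bar>G n x\<bar> \<le> (\<integral>y. \<bar>?g y\<bar> \<partial>M)"
      unfolding G_eq by (rule integral_abs_bound)
    also have "\<dots> \<le> (\<integral>y. lift_norm x * (lift_norm y * \<bar>f y\<bar>) \<partial>M)"
      using int_wf pow_le by (intro integral_mono') auto
    finally show ?thesis by (simp add: c_def)
  qed
  have T_sums: "(\<lambda>n. a n * G n x) sums (T f x - ip M (\<lambda>x. 1) f)" for x
  proof -
    have "(\<lambda>n. a n * G n x) sums (\<integral>y. (\<Sum>n. a n * (lift_norm x * lift_norm y * (direction x \<bullet> direction y) ^ n * f y)) \<partial>M)"
      unfolding G_eq
    proof (rule integral_powser_sums[OF powser_summable _ pow_le])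
      show "integrable M (\<lambda>y. lift_norm x * (lift_norm y * \<bar>f y\<bar>))" using int_wf by simp
      show "(\<lambda>y. lift_norm x * lift_norm y * (direction x \<bullet> direction y) ^ n * f y) \<in> borel_measurable M" for n
        by (intro borel_measurable_times[OF _ fm] continuous_measurable continuous_intros)
    qed
    also have "(\<lambda>y. \<Sum>n. a n * (lift_norm x * lift_norm y * (direction x \<bullet> direction y) ^ n * f y))
        = (\<lambda>y. zonal_kernel h x y * f y - f y)"
    proof
      fix y
      have "(\<lambda>n. a n * (direction x \<bullet> direction y) ^ n * (lift_norm x * lift_norm y * f y)) sums
          (h (direction x \<bullet> direction y) * (lift_norm x * lift_norm y * f y))"
        by (intro sums_mult2 nonneg_powser_sums[OF powser abs_inner_direction_le])
      then show "(\<Sum>n. a n * (lift_norm x * lift_norm y * (direction x \<bullet> direction y) ^ n * f y))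
          = zonal_kernel h x y * f y - f y"
        by (simp add: sums_iff zonal_kernel_def algebra_simps)
    qed
    also have "(\<integral>y. zonal_kernel h x y * f y - f y \<partial>M) = T f x - ip M (\<lambda>x. 1) f"
      using T_integrable[OF f, of x] l2_integrable_mult[OF one_l2 f] by (simp add: T_def ip_def)
    finally show ?thesis .
  qed
  have "(\<lambda>n. a n * (\<integral>x. G n x * f x \<partial>M)) sums (\<integral>x. (\<Sum>n. a n * (G n x * f x)) \<partial>M)"
  proof (rule integral_powser_sums[OF powser_summable])
    show "\<bar>G n x * f x\<bar> \<le> c * (lift_norm x * \<bar>f x\<bar>)" for n x
      using mult_right_mono[OF G_le, of "\<bar>f x\<bar>" n x] by (simp add: abs_mult algebra_simps)
    show "integrable M (\<lambda>x. c * (lift_norm x * \<bar>f x\<bar>))" using int_wf by simp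
  qed (intro borel_measurable_times G_meas fm)
  moreover have "(\<integral>x. G n x * f x \<partial>M) = power_form n f" for n
  proof -
    have "(\<integral>x. G n x * f x \<partial>M) = (\<integral>x. (\<Sum>\<alpha>\<in>multi_indices n. ip M (feature n \<alpha>) f * (feature n \<alpha> x * f x)) \<partial>M)"
      by (simp add: G_def sum_distrib_left sum_distrib_right algebra_simps)
    also have "\<dots> = (\<Sum>\<alpha>\<in>multi_indices n. ip M (feature n \<alpha>) f * ip M (feature n \<alpha>) f)"
      using l2_integrable_mult[OF feature_l2 f] by (subst Bochner_Integration.integral_sum) (auto simp: ip_def)
    finally show ?thesis by (simp add: power_form_def power2_eq_square)
  qed
  moreover have "(\<integral>x. (\<Sum>n. a n * (G n x * f x)) \<partial>M) = ip M (T f) f - (ip M (\<lambda>x. 1) f)\<^sup>2"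
  proof -
    have "(\<Sum>n. a n * (G n x * f x)) = T f x * f x - ip M (\<lambda>x. 1) f * f x" for x
    proof -
      have "(\<lambda>n. a n * G n x * f x) sums ((T f x - ip M (\<lambda>x. 1) f) * f x)"
        by (rule sums_mult2[OF T_sums])
      then show ?thesis by (simp add: sums_iff mult.assoc left_diff_distrib)
    qed
    then have "(\<integral>x. (\<Sum>n. a n * (G n x * f x)) \<partial>M) = (\<integral>x. T f x * f x - ip M (\<lambda>x. 1) f * f x \<partial>M)"
      by simp
    also have "\<dots> = (\<integral>x. T f x * f x \<partial>M) - (\<integral>x. ip M (\<lambda>x. 1) f * f x \<partial>M)"
      using l2_integrable_mult[OF T_l2[OF f] f] l2_integrable_mult[OF one_l2 f]
      by (intro Bochner_Integration.integral_diff) auto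
    finally show ?thesis by (simp add: ip_def power2_eq_square)
  qed
  ultimately show ?thesis by simp
qed

lemma form_ge_partial_sum:
  assumes f: "f \<in> l2 M" and S: "finite S"
  shows "(\<Sum>n\<in>S. a n * power_form n f) \<le> ip M (T f) f"
proof -
  have "(\<Sum>n\<in>S. a n * power_form n f) \<le> ip M (T f) f - (ip M (\<lambda>x. 1) f)\<^sup>2"
    unfolding sums_unique[OF form_sums[OF f]]
    by (intro sum_le_suminf sums_summable[OF form_sums[OF f]] S mult_nonneg_nonneg
        nonneg_powser_nonneg[OF powser] power_form_nonneg)
  then show ?thesis using zero_le_power2[of "ip M (\<lambda>x. 1) f"] by linarith
qed

lemma eigenvalue_bound_trivial:
  assumes "t \<in> eigenvalue_bounds (zonal_kernel h) M i" "1 \<le> i"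
  shows "t \<le> R"
proof -
  obtain g where g: "orthonormal M 1 g" "t \<le> ip M (T (g 0)) (g 0)"
    using orthonormal_of_eigenvalue_bound[OF assms(1), of "{}" 1] assms(2) by auto
  have "g 0 \<in> l2 M" "ip M (g 0) (g 0) = 1" using g(1) by (auto simp: orthonormal_def)
  then show ?thesis using ip_T_abs_le[of "g 0"] g(2) by simp
qed

text \<open>Testing against functions orthogonal to \<open>lift_norm\<close> on each cell allows one to subtract from
  every feature its value at the representative of the cell.\<close>
lemma power_form_bound_by_cells:
  assumes g: "orthonormal M N g" and Z: "finite Z" and cell: "\<And>x. cell x \<in> Z"
    and meas: "\<And>z. z \<in> Z \<Longrightarrow> {x. cell x = z} \<in> sets M"
    and perp: "\<And>l z. l < N \<Longrightarrow> z \<in> Z \<Longrightarrow> ip M (g l) (\<lambda>x. lift_norm x * indicator {x. cell x = z} x) = 0"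
  shows "(\<Sum>l<N. power_form n (g l))
    \<le> (\<integral>x. (lift_norm x)\<^sup>2 * (2 * (1 - (direction x \<bullet> direction (rep (cell x))) ^ n)) \<partial>M)"
proof -
  define e where "e z x = lift_norm x * indicator {x. cell x = z} x" for z x
  define P where "P \<alpha> x = (\<Prod>i<n. direction x \<bullet> \<alpha> i)" for \<alpha> and x :: 'a
  define \<psi> where "\<psi> \<alpha> x = feature n \<alpha> x - (\<Sum>z\<in>Z. P \<alpha> (rep z) * e z x)" for \<alpha> x
  have el2: "e z \<in> l2 M" if "z \<in> Z" for z
  proof (rule l2_bound[OF lift_norm_l2])
    show "e z \<in> borel_measurable M"
      unfolding e_def[abs_def] using lift_norm_measurable meas[OF that] by measurable
    show "\<bar>e z x\<bar> \<le> \<bar>lift_norm x\<bar>" for x by (simp add: e_def indicator_def)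
  qed
  have gl: "g l \<in> l2 M" if "l < N" for l using g that by (simp add: orthonormal_def)
  have sum_e: "(\<Sum>z\<in>Z. P \<alpha> (rep z) * e z x) = lift_norm x * P \<alpha> (rep (cell x))" for \<alpha> x
  proof -
    have "(\<Sum>z\<in>Z. P \<alpha> (rep z) * e z x) = (\<Sum>z\<in>Z. if z = cell x then lift_norm x * P \<alpha> (rep z) else 0)"
      by (intro sum.cong) (auto simp: e_def)
    then show ?thesis using Z cell[of x] by simp
  qed
  have sl2: "(\<lambda>x. \<Sum>z\<in>Z. P \<alpha> (rep z) * e z x) \<in> l2 M" for \<alpha>
    by (intro l2_sum l2_cmult el2)
  have \<psi>l2: "\<psi> \<alpha> \<in> l2 M" if "\<alpha> \<in> multi_indices n" for \<alpha>
    unfolding \<psi>_def[abs_def] by (intro l2_diff feature_l2 that sl2)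
  have \<psi>g: "ip M (\<psi> \<alpha>) (g l) = ip M (feature n \<alpha>) (g l)" if "\<alpha> \<in> multi_indices n" "l < N" for \<alpha> l
  proof -
    have "ip M (e z) (g l) = 0" if "z \<in> Z" for z
      using perp[OF \<open>l < N\<close> that] ip_commute[of M "e z" "g l"] by (simp add: e_def[abs_def])
    then have "ip M (\<lambda>x. \<Sum>z\<in>Z. P \<alpha> (rep z) * e z x) (g l) = 0"
      by (subst ip_sum_left) (auto simp: el2 gl that ip_cmult_left)
    then show ?thesis
      unfolding \<psi>_def[abs_def] using ip_diff_left[OF feature_l2[OF that(1)] sl2 gl[OF that(2)]] by simp
  qed
  \<comment> \<open>Once the sums are exchanged, Bessel's inequality removes the test functions
    altogether, and what remains is a trace.\<close>
  have "(\<Sum>l<N. power_form n (g l)) = (\<Sum>l<N. \<Sum>\<alpha>\<in>multi_indices n. (ip M (\<psi> \<alpha>) (g l))\<^sup>2)"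
    unfolding power_form_def by (intro sum.cong refl) (simp add: \<psi>g)
  also have "\<dots> = (\<Sum>\<alpha>\<in>multi_indices n. \<Sum>l<N. (ip M (\<psi> \<alpha>) (g l))\<^sup>2)" by (rule sum.swap)
  also have "\<dots> \<le> (\<Sum>\<alpha>\<in>multi_indices n. ip M (\<psi> \<alpha>) (\<psi> \<alpha>))"
    by (intro sum_mono Bessel_inequality[OF g] \<psi>l2)
  also have "\<dots> = (\<integral>x. (\<Sum>\<alpha>\<in>multi_indices n. \<psi> \<alpha> x * \<psi> \<alpha> x) \<partial>M)"
    unfolding ip_def using l2_integrable_mult[OF \<psi>l2 \<psi>l2] by (subst Bochner_Integration.integral_sum) auto
  also have "(\<lambda>x. \<Sum>\<alpha>\<in>multi_indices n. \<psi> \<alpha> x * \<psi> \<alpha> x)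
      = (\<lambda>x. (lift_norm x)\<^sup>2 * (2 * (1 - (direction x \<bullet> direction (rep (cell x))) ^ n)))"
  proof
    fix x
    let ?r = "rep (cell x)"
    have PP: "(\<Sum>\<alpha>\<in>multi_indices n. P \<alpha> u * P \<alpha> v) = (direction u \<bullet> direction v) ^ n" for u v
      unfolding P_def multi_indices_def inner_power_eq_sum ..
    have "\<psi> \<alpha> x * \<psi> \<alpha> x = (lift_norm x)\<^sup>2 * (P \<alpha> x * P \<alpha> x - 2 * (P \<alpha> x * P \<alpha> ?r) + P \<alpha> ?r * P \<alpha> ?r)" for \<alpha>
      unfolding \<psi>_def sum_e by (simp add: feature_def P_def[symmetric] power2_eq_square algebra_simps)
    \<comment> \<open>The square of a difference of tensor powers of unit vectors: the two outer
      sums are 1 and the mixed one is the n-th power of the inner product.\<close>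
    then have "(\<Sum>\<alpha>\<in>multi_indices n. \<psi> \<alpha> x * \<psi> \<alpha> x) = (lift_norm x)\<^sup>2 *
        ((\<Sum>\<alpha>\<in>multi_indices n. P \<alpha> x * P \<alpha> x) - 2 * (\<Sum>\<alpha>\<in>multi_indices n. P \<alpha> x * P \<alpha> ?r)
          + (\<Sum>\<alpha>\<in>multi_indices n. P \<alpha> ?r * P \<alpha> ?r))"
      by (simp add: sum_distrib_left sum_subtractf sum.distrib distrib_left right_diff_distrib)
    then show "(\<Sum>\<alpha>\<in>multi_indices n. \<psi> \<alpha> x * \<psi> \<alpha> x)
        = (lift_norm x)\<^sup>2 * (2 * (1 - (direction x \<bullet> direction ?r) ^ n))"
      unfolding PP by simp
  qed
  finally show ?thesis .
qed

text \<open>Testing is against N functions orthogonal to the constants, which removes the rank one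
  term, and to one weighted indicator per cell. Weighted by the coefficients, the traces 2(1 - u^n)
  add up to 2(h(1) - h(u)), which \<open>close\<close> bounds by twice \<eta>.\<close>

lemma eigenvalue_bound_by_cells:
  assumes t: "t \<in> eigenvalue_bounds (zonal_kernel h) M i" and Z: "finite Z" and cell: "\<And>x. cell x \<in> Z"
    and meas: "\<And>z. z \<in> Z \<Longrightarrow> {x. cell x = z} \<in> sets M"
    and close: "\<And>x. h 1 - h (direction x \<bullet> direction (rep (cell x))) \<le> \<eta>"
    and N: "N + card Z + 1 \<le> i"
  shows "N * t \<le> 2 * \<eta> * (\<integral>x. (lift_norm x)\<^sup>2 \<partial>M)"
proof -
  define e where "e z x = lift_norm x * indicator {x. cell x = z} x" for z x
  have el2: "e z \<in> l2 M" if "z \<in> Z" for z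
  proof (rule l2_bound[OF lift_norm_l2])
    show "e z \<in> borel_measurable M"
      unfolding e_def[abs_def] using lift_norm_measurable meas[OF that] by measurable
    show "\<bar>e z x\<bar> \<le> \<bar>lift_norm x\<bar>" for x by (simp add: e_def indicator_def)
  qed
  define H where "H = insert (\<lambda>x. 1) (e ` Z)"
  have "card H \<le> card Z + 1"
    unfolding H_def using card_insert_le_m1[of "card Z + 1" "e ` Z" "\<lambda>x. 1"] card_image_le[OF Z, of e] by simp
  then have card: "N + card H \<le> i" using N by simp
  have "finite H" "H \<subseteq> l2 M" using Z el2 by (auto simp: H_def)
  from orthonormal_of_eigenvalue_bound[OF t this card]
  obtain g where g: "orthonormal M N g" "\<And>l. l < N \<Longrightarrow> t \<le> ip M (T (g l)) (g l)"
    "\<And>l v. l < N \<Longrightarrow> v \<in> H \<Longrightarrow> ip M (g l) v = 0" by blast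
  have gl: "g l \<in> l2 M" if "l < N" for l using g that by (simp add: orthonormal_def)
  let ?B = "2 * \<eta> * (\<integral>x. (lift_norm x)\<^sup>2 \<partial>M)"
  let ?u = "\<lambda>x. direction x \<bullet> direction (rep (cell x))"
  \<comment> \<open>\<open>rep\<close> is an arbitrary function; measurability comes from the
    finitely many measurable cells, on each of which the representative is constant.\<close>
  have u_meas: "?u \<in> borel_measurable M"
  proof -
    have "(\<lambda>x. \<Sum>z\<in>Z. (direction x \<bullet> direction (rep z)) * indicator {x. cell x = z} x) \<in> borel_measurable M"
      by (intro borel_measurable_sum borel_measurable_times continuous_measurable continuous_intros
          borel_measurable_indicator meas)
    moreover have "(\<Sum>z\<in>Z. (direction x \<bullet> direction (rep z)) * indicator {x. cell x = z} x) = ?u x" for x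
    proof -
      have "(\<Sum>z\<in>Z. (direction x \<bullet> direction (rep z)) * indicator {x. cell x = z} x)
          = (\<Sum>z\<in>Z. if z = cell x then direction x \<bullet> direction (rep z) else 0)"
        by (intro sum.cong) (auto simp: indicator_def)
      then show ?thesis using Z cell[of x] by simp
    qed
    ultimately show ?thesis by simp
  qed
  have pow1: "\<bar>?u x ^ n\<bar> \<le> 1" for x n
    unfolding power_abs by (rule power_le_one) (auto intro: abs_inner_direction_le)
  have term_int: "integrable M (\<lambda>x. (lift_norm x)\<^sup>2 * (2 * (1 - ?u x ^ n)))" for n
  proof (rule Bochner_Integration.integrable_bound)
    show "integrable M (\<lambda>x. 4 * (lift_norm x)\<^sup>2)" using moment by simp
    show "(\<lambda>x. (lift_norm x)\<^sup>2 * (2 * (1 - ?u x ^ n))) \<in> borel_measurable M"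
      using u_meas lift_norm_measurable by measurable
    have "norm ((lift_norm x)\<^sup>2 * (2 * (1 - ?u x ^ n))) \<le> norm (4 * (lift_norm x)\<^sup>2)" for x
    proof -
      have "\<bar>2 * (1 - ?u x ^ n)\<bar> \<le> 4" using pow1[of x n] by (simp add: abs_le_iff)
      then have "(lift_norm x)\<^sup>2 * \<bar>2 * (1 - ?u x ^ n)\<bar> \<le> (lift_norm x)\<^sup>2 * 4"
        by (rule mult_left_mono) simp
      then show ?thesis by (simp add: abs_mult)
    qed
    then show "AE x in M. norm ((lift_norm x)\<^sup>2 * (2 * (1 - ?u x ^ n))) \<le> norm (4 * (lift_norm x)\<^sup>2)" by simp
  qed
  \<comment> \<open>Finitely many degrees first, so that sum and integral commute; the limit over
    the degrees is taken at the end.\<close>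
  have partial: "(\<Sum>n<K. a n * (\<Sum>l<N. power_form n (g l))) \<le> ?B" for K
  proof -
    have "(\<Sum>n<K. a n * (\<Sum>l<N. power_form n (g l)))
        \<le> (\<Sum>n<K. a n * (\<integral>x. (lift_norm x)\<^sup>2 * (2 * (1 - ?u x ^ n)) \<partial>M))"
    proof (intro sum_mono mult_left_mono)
      fix n
      show "(\<Sum>l<N. power_form n (g l)) \<le> (\<integral>x. (lift_norm x)\<^sup>2 * (2 * (1 - ?u x ^ n)) \<partial>M)"
      proof (rule power_form_bound_by_cells[OF g(1) Z cell meas])
        show "ip M (g l) (\<lambda>x. lift_norm x * indicator {x. cell x = z} x) = 0" if "l < N" "z \<in> Z" for l z
          using g(3)[OF that(1), of "e z"] that(2) by (simp add: H_def e_def[abs_def])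
      qed
    qed (rule nonneg_powser_nonneg[OF powser])
    also have "\<dots> = (\<integral>x. (\<Sum>n<K. a n * ((lift_norm x)\<^sup>2 * (2 * (1 - ?u x ^ n)))) \<partial>M)"
      using term_int by (subst Bochner_Integration.integral_sum) auto
    also have "\<dots> \<le> (\<integral>x. 2 * \<eta> * (lift_norm x)\<^sup>2 \<partial>M)"
    proof (rule integral_mono)
      show "integrable M (\<lambda>x. \<Sum>n<K. a n * ((lift_norm x)\<^sup>2 * (2 * (1 - ?u x ^ n))))"
        using term_int by simp
      show "integrable M (\<lambda>x. 2 * \<eta> * (lift_norm x)\<^sup>2)" using moment by simp
      fix x
      have "(\<Sum>n<K. a n * (1 - ?u x ^ n)) \<le> h 1 - h (?u x)"
      proof -
        have "(\<lambda>n. a n - a n * ?u x ^ n) sums (h 1 - h (?u x))"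
          by (intro sums_diff nonneg_powser_sums_one[OF powser] nonneg_powser_sums[OF powser] abs_inner_direction_le)
        then have s: "(\<lambda>n. a n * (1 - ?u x ^ n)) sums (h 1 - h (?u x))" by (simp add: right_diff_distrib)
        have "0 \<le> a n * (1 - ?u x ^ n)" for n
          using pow1[of x n] nonneg_powser_nonneg[OF powser, of n] by (simp add: abs_le_iff)
        then show ?thesis
          using sum_le_suminf[OF sums_summable[OF s], of "{..<K}"] sums_unique[OF s] by simp
      qed
      also have "\<dots> \<le> \<eta>" by (rule close)
      finally have "(2 * (lift_norm x)\<^sup>2) * (\<Sum>n<K. a n * (1 - ?u x ^ n)) \<le> (2 * (lift_norm x)\<^sup>2) * \<eta>"
        by (rule mult_left_mono) simp
      moreover have "(\<Sum>n<K. a n * ((lift_norm x)\<^sup>2 * (2 * (1 - ?u x ^ n))))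
          = (2 * (lift_norm x)\<^sup>2) * (\<Sum>n<K. a n * (1 - ?u x ^ n))"
        unfolding sum_distrib_left by (intro sum.cong refl) (simp only: mult_ac)
      ultimately show "(\<Sum>n<K. a n * ((lift_norm x)\<^sup>2 * (2 * (1 - ?u x ^ n)))) \<le> 2 * \<eta> * (lift_norm x)\<^sup>2"
        by (simp only: mult_ac)
    qed
    finally show ?thesis by simp
  qed
  have "N * t = (\<Sum>l<N. t)" by simp
  also have "\<dots> \<le> (\<Sum>l<N. ip M (T (g l)) (g l))" by (intro sum_mono g(2)) auto
  also have "\<dots> \<le> ?B"
  proof (rule LIMSEQ_le_const2)
    have "(\<lambda>n. \<Sum>l<N. a n * power_form n (g l)) sums (\<Sum>l<N. ip M (T (g l)) (g l))"
    proof (rule sums_sum)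
      fix l assume "l \<in> {..<N}"
      then have l: "l < N" by simp
      have "ip M (\<lambda>x. 1) (g l) = 0"
        using g(3)[OF l, of "\<lambda>x. 1"] ip_commute[of M "\<lambda>x. 1" "g l"] by (simp add: H_def)
      then show "(\<lambda>n. a n * power_form n (g l)) sums ip M (T (g l)) (g l)"
        using form_sums[OF gl[OF l]] by simp
    qed
    then show "(\<lambda>K. \<Sum>n<K. a n * (\<Sum>l<N. power_form n (g l))) \<longlonglongrightarrow> (\<Sum>l<N. ip M (T (g l)) (g l))"
      by (simp add: sums_def sum_distrib_left)
    show "\<exists>K. \<forall>n\<ge>K. (\<Sum>n<n. a n * (\<Sum>l<N. power_form n (g l))) \<le> ?B" using partial by blast
  qed
  finally show ?thesis .
qed

end

lemma eigenvalue_bounds_downward: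
  assumes t: "t \<in> eigenvalue_bounds k M i" and s: "0 < s" "s \<le> t"
  shows "s \<in> eigenvalue_bounds k M i"
proof -
  obtain f :: "nat \<Rightarrow> 'a \<Rightarrow> real" and lam :: "nat \<Rightarrow> real"
    where all: "\<forall>j<i. f j \<in> borel_measurable M \<and> integrable M (\<lambda>x. (f j x)\<^sup>2) \<and> lam j \<ge> t \<and>
               (AE x in M. integrable M (\<lambda>y. k x y * f j y) \<and> (\<integral>y. k x y * f j y \<partial>M) = lam j * f j x)"
    and ind: "\<forall>c :: nat \<Rightarrow> real. (AE x in M. (\<Sum>j<i. c j * f j x) = 0) \<longrightarrow> (\<forall>j<i. c j = 0)"
    using t unfolding eigenvalue_bounds_def by auto
  have "\<forall>j<i. f j \<in> borel_measurable M \<and> integrable M (\<lambda>x. (f j x)\<^sup>2) \<and> lam j \<ge> s \<and>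
               (AE x in M. integrable M (\<lambda>y. k x y * f j y) \<and> (\<integral>y. k x y * f j y \<partial>M) = lam j * f j x)"
    using all s(2) order_trans by blast
  then show ?thesis unfolding eigenvalue_bounds_def using s(1) ind by blast
qed

section \<open>Angles between directions, diagonal dominance, test functions on disjoint
  blocks\<close>

lemma lift_norm_square: "(lift_norm x)\<^sup>2 = 1 + (norm x)\<^sup>2"
  by (simp add: lift_norm_def norm_Pair)

lemma inner_direction: "direction x \<bullet> direction y = (x \<bullet> y + 1) / (lift_norm x * lift_norm y)"
  by (simp add: direction_def add_divide_distrib mult.commute)

text \<open>The squared sine of the angle is (P + G) / W, where P is the squared distance of x and y
  and G the Gram determinant of x and y. The first bound is G >= 0. For the second, G is also the
  Gram determinant of x and x - y, hence at most P times the squared norm of x.\<close>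

lemma inner_direction_square_bounds:
  fixes x y :: "'a::euclidean_space"
  shows "(direction x \<bullet> direction y)\<^sup>2 \<le> 1 - (norm (x - y))\<^sup>2 / ((lift_norm x)\<^sup>2 * (lift_norm y)\<^sup>2)"
    and "1 - (norm (x - y))\<^sup>2 \<le> (direction x \<bullet> direction y)\<^sup>2"
proof -
  let ?W = "(lift_norm x)\<^sup>2 * (lift_norm y)\<^sup>2"
  define P where "P = (norm (x - y))\<^sup>2"
  define G where "G = (norm x)\<^sup>2 * (norm y)\<^sup>2 - (x \<bullet> y)\<^sup>2"
  have W0: "0 < ?W" by simp
  have P: "P = (norm x)\<^sup>2 + (norm y)\<^sup>2 - 2 * (x \<bullet> y)"
    by (simp add: P_def power2_norm_eq_inner inner_diff_left inner_diff_right inner_commute)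
  have "?W - (x \<bullet> y + 1)\<^sup>2 = P + G"
    unfolding lift_norm_square P G_def by (simp add: power2_eq_square algebra_simps)
  then have sq: "(direction x \<bullet> direction y)\<^sup>2 = 1 - (P + G) / ?W"
    using W0 by (simp add: inner_direction power_divide power_mult_distrib field_simps)
  have G0: "0 \<le> G"
    using Cauchy_Schwarz_ineq[of x y] by (simp add: G_def power2_norm_eq_inner)
  have "P / ?W \<le> (P + G) / ?W" using G0 W0 by (intro divide_right_mono) auto
  then show "(direction x \<bullet> direction y)\<^sup>2 \<le> 1 - (norm (x - y))\<^sup>2 / ?W"
    unfolding sq P_def[symmetric] by simp
  have "G = (norm x)\<^sup>2 * P - (x \<bullet> (x - y))\<^sup>2"
    unfolding P G_def inner_diff_right dot_square_norm by (simp add: power2_eq_square algebra_simps)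
  then have "G \<le> (norm x)\<^sup>2 * P" by simp
  then have "P + G \<le> (lift_norm x)\<^sup>2 * P" by (simp add: lift_norm_square algebra_simps)
  also have "\<dots> \<le> (lift_norm x)\<^sup>2 * P * (lift_norm y)\<^sup>2"
    using mult_left_mono[of 1 "(lift_norm y)\<^sup>2" "(lift_norm x)\<^sup>2 * P"] lift_norm_ge_one[of y]
    by (simp add: P_def one_le_power)
  finally have "P + G \<le> P * ?W" by (simp add: algebra_simps)
  then have "(P + G) / ?W \<le> P" using W0 by (simp add: pos_divide_le_eq)
  then show "1 - (norm (x - y))\<^sup>2 \<le> (direction x \<bullet> direction y)\<^sup>2"
    unfolding sq P_def[symmetric] by simp
qed

text \<open>Gershgorin's bound for quadratic forms: each mixed product is split by 2|c_j c_l| <=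
  c_j^2 + c_l^2, and symmetry merges the two halves into row sums.\<close>

lemma diagonally_dominant_form_ge:
  fixes E :: "'j \<Rightarrow> 'j \<Rightarrow> real"
  assumes J: "finite J" and sym: "\<And>j l. E j l = E l j" and diag: "\<And>j. j \<in> J \<Longrightarrow> d \<le> E j j"
    and off: "\<And>j. j \<in> J \<Longrightarrow> (\<Sum>l\<in>J - {j}. \<bar>E j l\<bar>) \<le> r"
  shows "(d - r) * (\<Sum>j\<in>J. (c j)\<^sup>2) \<le> (\<Sum>j\<in>J. \<Sum>l\<in>J. c j * c l * E j l)"
proof -
  have half: "- (\<bar>E j l\<bar> * (c j)\<^sup>2 + \<bar>E j l\<bar> * (c l)\<^sup>2) / 2 \<le> c j * c l * E j l" for j l
  proof -
    have "2 * \<bar>c j * c l\<bar> \<le> (c j)\<^sup>2 + (c l)\<^sup>2"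
      using sum_squares_bound[of "\<bar>c j\<bar>" "\<bar>c l\<bar>"] by (simp add: abs_mult)
    then have "\<bar>E j l\<bar> * (2 * \<bar>c j * c l\<bar>) \<le> \<bar>E j l\<bar> * ((c j)\<^sup>2 + (c l)\<^sup>2)" by (rule mult_left_mono) simp
    moreover have "- (\<bar>E j l\<bar> * \<bar>c j * c l\<bar>) \<le> c j * c l * E j l"
      using abs_ge_minus_self[of "c j * c l * E j l"] by (simp add: abs_mult algebra_simps)
    ultimately show ?thesis by (simp add: algebra_simps)
  qed
  define off_diag where "off_diag j l = (if j = l then 0 else \<bar>E j l\<bar>)" for j l
  have O_sum: "(\<Sum>l\<in>J. off_diag j l) \<le> r" if "j \<in> J" for j
  proof -
    have "(\<Sum>l\<in>J. off_diag j l) = (\<Sum>l\<in>J - {j}. \<bar>E j l\<bar>)"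
      using J that by (simp add: sum.remove[of J j] off_diag_def) (intro sum.cong, auto)
    then show ?thesis using off[OF that] by simp
  qed
  have O_sym: "off_diag j l = off_diag l j" for j l using sym by (simp add: off_diag_def)
  have "(\<Sum>j\<in>J. d * (c j)\<^sup>2) - (\<Sum>j\<in>J. \<Sum>l\<in>J. (off_diag j l * (c j)\<^sup>2 + off_diag j l * (c l)\<^sup>2) / 2)
      \<le> (\<Sum>j\<in>J. \<Sum>l\<in>J. c j * c l * E j l)"
  proof -
    have "(\<Sum>l\<in>J. (if l = j then d * (c j)\<^sup>2 else 0) - (off_diag j l * (c j)\<^sup>2 + off_diag j l * (c l)\<^sup>2) / 2)
        \<le> (\<Sum>l\<in>J. c j * c l * E j l)" if "j \<in> J" for j
    proof (intro sum_mono)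
      fix l assume "l \<in> J"
      show "(if l = j then d * (c j)\<^sup>2 else 0) - (off_diag j l * (c j)\<^sup>2 + off_diag j l * (c l)\<^sup>2) / 2 \<le> c j * c l * E j l"
      proof (cases "l = j")
        case True
        then show ?thesis using mult_right_mono[OF diag[OF that], of "(c j)\<^sup>2"]
          by (simp add: off_diag_def power2_eq_square mult.commute)
      next
        case False
        then have o: "off_diag j l = \<bar>E j l\<bar>" by (simp add: off_diag_def)
          show ?thesis using False half[of j l] unfolding o
            by (simp only: if_False minus_divide_left[symmetric] diff_0)
      qed
    qed
    then have "(\<Sum>j\<in>J. \<Sum>l\<in>J. (if l = j then d * (c j)\<^sup>2 else 0) - (off_diag j l * (c j)\<^sup>2 + off_diag j l * (c l)\<^sup>2) / 2)
        \<le> (\<Sum>j\<in>J. \<Sum>l\<in>J. c j * c l * E j l)" by (rule sum_mono)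
    then show ?thesis using J by (simp add: sum_subtractf)
  qed
  moreover have "(\<Sum>j\<in>J. \<Sum>l\<in>J. (off_diag j l * (c j)\<^sup>2 + off_diag j l * (c l)\<^sup>2) / 2) \<le> r * (\<Sum>j\<in>J. (c j)\<^sup>2)"
  proof -
    have "(\<Sum>j\<in>J. \<Sum>l\<in>J. off_diag j l * (c l)\<^sup>2) = (\<Sum>j\<in>J. \<Sum>l\<in>J. off_diag j l * (c j)\<^sup>2)"
      by (subst sum.swap) (simp add: O_sym)
    then have "(\<Sum>j\<in>J. \<Sum>l\<in>J. (off_diag j l * (c j)\<^sup>2 + off_diag j l * (c l)\<^sup>2) / 2) = (\<Sum>j\<in>J. \<Sum>l\<in>J. off_diag j l * (c j)\<^sup>2)"
      by (simp add: sum_divide_distrib[symmetric] sum.distrib)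
    also have "\<dots> = (\<Sum>j\<in>J. (\<Sum>l\<in>J. off_diag j l) * (c j)\<^sup>2)" by (simp add: sum_distrib_right)
    also have "\<dots> \<le> (\<Sum>j\<in>J. r * (c j)\<^sup>2)" by (intro sum_mono mult_right_mono O_sum) auto
    finally show ?thesis by (simp add: sum_distrib_left)
  qed
  ultimately show ?thesis by (simp add: sum_distrib_left[symmetric] algebra_simps)
qed

context zonal_prob
begin

text \<open>The sum is the double integral of the n-th power of the inner product of directions
  against two probability densities, namely the weight times \<psi> and the weight times \<phi>. An
  average lies between the bounds for its integrand.\<close>

lemma feature_pair_bounds:
  assumes \<psi>: "\<psi> \<in> l2 M" "\<And>x. 0 \<le> \<psi> x" "ip M lift_norm \<psi> = 1"
    and \<phi>: "\<phi> \<in> l2 M" "\<And>x. 0 \<le> \<phi> x" "ip M lift_norm \<phi> = 1"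
    and bounds: "\<And>x y. \<psi> x \<noteq> 0 \<Longrightarrow> \<phi> y \<noteq> 0 \<Longrightarrow>
      lo \<le> (direction x \<bullet> direction y) ^ n \<and> (direction x \<bullet> direction y) ^ n \<le> hi"
  shows "lo \<le> (\<Sum>\<alpha>\<in>multi_indices n. ip M (feature n \<alpha>) \<psi> * ip M (feature n \<alpha>) \<phi>)"
    and "(\<Sum>\<alpha>\<in>multi_indices n. ip M (feature n \<alpha>) \<psi> * ip M (feature n \<alpha>) \<phi>) \<le> hi"
proof -
  define G where "G x = (\<Sum>\<alpha>\<in>multi_indices n. feature n \<alpha> x * ip M (feature n \<alpha>) \<phi>)" for x
  have Gl2: "G \<in> l2 M"
    unfolding G_def[abs_def] by (intro l2_sum) (subst mult.commute, intro l2_cmult feature_l2)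
  have sum_eq: "(\<Sum>\<alpha>\<in>multi_indices n. ip M (feature n \<alpha>) \<psi> * ip M (feature n \<alpha>) \<phi>) = ip M G \<psi>"
  proof -
    have "G = (\<lambda>x. \<Sum>\<alpha>\<in>multi_indices n. ip M (feature n \<alpha>) \<phi> * feature n \<alpha> x)"
      by (simp add: G_def fun_eq_iff mult.commute)
    then have "ip M G \<psi> = (\<Sum>\<alpha>\<in>multi_indices n. ip M (\<lambda>x. ip M (feature n \<alpha>) \<phi> * feature n \<alpha> x) \<psi>)"
      using ip_sum_left[of "multi_indices n" "\<lambda>\<alpha> x. ip M (feature n \<alpha>) \<phi> * feature n \<alpha> x" M \<psi>] \<psi>(1)
      by (simp add: feature_l2)
    then show ?thesis unfolding ip_cmult_left by (simp add: mult.commute)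
  qed
  have int_\<psi>: "integrable M (\<lambda>x. lift_norm x * \<psi> x)" and int_\<phi>: "integrable M (\<lambda>x. lift_norm x * \<phi> x)"
    by (intro l2_integrable_mult lift_norm_l2 \<psi>(1) \<phi>(1))+
  have G_int: "integrable M (\<lambda>y. lift_norm x * lift_norm y * (direction x \<bullet> direction y) ^ n * \<phi> y)" for x
  proof (rule Bochner_Integration.integrable_bound)
    show "integrable M (\<lambda>y. lift_norm x * (lift_norm y * \<phi> y))" using int_\<phi> by simp
    show "(\<lambda>y. lift_norm x * lift_norm y * (direction x \<bullet> direction y) ^ n * \<phi> y) \<in> borel_measurable M"
      by (intro borel_measurable_times[OF _ l2_measurable[OF \<phi>(1)]] continuous_measurable continuous_intros)
    have "norm (lift_norm x * lift_norm y * (direction x \<bullet> direction y) ^ n * \<phi> y) \<le> norm (lift_norm x * (lift_norm y * \<phi> y))" for y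
    proof -
      have "\<bar>direction x \<bullet> direction y\<bar> ^ n \<le> 1"
        by (rule power_le_one) (auto intro: abs_inner_direction_le)
      then have "(lift_norm x * lift_norm y * \<bar>\<phi> y\<bar>) * \<bar>direction x \<bullet> direction y\<bar> ^ n \<le> (lift_norm x * lift_norm y * \<bar>\<phi> y\<bar>) * 1"
        by (intro mult_left_mono) auto
      then show ?thesis by (simp add: abs_mult power_abs algebra_simps)
    qed
    then show "AE y in M. norm (lift_norm x * lift_norm y * (direction x \<bullet> direction y) ^ n * \<phi> y) \<le> norm (lift_norm x * (lift_norm y * \<phi> y))"
      by simp
  qed
  have G_bounds: "lo * lift_norm x \<le> G x" "G x \<le> hi * lift_norm x" if x: "\<psi> x \<noteq> 0" for x
  proof -
    have one: "(\<integral>y. lift_norm y * \<phi> y \<partial>M) = 1" using \<phi>(3) by (simp add: ip_def)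
    have pt: "lo * lift_norm x * (lift_norm y * \<phi> y) \<le> lift_norm x * lift_norm y * (direction x \<bullet> direction y) ^ n * \<phi> y \<and>
        lift_norm x * lift_norm y * (direction x \<bullet> direction y) ^ n * \<phi> y \<le> hi * lift_norm x * (lift_norm y * \<phi> y)" for y
    proof (cases "\<phi> y = 0")
      case False
      have "0 \<le> lift_norm x * lift_norm y * \<phi> y" using \<phi>(2) by simp
      from mult_left_mono[OF _ this, of lo "(direction x \<bullet> direction y) ^ n"]
        mult_left_mono[OF _ this, of "(direction x \<bullet> direction y) ^ n" hi] bounds[OF x False]
      show ?thesis by (simp add: algebra_simps)
    qed simp
    have "(\<integral>y. lo * lift_norm x * (lift_norm y * \<phi> y) \<partial>M) \<le> G x"
      unfolding G_def feature_sum_ip[OF \<phi>(1)] using G_int int_\<phi> pt by (intro integral_mono) auto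
    then show "lo * lift_norm x \<le> G x" using one by simp
    have "G x \<le> (\<integral>y. hi * lift_norm x * (lift_norm y * \<phi> y) \<partial>M)"
      unfolding G_def feature_sum_ip[OF \<phi>(1)] using G_int int_\<phi> pt by (intro integral_mono) auto
    then show "G x \<le> hi * lift_norm x" using one by simp
  qed
  have pt: "lo * (lift_norm x * \<psi> x) \<le> G x * \<psi> x \<and> G x * \<psi> x \<le> hi * (lift_norm x * \<psi> x)" for x
  proof (cases "\<psi> x = 0")
    case False
    then show ?thesis
      using mult_right_mono[OF G_bounds(1) \<psi>(2), of x] mult_right_mono[OF G_bounds(2) \<psi>(2), of x]
      by (simp add: mult.assoc)
  qed simp
  have int_G: "integrable M (\<lambda>x. G x * \<psi> x)" by (rule l2_integrable_mult[OF Gl2 \<psi>(1)])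
  have one: "(\<integral>x. lift_norm x * \<psi> x \<partial>M) = 1" using \<psi>(3) by (simp add: ip_def)
  have "(\<integral>x. lo * (lift_norm x * \<psi> x) \<partial>M) \<le> ip M G \<psi>"
    unfolding ip_def using int_G int_\<psi> pt by (intro integral_mono) auto
  then show "lo \<le> (\<Sum>\<alpha>\<in>multi_indices n. ip M (feature n \<alpha>) \<psi> * ip M (feature n \<alpha>) \<phi>)"
    unfolding sum_eq using one by simp
  have "ip M G \<psi> \<le> (\<integral>x. hi * (lift_norm x * \<psi> x) \<partial>M)"
    unfolding ip_def using int_G int_\<psi> pt by (intro integral_mono) auto
  then show "(\<Sum>\<alpha>\<in>multi_indices n. ip M (feature n \<alpha>) \<psi> * ip M (feature n \<alpha>) \<phi>) \<le> hi"
    unfolding sum_eq using one by simp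
qed

text \<open>For every degree in \<open>S\<close> the Gram matrix of the block functions has diagonal
  at least 1/2 and off-diagonal row sums at most 1/4, so its form is at least 1/4 of the sum of the
  squared coefficients. The factor \<open>v0\<close> converts that sum back into the squared
  norm.\<close>

lemma eigenvalue_bounds_by_blocks:
  fixes B :: "'j \<Rightarrow> 'a set"
  assumes J: "finite J" and S: "finite S" and v0: "0 < v0"
    and meas: "\<And>j. j \<in> J \<Longrightarrow> B j \<in> sets M" and mass: "\<And>j. j \<in> J \<Longrightarrow> v0 \<le> measure M (B j)"
    and disj: "\<And>j l. j \<in> J \<Longrightarrow> l \<in> J \<Longrightarrow> j \<noteq> l \<Longrightarrow> B j \<inter> B l = {}"
    and even: "\<And>n. n \<in> S \<Longrightarrow> even n"
    and diag: "\<And>n j x y. n \<in> S \<Longrightarrow> j \<in> J \<Longrightarrow> x \<in> B j \<Longrightarrow> y \<in> B j \<Longrightarrow> 1 / 2 \<le> (direction x \<bullet> direction y) ^ n"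
    and off: "\<And>n j l x y. n \<in> S \<Longrightarrow> j \<in> J \<Longrightarrow> l \<in> J \<Longrightarrow> j \<noteq> l \<Longrightarrow> x \<in> B j \<Longrightarrow> y \<in> B l \<Longrightarrow>
      (direction x \<bullet> direction y) ^ n \<le> \<theta> j l"
    and off_sum: "\<And>j. j \<in> J \<Longrightarrow> (\<Sum>l\<in>J - {j}. \<theta> j l) \<le> 1 / 4"
    and pos: "0 < (\<Sum>n\<in>S. a n)" and i: "i \<le> card J"
  shows "v0 / 4 * (\<Sum>n\<in>S. a n) \<in> eigenvalue_bounds (zonal_kernel h) M i"
proof -
  define m where "m j = (\<integral>x. lift_norm x * indicator (B j) x \<partial>M)" for j
  \<comment> \<open>Scaled to have integral 1 against the weight, as
    \<open>feature_pair_bounds\<close> requires. Since the weight is at least 1, \<open>m j\<close>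
    is at least the mass of the block, which keeps the squared norm below
    \<open>1 / v0\<close>.\<close>
  define \<psi> where "\<psi> j x = (1 / m j) * indicator (B j) x" for j x
  have ind_l2: "indicator (B j) \<in> l2 M" if "j \<in> J" for j
    by (rule l2_bound[OF one_l2]) (use meas[OF that] in \<open>auto simp: indicator_def\<close>)
  have ind_ip: "ip M (indicator (B j)) (indicator (B j)) = measure M (B j)" if "j \<in> J" for j
  proof -
    have "ip M (indicator (B j)) (indicator (B j)) = (\<integral>x. indicator (B j) x \<partial>M)"
      unfolding ip_def by (intro Bochner_Integration.integral_cong) (auto simp: indicator_def)
    then show ?thesis using meas[OF that] by simp
  qed
  have m_ge: "measure M (B j) \<le> m j" if "j \<in> J" for j
  proof -
    have "(\<integral>x. indicator (B j) x \<partial>M) \<le> m j"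
      unfolding m_def
    proof (rule integral_mono)
      show "integrable M (indicator (B j) :: 'a \<Rightarrow> real)"
        using l2_integrable_mult[OF one_l2 ind_l2[OF that]] by simp
      show "integrable M (\<lambda>x. lift_norm x * indicator (B j) x)"
        by (rule l2_integrable_mult[OF lift_norm_l2 ind_l2[OF that]])
      show "indicator (B j) x \<le> lift_norm x * indicator (B j) x" for x
        using lift_norm_ge_one[of x] by (simp add: indicator_def)
    qed
    then show ?thesis using meas[OF that] by simp
  qed
  have m_pos: "0 < m j" if "j \<in> J" for j using m_ge[OF that] mass[OF that] v0 by linarith
  have \<psi>l2: "\<psi> j \<in> l2 M" if "j \<in> J" for j
    unfolding \<psi>_def[abs_def] by (intro l2_cmult ind_l2 that)
  have \<psi>0: "0 \<le> \<psi> j x" if "j \<in> J" for j x using m_pos[OF that] by (simp add: \<psi>_def)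
  have \<psi>1: "ip M lift_norm (\<psi> j) = 1" if "j \<in> J" for j
    unfolding \<psi>_def[abs_def] ip_cmult_right using m_pos[OF that] by (simp add: m_def ip_def)
  have \<psi>B: "x \<in> B j" if "\<psi> j x \<noteq> 0" for j x using that by (auto simp: \<psi>_def indicator_def split: if_splits)
  have \<psi>\<psi>: "ip M (\<psi> j) (\<psi> j) \<le> 1 / v0" if "j \<in> J" for j
  proof -
    have "ip M (\<psi> j) (\<psi> j) = (1 / m j) * ((1 / m j) * measure M (B j))"
      unfolding \<psi>_def[abs_def] ip_cmult_left ip_cmult_right ind_ip[OF that] ..
    also have "\<dots> \<le> (1 / m j) * ((1 / m j) * m j)"
      using m_ge[OF that] m_pos[OF that] by (intro mult_left_mono) auto
    also have "\<dots> = 1 / m j" using m_pos[OF that] by simp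
    also have "\<dots> \<le> 1 / v0" using m_ge[OF that] mass[OF that] v0 by (intro frac_le) auto
    finally show ?thesis .
  qed
  have \<psi>orth: "ip M (\<psi> j) (\<psi> l) = 0" if "j \<in> J" "l \<in> J" "j \<noteq> l" for j l
  proof -
    have "\<psi> j x * \<psi> l x = 0" for x using disj[OF that] \<psi>B[of j x] \<psi>B[of l x] by auto
    then show ?thesis unfolding ip_def by (simp only: Bochner_Integration.integral_zero)
  qed
  let ?f = "\<lambda>c x. \<Sum>j\<in>J. c j * \<psi> j x"
  have fl2: "?f c \<in> l2 M" for c by (intro l2_sum l2_cmult \<psi>l2)
  have ff: "ip M (?f c) (?f c) \<le> (1 / v0) * (\<Sum>j\<in>J. (c j)\<^sup>2)" for c
  proof -
    have "ip M (?f c) (?f c) = (\<Sum>j\<in>J. \<Sum>l\<in>J. c j * c l * ip M (\<psi> j) (\<psi> l))"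
      by (intro ip_sum_sum \<psi>l2)
    also have "\<dots> = (\<Sum>j\<in>J. \<Sum>l\<in>J. if l = j then c j * c j * ip M (\<psi> j) (\<psi> j) else 0)"
      by (intro sum.cong) (auto simp: \<psi>orth)
    also have "\<dots> = (\<Sum>j\<in>J. (c j)\<^sup>2 * ip M (\<psi> j) (\<psi> j))" using J by (simp add: power2_eq_square)
    also have "\<dots> \<le> (\<Sum>j\<in>J. (c j)\<^sup>2 * (1 / v0))" by (intro sum_mono mult_left_mono \<psi>\<psi>) auto
    finally show ?thesis by (simp add: sum_divide_distrib)
  qed
  have form: "1 / 4 * (\<Sum>j\<in>J. (c j)\<^sup>2) \<le> power_form n (?f c)" if n: "n \<in> S" for c n
  proof -
    define E where "E j l = (\<Sum>\<alpha>\<in>multi_indices n. ip M (feature n \<alpha>) (\<psi> j) * ip M (feature n \<alpha>) (\<psi> l))" for j l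
    have ipf: "ip M (feature n \<alpha>) (?f c) = (\<Sum>j\<in>J. c j * ip M (feature n \<alpha>) (\<psi> j))"
      if "\<alpha> \<in> multi_indices n" for \<alpha>
    proof -
      have "ip M (feature n \<alpha>) (?f c) = (\<Sum>j\<in>J. ip M (feature n \<alpha>) (\<lambda>x. c j * \<psi> j x))"
        by (intro ip_sum_right l2_cmult \<psi>l2 feature_l2 that)
      then show ?thesis by (simp only: ip_cmult_right)
    qed
    have "power_form n (?f c) = (\<Sum>\<alpha>\<in>multi_indices n. \<Sum>j\<in>J. \<Sum>l\<in>J.
        c j * c l * (ip M (feature n \<alpha>) (\<psi> j) * ip M (feature n \<alpha>) (\<psi> l)))"
      unfolding power_form_def
      by (intro sum.cong refl) (simp add: ipf power2_eq_square sum_product algebra_simps)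
    also have "\<dots> = (\<Sum>j\<in>J. \<Sum>\<alpha>\<in>multi_indices n. \<Sum>l\<in>J.
        c j * c l * (ip M (feature n \<alpha>) (\<psi> j) * ip M (feature n \<alpha>) (\<psi> l)))" by (rule sum.swap)
    also have "\<dots> = (\<Sum>j\<in>J. \<Sum>l\<in>J. c j * c l * E j l)"
      unfolding E_def sum_distrib_left by (intro sum.cong refl sum.swap)
    finally have pf: "power_form n (?f c) = (\<Sum>j\<in>J. \<Sum>l\<in>J. c j * c l * E j l)" .
    have "(1 / 2 - 1 / 4) * (\<Sum>j\<in>J. (c j)\<^sup>2) \<le> power_form n (?f c)"
      unfolding pf
    proof (rule diagonally_dominant_form_ge[OF J])
      show "E j l = E l j" for j l by (simp add: E_def mult.commute)
      show "1 / 2 \<le> E j j" if j: "j \<in> J" for j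
        unfolding E_def
      proof (rule feature_pair_bounds(1)[OF \<psi>l2[OF j] \<psi>0[OF j] \<psi>1[OF j] \<psi>l2[OF j] \<psi>0[OF j] \<psi>1[OF j]])
        fix x y assume "\<psi> j x \<noteq> 0" "\<psi> j y \<noteq> 0"
        then have "1 / 2 \<le> (direction x \<bullet> direction y) ^ n" using diag[OF n j] \<psi>B by blast
        moreover have "(direction x \<bullet> direction y) ^ n \<le> 1"
          using power_le_one[of "\<bar>direction x \<bullet> direction y\<bar>" n] abs_inner_direction_le[of x y]
            abs_ge_self[of "(direction x \<bullet> direction y) ^ n"] by (simp add: power_abs)
        ultimately show "1 / 2 \<le> (direction x \<bullet> direction y) ^ n \<and> (direction x \<bullet> direction y) ^ n \<le> 1" ..
      qed
      have E_off: "\<bar>E j l\<bar> \<le> \<theta> j l" if jl: "j \<in> J" "l \<in> J" "j \<noteq> l" for j l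
      proof -
        \<comment> \<open>Even degrees supply the lower bound 0, so that one upper bound controls
          the absolute value of the entry.\<close>
        have b: "0 \<le> (direction x \<bullet> direction y) ^ n \<and> (direction x \<bullet> direction y) ^ n \<le> \<theta> j l"
          if "\<psi> j x \<noteq> 0" "\<psi> l y \<noteq> 0" for x y
          using off[OF n jl \<psi>B[OF that(1)] \<psi>B[OF that(2)]] zero_le_even_power[OF even[OF n]] by blast
        have "0 \<le> E j l" "E j l \<le> \<theta> j l"
          unfolding E_def
          by (rule feature_pair_bounds[OF \<psi>l2[OF jl(1)] \<psi>0[OF jl(1)] \<psi>1[OF jl(1)]
                \<psi>l2[OF jl(2)] \<psi>0[OF jl(2)] \<psi>1[OF jl(2)] b], assumption+)+
        then show ?thesis by simp
      qed
      show "(\<Sum>l\<in>J - {j}. \<bar>E j l\<bar>) \<le> 1 / 4" if j: "j \<in> J" for j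
      proof -
        have "(\<Sum>l\<in>J - {j}. \<bar>E j l\<bar>) \<le> (\<Sum>l\<in>J - {j}. \<theta> j l)"
          by (intro sum_mono E_off) (use j in auto)
        then show ?thesis using off_sum[OF j] by linarith
      qed
    qed
    then show ?thesis by simp
  qed
  let ?A = "\<Sum>n\<in>S. a n"
  have Tf: "?A * (1 / 4 * (\<Sum>j\<in>J. (c j)\<^sup>2)) \<le> ip M (T (?f c)) (?f c)" for c
  proof -
    have "?A * (1 / 4 * (\<Sum>j\<in>J. (c j)\<^sup>2)) = (\<Sum>n\<in>S. a n * (1 / 4 * (\<Sum>j\<in>J. (c j)\<^sup>2)))"
      by (rule sum_distrib_right)
    also have "\<dots> \<le> (\<Sum>n\<in>S. a n * power_form n (?f c))"
      by (intro sum_mono mult_left_mono form nonneg_powser_nonneg[OF powser])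
    also have "\<dots> \<le> ip M (T (?f c)) (?f c)" by (rule form_ge_partial_sum[OF fl2 S])
    finally show ?thesis .
  qed
  show ?thesis
  proof (rule eigenvalue_bounds_memI[OF J _ \<psi>l2 _ _ i])
    show "0 < v0 / 4 * ?A" using v0 pos by simp
    fix c :: "'j \<Rightarrow> real"
    have "v0 / 4 * ?A * ip M (?f c) (?f c) \<le> v0 / 4 * ?A * ((1 / v0) * (\<Sum>j\<in>J. (c j)\<^sup>2))"
      using v0 pos by (intro mult_left_mono ff) auto
    also have "\<dots> = ?A * (1 / 4 * (\<Sum>j\<in>J. (c j)\<^sup>2))" using v0 by simp
    also have "\<dots> \<le> ip M (T (?f c)) (?f c)" by (rule Tf)
    finally show "v0 / 4 * ?A * ip M (?f c) (?f c) \<le> ip M (T (?f c)) (?f c)" .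
  next
    fix c :: "'j \<Rightarrow> real" assume "\<exists>j\<in>J. c j \<noteq> 0"
    then have "0 < (\<Sum>j\<in>J. (c j)\<^sup>2)" using J by (auto intro: sum_pos2)
    then have "0 < ?A * (1 / 4 * (\<Sum>j\<in>J. (c j)\<^sup>2))" using pos by simp
    then have "0 < ip M (T (?f c)) (?f c)" using Tf[of c] by linarith
    \<comment> \<open>Independence comes for free: a function of norm zero would have form zero, but
      the form has just been shown to be positive.\<close>
    then have "ip M (?f c) (?f c) \<noteq> 0" using ip_T_abs_le[OF fl2[of c]] by auto
    then show "0 < ip M (?f c) (?f c)" by (rule ip_self_pos)
  qed
qed

end

section \<open>The lower bound\<close>

text \<open>Truncated subtraction makes one summand vanish. The value is a natural number so that it
  can serve as an exponent.\<close>

definition nat_dist :: "nat \<Rightarrow> nat \<Rightarrow> nat" where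
  "nat_dist a b = (a - b) + (b - a)"

lemma real_nat_dist: "real (nat_dist a b) = \<bar>real a - real b\<bar>"
  by (simp add: nat_dist_def of_nat_diff abs_if)

text \<open>A two-sided geometric series; the subtracted 1 is the centre, which both halves would
  count.\<close>

lemma sum_power_nat_dist_le:
  fixes \<theta> :: real
  assumes "0 < \<theta>" "\<theta> < 1" "a < m"
  shows "(\<Sum>b<m. \<theta> ^ nat_dist a b) \<le> 2 / (1 - \<theta>) - 1"
proof -
  have geo: "(\<Sum>i\<in>I. \<theta> ^ i) \<le> 1 / (1 - \<theta>)" if "finite I" for I
  proof -
    have "(\<Sum>i\<in>I. \<theta> ^ i) \<le> (\<Sum>i. \<theta> ^ i)"
      using assms that by (intro sum_le_suminf summable_geometric) auto
    then show ?thesis using assms by (simp add: suminf_geometric)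
  qed
  have "(\<Sum>b<m. \<theta> ^ nat_dist a b) = (\<Sum>b\<in>{..a}. \<theta> ^ nat_dist a b) + (\<Sum>b\<in>{a<..<m}. \<theta> ^ nat_dist a b)"
    using assms(3) by (subst sum.union_disjoint[symmetric]) (auto intro!: sum.cong)
  also have "(\<Sum>b\<in>{..a}. \<theta> ^ nat_dist a b) = (\<Sum>i\<in>(\<lambda>b. a - b) ` {..a}. \<theta> ^ i)"
    by (subst sum.reindex) (auto simp: inj_on_def nat_dist_def)
  also have "\<dots> \<le> 1 / (1 - \<theta>)" by (rule geo) simp
  also have "(\<Sum>b\<in>{a<..<m}. \<theta> ^ nat_dist a b) = (\<Sum>i\<in>(\<lambda>b. b - a) ` {a<..<m}. \<theta> ^ i)"
    by (subst sum.reindex) (auto simp: inj_on_def nat_dist_def)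
  also have "\<dots> \<le> 1 / (1 - \<theta>) - 1"
  proof -
    have "0 \<notin> (\<lambda>b. b - a) ` {a<..<m}" by auto
    then have "(\<Sum>i\<in>insert 0 ((\<lambda>b. b - a) ` {a<..<m}). \<theta> ^ i) = 1 + (\<Sum>i\<in>(\<lambda>b. b - a) ` {a<..<m}. \<theta> ^ i)"
      by simp
    then show ?thesis using geo[of "insert 0 ((\<lambda>b. b - a) ` {a<..<m})"] by simp
  qed
  finally show ?thesis by simp
qed

lemma norm_square_cart: "(norm (x :: real^'d))\<^sup>2 = (\<Sum>i\<in>UNIV. (x $ i)\<^sup>2)"
  by (simp add: norm_vec_def L2_set_def sum_nonneg)

lemma one_minus_power_le_exp:
  fixes x :: real
  assumes "x \<le> 1"
  shows "(1 - x) ^ k \<le> exp (- (real k * x))"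
proof -
  have "(1 - x) ^ k \<le> exp (- x) ^ k"
    using assms exp_ge_add_one_self[of "- x"] by (intro power_mono) auto
  then show ?thesis by (simp add: exp_of_nat_mult[symmetric])
qed

text \<open>The grid has spacing s but the cubes have side at most s/2, so different indices leave a
  gap. As the index distance is then at least 1, subtracting the side still leaves half of the
  distance of the corners.\<close>

lemma cbox_grid_coords:
  fixes j l :: "'d::finite \<Rightarrow> nat" and c x y :: "real^'d" and s \<epsilon> :: real
  assumes s: "0 < s" and \<epsilon>: "\<epsilon> \<le> 1 / 2"
    and x: "x \<in> cbox (\<chi> i. c $ i + s * j i) (\<chi> i. c $ i + s * (j i + \<epsilon>))"
    and y: "y \<in> cbox (\<chi> i. c $ i + s * l i) (\<chi> i. c $ i + s * (l i + \<epsilon>))"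
  shows "s / 2 * nat_dist (j i) (l i) \<le> \<bar>x $ i - y $ i\<bar>"
proof -
  have x': "c $ i + s * j i \<le> x $ i" "x $ i \<le> c $ i + s * (j i + \<epsilon>)"
    and y': "c $ i + s * l i \<le> y $ i" "y $ i \<le> c $ i + s * (l i + \<epsilon>)"
    using x y by (auto simp: mem_box_cart)
  have e: "s * \<epsilon> \<le> s / 2" using mult_left_mono[OF \<epsilon>, of s] s by simp
  show ?thesis
  proof (cases "j i = l i")
    case True
    then show ?thesis by (simp add: nat_dist_def)
  next
    case False
    consider "j i < l i" | "l i < j i" using False by linarith
    then show ?thesis
    proof cases
      case 1
      then have "1 \<le> real (l i) - real (j i)" by simp
      then have "s * 1 \<le> s * (real (l i) - real (j i))" using s by (intro mult_left_mono) auto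
      moreover have "s / 2 * nat_dist (j i) (l i) = (s * real (l i) - s * real (j i)) / 2"
        using 1 unfolding real_nat_dist by (simp add: algebra_simps)
      ultimately show ?thesis
        using x'(2) y'(1) e abs_ge_minus_self[of "x $ i - y $ i"] by (simp add: algebra_simps)
    next
      case 2
      then have "1 \<le> real (j i) - real (l i)" by simp
      then have "s * 1 \<le> s * (real (j i) - real (l i))" using s by (intro mult_left_mono) auto
      moreover have "s / 2 * nat_dist (j i) (l i) = (s * real (j i) - s * real (l i)) / 2"
        using 2 unfolding real_nat_dist by (simp add: algebra_simps)
      ultimately show ?thesis
        using x'(1) y'(2) e abs_ge_self[of "x $ i - y $ i"] by (simp add: algebra_simps)
    qed
  qed
qed

text \<open>The d-th power bounds a full row of the matrix with entries \<theta>^|j - l|_1 on a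
  d-dimensional grid. Its diagonal entry is 1, so 5/4 leaves 1/4 for the others.\<close>

lemma geometric_product_near_one:
  "\<exists>\<theta>>0. \<theta> < 1 \<and> (\<forall>\<theta>'. 0 < \<theta>' \<and> \<theta>' < \<theta> \<longrightarrow> (2 / (1 - \<theta>') - 1) ^ d \<le> 5 / (4::real))"
proof -
  have "((\<lambda>\<theta>::real. (2 / (1 - \<theta>) - 1) ^ d) \<longlongrightarrow> (2 / (1 - 0) - 1) ^ d) (at_right 0)"
    by (intro tendsto_intros) auto
  then have "\<forall>\<^sub>F \<theta> in at_right 0. (2 / (1 - \<theta>) - 1) ^ d < (5 / 4::real)"
    by (rule order_tendstoD) simp
  then obtain b :: real where b: "b > 0" "\<And>\<theta>. 0 < \<theta> \<Longrightarrow> \<theta> < b \<Longrightarrow> (2 / (1 - \<theta>) - 1) ^ d < 5 / 4"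
    unfolding eventually_at_right_field by blast
  show ?thesis
  proof (intro exI[of _ "min b (1/2)"] conjI allI impI)
    show "(2 / (1 - \<theta>') - 1) ^ d \<le> 5 / 4" if "0 < \<theta>' \<and> \<theta>' < min b (1/2)" for \<theta>'
      using b(2)[of \<theta>'] that by simp
  qed (use b(1) in auto)
qed

locale zonal_prob_cart = zonal_prob M a h for M :: "(real^'d) measure" and a h
begin

text \<open>A grid of \<open>m ^ d\<close> small cubes, tested against the even powers of order \<open>m\<^sup>2\<close>: these
  powers are nearly constant on one cube and small between different cubes.\<close>
lemma eigenvalue_lower_rate:
  fixes c :: "real^'d"
  assumes \<rho>: "0 < \<rho>" "\<rho> \<le> 1" and c0: "0 < c0"
    and sets: "sets borel \<subseteq> sets M"
    and mass: "\<And>u v. cbox u v \<subseteq> cbox c (\<chi> i. c $ i + \<rho>) \<Longrightarrow>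
      c0 * Henstock_Kurzweil_Integration.content (cbox u v) \<le> measure M (cbox u v)"
    and coeff: "0 < \<kappa>" "\<And>k. k \<ge> 1 \<Longrightarrow> \<kappa> * real k powr (-3/2) \<le> a (2 * k)"
  shows "\<exists>C>0. \<forall>m\<ge>1. \<forall>i\<le>m ^ CARD('d). C / real m ^ (CARD('d) + 1) \<in> eigenvalue_bounds (zonal_kernel h) M i"
proof -
  let ?d = "CARD('d)"
  obtain \<theta>0 :: real where \<theta>0: "0 < \<theta>0" "\<theta>0 < 1"
    "\<And>\<theta>. 0 < \<theta> \<Longrightarrow> \<theta> < \<theta>0 \<Longrightarrow> (2 / (1 - \<theta>) - 1) ^ ?d \<le> 5 / 4"
    using geometric_product_near_one[of ?d] by blast
  have "compact (lift_norm ` cbox c (\<chi> i. c $ i + \<rho>))"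
    by (intro compact_continuous_image continuous_intros) auto
  then have "bounded (lift_norm ` cbox c (\<chi> i. c $ i + \<rho>))" by (rule compact_imp_bounded)
  then obtain w0 where w0': "\<forall>z\<in>lift_norm ` cbox c (\<chi> i. c $ i + \<rho>). norm z \<le> w0"
    unfolding bounded_iff by blast
  have w0: "lift_norm x \<le> w0" if "x \<in> cbox c (\<chi> i. c $ i + \<rho>)" for x
    using w0' that by auto
  have c_in: "c \<in> cbox c (\<chi> i. c $ i + \<rho>)" using \<rho> by (simp add: mem_box_cart)
  have w0_ge: "1 \<le> w0" using w0[OF c_in] lift_norm_ge_one[of c] by linarith
  \<comment> \<open>Bounds the product of the two squared weights on the cube, the denominator in
    \<open>inner_direction_square_bounds\<close>.\<close>
  define D where "D = w0\<^sup>2 * w0\<^sup>2"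
  have D1: "1 \<le> D" using w0_ge unfolding D_def by (simp add: one_le_power flip: power_add)
  \<comment> \<open>Raising the degrees to order A m^2 makes \<theta>, the decay per unit of grid
    distance, as small as diagonal dominance demands.\<close>
  obtain A :: nat where A: "(ln (1 / \<theta>0) + 1) * (4 * D / \<rho>\<^sup>2) < A" using reals_Archimedean2 by blast
  have A_arg: "0 < (ln (1 / \<theta>0) + 1) * (4 * D / \<rho>\<^sup>2)"
    using \<theta>0 D1 \<rho> by (intro mult_pos_pos add_nonneg_pos) auto
  have A1: "1 \<le> A" using A A_arg by linarith
  \<comment> \<open>For k >= A m^2 and points at squared distance at least (\<rho> / 2m)^2 N, the
    exponent k P / D is at least N times the one here.\<close>
  define \<theta> where "\<theta> = exp (- (A * \<rho>\<^sup>2 / (4 * D)))"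
  have \<theta>: "0 < \<theta>" "\<theta> < \<theta>0"
  proof -
    have "ln (1 / \<theta>0) + 1 < A * \<rho>\<^sup>2 / (4 * D)"
      using A D1 \<rho> by (simp add: field_simps)
    then have "- (A * \<rho>\<^sup>2 / (4 * D)) < ln \<theta>0" using \<theta>0 by (simp add: ln_div)
    then have "\<theta> < exp (ln \<theta>0)" unfolding \<theta>_def by (simp only: exp_less_cancel_iff)
    then show "\<theta> < \<theta>0" using \<theta>0 by simp
  qed (simp add: \<theta>_def)
  \<comment> \<open>The relative side of the cubes. It is such that 2 A m^2 times the squared
    diameter of a cube is \<open>\<rho>\<^sup>2 / 2\<close>, hence at most 1/2.\<close>
  define \<epsilon> where "\<epsilon> = 1 / (2 * sqrt (A * ?d))"
  have \<epsilon>0: "0 < \<epsilon>" using A1 by (simp add: \<epsilon>_def)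
  have \<epsilon>2: "\<epsilon>\<^sup>2 = 1 / (4 * (A * ?d))" by (simp add: \<epsilon>_def power_divide power_mult_distrib)
  have \<epsilon>_le: "\<epsilon> \<le> 1 / 2"
  proof -
    have "1 * 1 \<le> real A * ?d" using A1 by (intro mult_mono) auto
    then show ?thesis by (simp add: \<epsilon>_def)
  qed
  \<comment> \<open>A quarter of the mass bound of a cube times the lower bound \<open>sumA\<close>
    for the coefficient sum, with the powers m^-d and m^-1 taken out.\<close>
  define C where "C = c0 * (\<epsilon> * \<rho>) ^ ?d / 4 * (A * (\<kappa> * (2 * A) powr (-3/2)))"
  have C0: "0 < C" using c0 \<epsilon>0 \<rho> A1 coeff(1) by (simp add: C_def)
  have "C / real m ^ (?d + 1) \<in> eigenvalue_bounds (zonal_kernel h) M i" if m: "m \<ge> 1" and i: "i \<le> m ^ ?d" for m i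
  proof -
    define s where "s = \<rho> / m"
    have s0: "0 < s" using \<rho> m by (simp add: s_def)
    define J :: "('d \<Rightarrow> nat) set" where "J = (UNIV \<rightarrow>\<^sub>E {..<m})"
    have J: "finite J" "card J = m ^ ?d" by (auto simp: J_def finite_PiE card_PiE)
    define B :: "('d \<Rightarrow> nat) \<Rightarrow> (real^'d) set" where
      "B j = cbox (\<chi> i. c $ i + s * j i) (\<chi> i. c $ i + s * (j i + \<epsilon>))" for j
    define S where "S = (\<lambda>k. 2 * k) ` {A * m\<^sup>2..<2 * A * m\<^sup>2}"
    define v0 where "v0 = c0 * (\<epsilon> * s) ^ ?d"
    have jm: "j i < m" if "j \<in> J" for j i using that by (auto simp: J_def)
    have B_sub: "B j \<subseteq> cbox c (\<chi> i. c $ i + \<rho>)" if j: "j \<in> J" for j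
    proof
      fix x assume x: "x \<in> B j"
      have "c $ i \<le> x $ i \<and> x $ i \<le> c $ i + \<rho>" for i
      proof -
        have b: "c $ i + s * j i \<le> x $ i" "x $ i \<le> c $ i + s * (j i + \<epsilon>)"
          using x by (auto simp: B_def mem_box_cart)
        have "real (j i) + \<epsilon> \<le> m" using jm[OF j, of i] \<epsilon>_le by linarith
        then have "s * (j i + \<epsilon>) \<le> s * m" using s0 by (intro mult_left_mono) auto
        then have "s * (j i + \<epsilon>) \<le> \<rho>" using m by (simp add: s_def)
        moreover have "0 \<le> s * j i" using s0 by simp
        ultimately show ?thesis using b by linarith
      qed
      then show "x \<in> cbox c (\<chi> i. c $ i + \<rho>)" by (simp add: mem_box_cart)
    qed
    have B_content: "Henstock_Kurzweil_Integration.content (B j) = (\<epsilon> * s) ^ ?d" for j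
    proof -
      have "Henstock_Kurzweil_Integration.content (B j) = (\<Prod>i\<in>UNIV. (c $ i + s * (j i + \<epsilon>)) - (c $ i + s * j i))"
        unfolding B_def using s0 \<epsilon>0
        by (subst content_cbox_cart) (auto simp: interval_ne_empty_cart intro!: prod.cong)
      also have "\<dots> = (\<Prod>i\<in>(UNIV :: 'd set). \<epsilon> * s)" by (intro prod.cong) (auto simp: algebra_simps)
      finally show ?thesis by simp
    qed
    have S_fin: "finite S" by (simp add: S_def)
    have B_diff: "s / 2 * nat_dist (j i) (l i) \<le> \<bar>x $ i - y $ i\<bar>" if "x \<in> B j" "y \<in> B l" for j l x y i
      using cbox_grid_coords[OF s0 \<epsilon>_le that[unfolded B_def]] .
    \<comment> \<open>There are A m^2 terms, each estimated by the bound at the largest degree,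
      which is of order m^-3.\<close>
    have sumA: "A * (\<kappa> * (2 * A) powr (-3/2)) / m \<le> (\<Sum>n\<in>S. a n)"
    proof -
      have Am: "1 \<le> A * m\<^sup>2" using A1 m by (simp add: Suc_le_eq)
      have "(\<Sum>n\<in>S. a n) = (\<Sum>k\<in>{A * m\<^sup>2..<2 * A * m\<^sup>2}. a (2 * k))"
        unfolding S_def by (subst sum.reindex) (auto simp: inj_on_def)
      moreover have "(\<Sum>k\<in>{A * m\<^sup>2..<2 * A * m\<^sup>2}. \<kappa> * (2 * A * m\<^sup>2) powr (-3/2)) \<le> \<dots>"
      proof (rule sum_mono)
        fix k assume k: "k \<in> {A * m\<^sup>2..<2 * A * m\<^sup>2}"
        then have k1: "1 \<le> k" using Am by simp
        have "real k \<le> real (2 * A * m\<^sup>2)" using k by (simp only: of_nat_le_iff) simp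
        then have "real (2 * A * m\<^sup>2) powr (-3/2) \<le> real k powr (-3/2)"
          using k1 by (intro powr_mono2') auto
        then have "\<kappa> * real (2 * A * m\<^sup>2) powr (-3/2) \<le> \<kappa> * real k powr (-3/2)"
          using coeff(1) by (intro mult_left_mono) auto
        then show "\<kappa> * real (2 * A * m\<^sup>2) powr (-3/2) \<le> a (2 * k)" using coeff(2)[OF k1] by simp
      qed
      moreover have "(\<Sum>k\<in>{A * m\<^sup>2..<2 * A * m\<^sup>2}. \<kappa> * (2 * A * m\<^sup>2) powr (-3/2)) = A * (\<kappa> * (2 * A) powr (-3/2)) / m"
      proof -
        have "real (2 * A * m\<^sup>2) powr (-3/2) = (2 * A) powr (-3/2) * (real m powr 2) powr (-3/2)"
          using m by (simp add: powr_mult)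
        also have "(real m powr 2) powr (-3/2) = 1 / real m ^ 3"
          unfolding powr_powr using powr_minus_divide[of "real m" 3] by simp
        finally have "real (2 * A * m\<^sup>2) powr (-3/2) = (2 * A) powr (-3/2) * (1 / real m ^ 3)" .
        then have "(\<Sum>k\<in>{A * m\<^sup>2..<2 * A * m\<^sup>2}. \<kappa> * (2 * A * m\<^sup>2) powr (-3/2))
            = (A * m\<^sup>2) * (\<kappa> * ((2 * A) powr (-3/2) * (1 / real m ^ 3)))" by simp
        also have "\<dots> = A * (\<kappa> * (2 * A) powr (-3/2)) * (real m ^ 2 / real m ^ 3)" by simp
        also have "real m ^ 2 / real m ^ 3 = 1 / m" using m by (simp add: power2_eq_square power3_eq_cube)
        finally show ?thesis by simp
      qed
      ultimately show ?thesis by simp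
    qed
    have pos: "0 < A * (\<kappa> * (2 * A) powr (-3/2)) / m" using A1 m coeff(1) by simp
    have mem: "v0 / 4 * (\<Sum>n\<in>S. a n) \<in> eigenvalue_bounds (zonal_kernel h) M i"
    proof (rule eigenvalue_bounds_by_blocks[where B = B and J = J and \<theta> = "\<lambda>j l. \<Prod>i\<in>UNIV. \<theta> ^ nat_dist (j i) (l i)"])
      show "0 < v0" using c0 \<epsilon>0 s0 by (simp add: v0_def)
      show "0 < (\<Sum>n\<in>S. a n)" using sumA pos by linarith
      show "i \<le> card J" using i J by simp
      show "B j \<in> sets M" for j using sets unfolding B_def by auto
      show "v0 \<le> measure M (B j)" if "j \<in> J" for j
        using mass[of "\<chi> i. c $ i + s * j i" "\<chi> i. c $ i + s * (j i + \<epsilon>)"] B_sub[OF that] B_content[of j]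
        by (simp add: v0_def B_def)
      show "B j \<inter> B l = {}" if jl: "j \<in> J" "l \<in> J" "j \<noteq> l" for j l
      proof (rule ccontr)
        assume "B j \<inter> B l \<noteq> {}"
        then obtain x where x: "x \<in> B j" "x \<in> B l" by blast
        obtain i where "j i \<noteq> l i" using jl(3) by auto
        then have "0 < s / 2 * nat_dist (j i) (l i)" using s0 by (auto simp: nat_dist_def)
        then show False using B_diff[OF x, of i] by simp
      qed
      show "even n" if "n \<in> S" for n using that by (auto simp: S_def)
      show "1 / 2 \<le> (direction x \<bullet> direction y) ^ n" if n: "n \<in> S" and xy: "x \<in> B j" "y \<in> B j" for n j x y
      proof -
        obtain k where k: "n = 2 * k" "A * m\<^sup>2 \<le> k" "k < 2 * A * m\<^sup>2" using n by (auto simp: S_def)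
        define P where "P = (norm (x - y))\<^sup>2"
        have "P \<le> (\<Sum>i\<in>(UNIV::'d set). (s * \<epsilon>)\<^sup>2)"
          unfolding P_def norm_square_cart
        proof (rule sum_mono)
          fix i :: 'd
          have "c $ i + s * j i \<le> x $ i" "x $ i \<le> c $ i + s * j i + s * \<epsilon>"
            "c $ i + s * j i \<le> y $ i" "y $ i \<le> c $ i + s * j i + s * \<epsilon>"
            using xy by (auto simp: B_def mem_box_cart algebra_simps)
          then have "\<bar>(x - y) $ i\<bar> \<le> \<bar>s * \<epsilon>\<bar>" by simp
          then show "((x - y) $ i)\<^sup>2 \<le> (s * \<epsilon>)\<^sup>2" by (simp only: abs_le_square_iff)
        qed
        also have "\<dots> = ?d * (s\<^sup>2 * \<epsilon>\<^sup>2)" by (simp add: power_mult_distrib)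
        finally have P: "P \<le> ?d * (s\<^sup>2 * \<epsilon>\<^sup>2)" .
        have "real k * P \<le> (2 * A * m\<^sup>2) * (?d * (s\<^sup>2 * \<epsilon>\<^sup>2))"
        proof (rule mult_mono[OF _ P])
          show "real k \<le> real (2 * A * m\<^sup>2)" using k(3) by (simp only: of_nat_le_iff)
        qed (auto simp: P_def)
        also have "\<dots> = \<rho>\<^sup>2 / 2"
          unfolding \<epsilon>2 s_def using A1 m by (simp add: power_divide)
        also have "\<dots> \<le> 1 / 2" using \<rho> by (simp add: power_le_one)
        finally have kP: "real k * P \<le> 1 / 2" .
        have k1: "1 \<le> real k"
        proof -
          have "1 \<le> A * m\<^sup>2" using A1 m by (simp add: Suc_le_eq)
          then show ?thesis using k(2) by linarith
        qed
        have P0: "0 \<le> P" by (simp add: P_def)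
        then have P1: "P \<le> 1" using mult_right_mono[OF k1 P0] kP by linarith
        \<comment> \<open>Bernoulli's inequality; \<open>kP\<close> makes the left side at least
          1/2.\<close>
        have "1 - real k * P \<le> (1 - P) ^ k"
          using Bernoulli_inequality[of "- P" k] P1 by simp
        also have "\<dots> \<le> ((direction x \<bullet> direction y)\<^sup>2) ^ k"
          using P1 inner_direction_square_bounds(2)[of x y] by (intro power_mono) (auto simp: P_def)
        also have "\<dots> = (direction x \<bullet> direction y) ^ n" by (simp add: k(1) power_mult)
        finally show ?thesis using kP by linarith
      qed
      show "(direction x \<bullet> direction y) ^ n \<le> (\<Prod>i\<in>UNIV. \<theta> ^ nat_dist (j i) (l i))"
        if n: "n \<in> S" and jl: "j \<in> J" "l \<in> J" and xy: "x \<in> B j" "y \<in> B l" for n j l x y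
      proof -
        obtain k where k: "n = 2 * k" "A * m\<^sup>2 \<le> k" using n by (auto simp: S_def)
        define P where "P = (norm (x - y))\<^sup>2"
        define N where "N = (\<Sum>i\<in>UNIV. nat_dist (j i) (l i))"
        have P: "(s / 2)\<^sup>2 * N \<le> P"
        proof -
          have "(s / 2)\<^sup>2 * N = (\<Sum>i\<in>UNIV. (s / 2)\<^sup>2 * nat_dist (j i) (l i))"
            by (simp add: N_def sum_distrib_left)
          also have "\<dots> \<le> (\<Sum>i\<in>UNIV. ((x - y) $ i)\<^sup>2)"
          proof (rule sum_mono)
            fix i
            \<comment> \<open>Passing from squares to first powers of the integer distances makes
              the exponent additive over coordinates, so that the bound becomes a product over
              them.\<close>
            have "real (nat_dist (j i) (l i)) \<le> (real (nat_dist (j i) (l i)))\<^sup>2"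
              by (simp add: power2_eq_square flip: of_nat_mult)
            then have "(s / 2)\<^sup>2 * nat_dist (j i) (l i) \<le> (s / 2)\<^sup>2 * (real (nat_dist (j i) (l i)))\<^sup>2"
              by (rule mult_left_mono) simp
            also have "\<dots> = (s / 2 * nat_dist (j i) (l i))\<^sup>2" by (simp add: power_mult_distrib power_divide)
            also have "\<dots> \<le> \<bar>x $ i - y $ i\<bar>\<^sup>2" using B_diff[OF xy, of i] s0 by (intro power_mono) auto
            finally show "(s / 2)\<^sup>2 * nat_dist (j i) (l i) \<le> ((x - y) $ i)\<^sup>2" by simp
          qed
          finally show ?thesis by (simp add: P_def norm_square_cart)
        qed
        have W: "(lift_norm x)\<^sup>2 * (lift_norm y)\<^sup>2 \<le> D"
          unfolding D_def using w0 B_sub[OF jl(1)] B_sub[OF jl(2)] xy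
          by (intro mult_mono power_mono) auto
        have PW: "P / D \<le> P / ((lift_norm x)\<^sup>2 * (lift_norm y)\<^sup>2)"
          using W D1 by (intro divide_left_mono mult_pos_pos) (auto simp: P_def)
        have u2: "(direction x \<bullet> direction y)\<^sup>2 \<le> 1 - P / D"
          using inner_direction_square_bounds(1)[of x y] PW by (simp add: P_def)
        have PD1: "P / D \<le> 1" using u2 zero_le_power2[of "direction x \<bullet> direction y"] by linarith
        have "(direction x \<bullet> direction y) ^ n = ((direction x \<bullet> direction y)\<^sup>2) ^ k"
          by (simp add: k(1) power_mult)
        also have "\<dots> \<le> (1 - P / D) ^ k" by (rule power_mono[OF u2]) simp
        also have "\<dots> \<le> exp (- (real k * (P / D)))" by (rule one_minus_power_le_exp[OF PD1])
        also have "\<dots> \<le> exp (- (N * (A * \<rho>\<^sup>2 / (4 * D))))"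
        proof -
          have "N * (A * \<rho>\<^sup>2 / (4 * D)) = real (A * m\<^sup>2) * ((s / 2)\<^sup>2 * N / D)"
            using m by (simp add: s_def power_divide)
          also have "\<dots> \<le> real k * (P / D)"
          proof (rule mult_mono)
            show "real (A * m\<^sup>2) \<le> real k" using k(2) by (simp only: of_nat_le_iff)
            show "(s / 2)\<^sup>2 * N / D \<le> P / D" using P D1 by (intro divide_right_mono) auto
          qed (use D1 in auto)
          finally show ?thesis by simp
        qed
        also have "\<dots> = \<theta> ^ N" unfolding \<theta>_def exp_of_nat_mult[symmetric] by simp
        also have "\<dots> = (\<Prod>i\<in>UNIV. \<theta> ^ nat_dist (j i) (l i))" by (simp add: N_def power_sum)
        finally show ?thesis .
      qed
      show "(\<Sum>l\<in>J - {j}. \<Prod>i\<in>UNIV. \<theta> ^ nat_dist (j i) (l i)) \<le> 1 / 4" if j: "j \<in> J" for j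
      proof -
        \<comment> \<open>Distributivity turns the sum over the grid into a product of
          one-dimensional sums. The diagonal entry is included for this purpose and removed again
          below.\<close>
        have "(\<Sum>l\<in>J. \<Prod>i\<in>UNIV. \<theta> ^ nat_dist (j i) (l i)) = (\<Prod>i\<in>UNIV. \<Sum>b<m. \<theta> ^ nat_dist (j i) b)"
          unfolding J_def by (rule prod_sum_PiE[symmetric]) auto
        also have "\<dots> \<le> (\<Prod>i\<in>(UNIV :: 'd set). 2 / (1 - \<theta>) - 1)"
          using \<theta> \<theta>0 jm[OF j] by (intro prod_mono conjI sum_power_nat_dist_le sum_nonneg) auto
        also have "\<dots> = (2 / (1 - \<theta>) - 1) ^ ?d" by simp
        also have "\<dots> \<le> 5 / 4" by (rule \<theta>0(3)[OF \<theta>])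
        finally have "(\<Sum>l\<in>J. \<Prod>i\<in>UNIV. \<theta> ^ nat_dist (j i) (l i)) \<le> 5 / 4" .
        moreover have "(\<Sum>l\<in>J. \<Prod>i\<in>UNIV. \<theta> ^ nat_dist (j i) (l i))
            = 1 + (\<Sum>l\<in>J - {j}. \<Prod>i\<in>UNIV. \<theta> ^ nat_dist (j i) (l i))"
          using J(1) j by (simp add: sum.remove[of J j] nat_dist_def)
        ultimately show ?thesis by simp
      qed
    qed (use J S_fin in auto)
    have "C / real m ^ (?d + 1) = v0 / 4 * (A * (\<kappa> * (2 * A) powr (-3/2)) / m)"
      by (simp add: C_def v0_def s_def power_mult_distrib power_divide)
    also have "\<dots> \<le> v0 / 4 * (\<Sum>n\<in>S. a n)"
      using sumA c0 \<epsilon>0 s0 by (intro mult_left_mono) (auto simp: v0_def)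
    finally have le: "C / real m ^ (?d + 1) \<le> v0 / 4 * (\<Sum>n\<in>S. a n)" .
    show ?thesis
    proof (rule eigenvalue_bounds_downward[OF mem _ le])
      show "0 < C / real m ^ (?d + 1)" using C0 m by simp
    qed
  qed
  then show ?thesis using C0 by blast
qed

end

section \<open>The upper bound\<close>

text \<open>The sup norm of (x, 1).\<close>

definition cube_scale :: "real^'d \<Rightarrow> real" where
  "cube_scale x = max 1 (infnorm x)"

text \<open>The point of the boundary of the unit cube on the ray through \<open>(x, 1)\<close>; the index
  \<open>None\<close> stands for the additional coordinate.\<close>
definition cube_coord :: "real^'d \<Rightarrow> 'd option \<Rightarrow> real" where
  "cube_coord x c = (case c of None \<Rightarrow> 1 | Some i \<Rightarrow> x $ i) / cube_scale x"

definition direction_cell :: "nat \<Rightarrow> real^'d \<Rightarrow> 'd option \<Rightarrow> int" where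
  "direction_cell q x c = \<lfloor>real q * cube_coord x c\<rfloor>"

lemma cube_scale_ge_one: "1 \<le> cube_scale x"
  by (simp add: cube_scale_def)

lemma cube_scale_pos [simp]: "0 < cube_scale x"
  by (rule less_le_trans[OF zero_less_one cube_scale_ge_one])

lemma cube_scale_nonzero [simp]: "cube_scale x \<noteq> 0"
  by (rule less_imp_neq[OF cube_scale_pos, symmetric])

lemma cube_coord_abs_le: "\<bar>cube_coord x c\<bar> \<le> 1"
proof -
  have "\<bar>case c of None \<Rightarrow> 1 | Some i \<Rightarrow> x $ i\<bar> \<le> cube_scale x"
    using component_le_infnorm_cart[of x] by (auto simp: cube_scale_def le_max_iff_disj split: option.split)
  then show ?thesis
    using cube_scale_pos[of x] by (simp add: cube_coord_def divide_le_eq_1)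
qed

lemma cube_coord_attained: "\<exists>c. \<bar>cube_coord x c\<bar> = 1"
proof (cases "infnorm x \<le> 1")
  case True
  then show ?thesis by (intro exI[of _ None]) (simp add: cube_coord_def cube_scale_def max_absorb1)
next
  case False
  have "infnorm x \<in> (\<lambda>i. \<bar>x \<bullet> i\<bar>) ` Basis"
    unfolding infnorm_Max by (rule Max_in) auto
  then obtain b where b: "b \<in> Basis" "infnorm x = \<bar>x \<bullet> b\<bar>" by auto
  then obtain i where "b = axis i 1" by (auto simp: Basis_vec_def)
  then have "infnorm x = \<bar>x $ i\<bar>" using b(2) by (simp add: inner_axis)
  then show ?thesis
    using False by (intro exI[of _ "Some i"]) (simp add: cube_coord_def cube_scale_def max_def)
qed

text \<open>A boundary point of the cube has a coordinate 1 or -1, whose label is exactly q or -q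
  since floor leaves integers unchanged. Fixing that coordinate reduces the count from order q^(d+1)
  to order q^d, on which the exponent of the theorem depends.\<close>

definition boundary_cells :: "nat \<Rightarrow> ('d::finite option \<Rightarrow> int) set" where
  "boundary_cells q = (\<Union>c. \<Union>s\<in>{int q, - int q}. (UNIV \<rightarrow>\<^sub>E {- int q..int q}) \<inter> {g. g c = s})"

lemma direction_cell_in_boundary_cells: "direction_cell q x \<in> boundary_cells q"
proof -
  obtain c where c: "\<bar>cube_coord x c\<bar> = 1" using cube_coord_attained by blast
  have "direction_cell q x c \<in> {int q, - int q}"
  proof (cases "0 \<le> cube_coord x c")
    case True
    then have "cube_coord x c = 1" using c by simp
    then show ?thesis by (simp add: direction_cell_def)
  next
    case False
    then have "cube_coord x c = - 1" using c by simp
    then have "direction_cell q x c = \<lfloor>real_of_int (- int q)\<rfloor>" by (simp add: direction_cell_def)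
    then show ?thesis by (simp only: floor_of_int) simp
  qed
  moreover have "direction_cell q x c' \<in> {- int q..int q}" for c'
  proof -
    have "real q * cube_coord x c' \<le> real q * 1" "real q * (- 1) \<le> real q * cube_coord x c'"
      using cube_coord_abs_le[of x c'] by (intro mult_left_mono; simp add: abs_le_iff)+
    then show ?thesis by (simp add: direction_cell_def floor_le_iff le_floor_iff)
  qed
  ultimately show ?thesis unfolding boundary_cells_def by blast
qed

lemma finite_boundary_cells: "finite (boundary_cells q :: ('d::finite option \<Rightarrow> int) set)"
  unfolding boundary_cells_def by (auto intro!: finite_PiE)

lemma card_boundary_cells:
  "card (boundary_cells q :: ('d::finite option \<Rightarrow> int) set) \<le> 2 * (CARD('d) + 1) * (2 * q + 1) ^ CARD('d)"
proof -
  let ?I = "{- int q..int q}"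
  have cI: "card ?I = 2 * q + 1" by (simp add: nat_add_distrib nat_mult_distrib)
  have one: "card ((UNIV \<rightarrow>\<^sub>E ?I) \<inter> {g. g c = s}) \<le> (2 * q + 1) ^ CARD('d)" for c :: "'d option" and s
  proof -
    have "card ((UNIV \<rightarrow>\<^sub>E ?I) \<inter> {g. g c = s}) \<le> card (PiE UNIV (\<lambda>c'. if c' = c then {s} else ?I))"
      by (rule card_mono) (auto intro!: finite_PiE simp: PiE_iff)
    also have "\<dots> = (\<Prod>c'\<in>UNIV. card (if c' = c then {s} else ?I))" by (rule card_PiE) simp
    also have "\<dots> = (\<Prod>c'\<in>UNIV - {c}. 2 * q + 1)"
    proof -
      have "(\<Prod>c'\<in>UNIV - {c}. card (if c' = c then {s} else ?I)) = (\<Prod>c'\<in>UNIV - {c}. 2 * q + 1)"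
        by (intro prod.cong refl) (use cI in auto)
      then show ?thesis by (subst prod.remove[of _ c]) simp_all
    qed
    also have "\<dots> = (2 * q + 1) ^ CARD('d)" by (simp add: card_Diff_singleton)
    finally show ?thesis .
  qed
  have "card (boundary_cells q :: ('d option \<Rightarrow> int) set)
      \<le> (\<Sum>c\<in>(UNIV :: 'd option set). card (\<Union>s\<in>{int q, - int q}. (UNIV \<rightarrow>\<^sub>E ?I) \<inter> {g. g c = s}))"
    unfolding boundary_cells_def by (rule card_UN_le) simp
  also have "\<dots> \<le> (\<Sum>c\<in>(UNIV :: 'd option set). 2 * (2 * q + 1) ^ CARD('d))"
  proof (rule sum_mono)
    fix c :: "'d option"
    have "card (\<Union>s\<in>{int q, - int q}. (UNIV \<rightarrow>\<^sub>E ?I) \<inter> {g. g c = s})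
        \<le> (\<Sum>s\<in>{int q, - int q}. card ((UNIV \<rightarrow>\<^sub>E ?I) \<inter> {g. g c = s}))"
      by (rule card_UN_le) simp
    also have "\<dots> \<le> of_nat (card {int q, - int q}) * (2 * q + 1) ^ CARD('d)"
      by (rule sum_bounded_above) (rule one)
    also have "\<dots> \<le> 2 * (2 * q + 1) ^ CARD('d)"
      by (intro mult_right_mono) (auto simp: card_insert_if)
    finally show "card (\<Union>s\<in>{int q, - int q}. (UNIV \<rightarrow>\<^sub>E ?I) \<inter> {g. g c = s}) \<le> 2 * (2 * q + 1) ^ CARD('d)" .
  qed
  finally show ?thesis by (simp add: card_UNIV_option algebra_simps)
qed

text \<open>Radial projection to the sphere expands distances at most by 2 from a point outside the
  open unit ball: one part for moving the vector, one for changing the divisor, and both are divided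
  by \<open>norm u\<close>.\<close>

lemma normalized_diff_le:
  fixes u v :: "'a::real_normed_vector"
  assumes "1 \<le> norm u" "v \<noteq> 0"
  shows "norm ((1 / norm u) *\<^sub>R u - (1 / norm v) *\<^sub>R v) \<le> 2 * norm (u - v)"
proof -
  have u0: "norm u > 0" and v0: "norm v > 0" using assms by (linarith, simp)
  have "(1 / norm u) *\<^sub>R u - (1 / norm v) *\<^sub>R v = (1 / norm u) *\<^sub>R (u - v) + (1 / norm u - 1 / norm v) *\<^sub>R v"
    by (simp add: algebra_simps)
  then have "norm ((1 / norm u) *\<^sub>R u - (1 / norm v) *\<^sub>R v)
      \<le> norm ((1 / norm u) *\<^sub>R (u - v)) + norm ((1 / norm u - 1 / norm v) *\<^sub>R v)"
    by (simp only: norm_triangle_ineq)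
  also have "norm ((1 / norm u - 1 / norm v) *\<^sub>R v) = \<bar>norm v - norm u\<bar> / norm u"
  proof -
    have "(1 / norm u - 1 / norm v) * norm v = (norm v - norm u) / norm u"
      using u0 v0 by (simp add: divide_simps)
    then have "\<bar>1 / norm u - 1 / norm v\<bar> * norm v = \<bar>norm v - norm u\<bar> / norm u"
      using u0 v0 by (metis abs_divide abs_mult abs_norm_cancel)
    then show ?thesis by simp
  qed
  also have "norm ((1 / norm u) *\<^sub>R (u - v)) = norm (u - v) / norm u" by simp
  also have "norm (u - v) / norm u + \<bar>norm v - norm u\<bar> / norm u \<le> norm (u - v) / 1 + norm (u - v) / 1"
    using assms(1) norm_triangle_ineq3[of v u] by (intro add_mono frac_le) (auto simp: norm_minus_commute)
  finally show ?thesis by simp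
qed

text \<open>On the boundary of the cube two points with the same label differ by at most 1/q in each
  of d + 1 coordinates. Such points have norm at least 1, so projecting them to the sphere costs a
  factor 2 in distance, and for unit vectors the squared distance is 2(1 - u).\<close>

lemma direction_cell_close:
  fixes x y :: "real^'d"
  assumes q: "1 \<le> q" and eq: "direction_cell q x = direction_cell q y"
  shows "1 - direction x \<bullet> direction y \<le> 2 * (CARD('d) + 1) / (real q)\<^sup>2"
proof -
  define u where "u z = (1 / cube_scale z) *\<^sub>R (z, 1::real)" for z :: "real^'d"
  have norm_u: "norm (u z) = lift_norm z / cube_scale z" for z
    using less_imp_le[OF cube_scale_pos[of z]]
    by (simp only: u_def norm_scaleR lift_norm_def[symmetric]) (simp add: abs_divide)
  have u_dir: "(1 / norm (u z)) *\<^sub>R u z = direction z" for z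
    unfolding norm_u using cube_scale_pos[of z] by (simp add: u_def direction_def)
  have u0: "u z \<noteq> 0" for z by (simp add: u_def zero_prod_def)
  have "1 \<le> norm (u x)"
  proof -
    have "cube_scale x \<le> lift_norm x"
    proof -
      have "infnorm x \<le> norm x" by (rule infnorm_le_norm)
      also have "\<dots> \<le> lift_norm x" unfolding lift_norm_def by (rule norm_fst_le)
      finally show ?thesis using lift_norm_ge_one[of x] by (simp add: cube_scale_def)
    qed
    then show ?thesis unfolding norm_u by simp
  qed
  then have "norm (direction x - direction y) \<le> 2 * norm (u x - u y)"
    using normalized_diff_le[OF _ u0, of "u x" y] unfolding u_dir by blast
  then have "(norm (direction x - direction y))\<^sup>2 \<le> (2 * norm (u x - u y))\<^sup>2" by (intro power_mono) auto
  moreover have "(norm (direction x - direction y))\<^sup>2 = 2 * (1 - direction x \<bullet> direction y)"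
    by (simp add: power2_norm_eq_inner inner_diff_left inner_diff_right inner_commute)
  moreover have "(norm (u x - u y))\<^sup>2 \<le> (CARD('d) + 1) / (real q)\<^sup>2"
  proof -
    have coord: "(cube_coord x c - cube_coord y c)\<^sup>2 \<le> 1 / (real q)\<^sup>2" for c
    proof -
      have "\<lfloor>real q * cube_coord x c\<rfloor> = \<lfloor>real q * cube_coord y c\<rfloor>"
        using fun_cong[OF eq, of c] by (simp add: direction_cell_def)
      then have "\<bar>real q * cube_coord x c - real q * cube_coord y c\<bar> \<le> 1" by linarith
      then have "\<bar>real q * (cube_coord x c - cube_coord y c)\<bar>\<^sup>2 \<le> 1"
        by (intro power_le_one) (auto simp: right_diff_distrib)
      then have "(real q)\<^sup>2 * (cube_coord x c - cube_coord y c)\<^sup>2 \<le> 1" by (simp add: power_mult_distrib)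
      then show ?thesis using q by (simp add: pos_le_divide_eq mult.commute)
    qed
    have "(norm (u x - u y))\<^sup>2
        = (\<Sum>i\<in>UNIV. (cube_coord x (Some i) - cube_coord y (Some i))\<^sup>2) + (cube_coord x None - cube_coord y None)\<^sup>2"
      by (simp add: u_def norm_Pair norm_vec_def L2_set_def sum_nonneg cube_coord_def)
    also have "\<dots> \<le> (\<Sum>i\<in>(UNIV :: 'd set). 1 / (real q)\<^sup>2) + 1 / (real q)\<^sup>2"
      by (intro add_mono sum_mono coord)
    finally show ?thesis by (simp add: add_divide_distrib)
  qed
  moreover have "(2 * norm (u x - u y))\<^sup>2 = 4 * (norm (u x - u y))\<^sup>2" by (simp add: power_mult_distrib)
  moreover have "A \<le> 2 * Q" if "X \<le> Y" "X = 2 * A" "Z \<le> Q" "Y = 4 * Z" for A Q X Y Z :: real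
    using that by linarith
  ultimately have "1 - direction x \<bullet> direction y \<le> 2 * ((CARD('d) + 1) / (real q)\<^sup>2)" by blast
  then show ?thesis by simp
qed

lemma direction_cell_measurable:
  "{x :: real^'d. direction_cell q x = g} \<in> sets borel"
proof -
  have [measurable]: "(\<lambda>x :: real^'d. cube_coord x c) \<in> borel_measurable borel" for c
  proof (intro borel_measurable_continuous_onI)
    have "continuous_on UNIV (cube_scale :: real^'d \<Rightarrow> real)"
      unfolding cube_scale_def by (intro continuous_on_max continuous_on_const continuous_at_imp_continuous_on ballI
          continuous_infnorm continuous_ident)
    then show "continuous_on UNIV (\<lambda>x :: real^'d. cube_coord x c)"
      unfolding cube_coord_def
      by (cases c) (auto intro!: continuous_on_divide continuous_intros simp: less_imp_neq[symmetric])
  qed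
  have "{x :: real^'d. direction_cell q x = g} = (\<Inter>c. {x. \<lfloor>real q * cube_coord x c\<rfloor> = g c})"
    by (auto simp: direction_cell_def fun_eq_iff)
  also have "\<dots> \<in> sets borel"
    by (intro sets.finite_INT) (auto intro!: borel_measurable_times)
  finally show ?thesis .
qed

context zonal_prob_cart
begin

text \<open>The scale q is chosen so that the cells consume at most about a quarter of the i
  dimensions. The remaining N >= i/2 test functions give t <= const / (i q) with q of order i^(1/d).
  Indices too small for this are covered by the trivial bound \<open>R\<close>.\<close>

lemma eigenvalue_upper_rate:
  assumes id: "\<And>X :: (real^'d) set. X \<in> sets borel \<Longrightarrow> X \<in> sets M"
    and H: "0 \<le> H" "\<And>u. \<bar>u\<bar> \<le> 1 \<Longrightarrow> h 1 - h u \<le> H * sqrt (1 - u)"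
  shows "\<exists>B>0. \<forall>i\<ge>1. \<forall>t\<in>eigenvalue_bounds (zonal_kernel h) M i.
    t \<le> B * real i powr (- (real CARD('d) + 1) / real CARD('d))"
proof -
  let ?d = "CARD('d)"
  let ?e = "(real ?d + 1) / real ?d"
  define W where "W = (\<integral>x. (lift_norm x)\<^sup>2 \<partial>M)"
  have W0: "0 \<le> W" by (simp add: W_def)
  \<comment> \<open>From \<open>card_boundary_cells\<close>, with 2q + 1 <= 3q.\<close>
  define K :: real where "K = 2 * (?d + 1) * 3 ^ ?d"
  have K1: "1 \<le> K"
  proof -
    have "1 * 1 \<le> (2 * (real ?d + 1)) * 3 ^ ?d" by (intro mult_mono) auto
    then show ?thesis by (simp add: K_def algebra_simps)
  qed
  \<comment> \<open>Inserting \<open>direction_cell_close\<close> into the square root makes F/q the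
    gap of the profile over a cell.\<close>
  define F where "F = H * sqrt (2 * (?d + 1))"
  have F0: "0 \<le> F" using H(1) by (simp add: F_def)
  have cells: "real N * t \<le> 2 * (F / q) * W"
    if q: "1 \<le> q" and t: "t \<in> eigenvalue_bounds (zonal_kernel h) M i"
      and N: "real N + K * real q ^ ?d + 1 \<le> real i" for N q :: nat and t i
  proof -
    let ?Z = "boundary_cells q :: ('d option \<Rightarrow> int) set"
    \<comment> \<open>Any choice of a point with a given label will do; labels outside the range are
      never consulted.\<close>
    define rep where "rep = inv (direction_cell q :: real^'d \<Rightarrow> _)"
    have rep: "direction_cell q (rep (direction_cell q x)) = direction_cell q x" for x :: "real^'d"
      unfolding rep_def by (rule f_inv_into_f) simp
    have "N * t \<le> 2 * (F / q) * (\<integral>x. (lift_norm x)\<^sup>2 \<partial>M)"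
    proof (rule eigenvalue_bound_by_cells[OF t finite_boundary_cells direction_cell_in_boundary_cells])
      show "{x. direction_cell q x = z} \<in> sets M" for z by (rule id[OF direction_cell_measurable])
      show "h 1 - h (direction x \<bullet> direction (rep (direction_cell q x))) \<le> F / q" for x
      proof -
        let ?y = "rep (direction_cell q x)"
        have "h 1 - h (direction x \<bullet> direction ?y) \<le> H * sqrt (1 - direction x \<bullet> direction ?y)"
          by (rule H(2)[OF abs_inner_direction_le])
        also have "\<dots> \<le> H * sqrt (2 * (?d + 1) / (real q)\<^sup>2)"
          using direction_cell_close[OF q rep[symmetric], of x] by (intro mult_left_mono H(1)) simp
        also have "\<dots> = F / q" using q by (simp add: F_def real_sqrt_divide)
        finally show ?thesis .
      qed
      have "real (card ?Z) \<le> K * real q ^ ?d"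
      proof -
        have "real (card ?Z) \<le> real (2 * (?d + 1) * (2 * q + 1) ^ ?d)"
          by (simp only: of_nat_le_iff card_boundary_cells)
        also have "\<dots> \<le> real (2 * (?d + 1) * (3 * q) ^ ?d)"
          unfolding of_nat_le_iff using q by (intro mult_left_mono power_mono) auto
        also have "\<dots> = K * real q ^ ?d" by (simp add: K_def power_mult_distrib algebra_simps)
        finally show ?thesis .
      qed
      then have "real (N + card ?Z + 1) \<le> real i" using N by simp
      then show "N + card ?Z + 1 \<le> i" by (simp only: of_nat_le_iff)
    qed
    then show ?thesis by (simp add: W_def)
  qed
  \<comment> \<open>\<open>B1\<close> serves i < 4K, \<open>B2\<close> all other indices; the 1
    added to their sum guarantees a positive constant.\<close>
  define B1 where "B1 = R * (4 * K) powr ?e"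
  define B2 where "B2 = 8 * F * W * (4 * K) powr (1 / ?d)"
  have B: "0 \<le> B1" "0 \<le> B2" using F0 W0 by (auto simp: B1_def B2_def)
  have "t \<le> (B1 + B2 + 1) * real i powr (- ?e)"
    if i: "i \<ge> 1" and t: "t \<in> eigenvalue_bounds (zonal_kernel h) M i" for i t
  proof (cases "real i < 4 * K")
    case True
    have "t \<le> R" by (rule eigenvalue_bound_trivial[OF t i])
    also have "\<dots> = R * 1" by simp
    also have "\<dots> \<le> R * ((4 * K) powr ?e * real i powr (- ?e))"
    proof (rule mult_left_mono)
      have "real i powr ?e \<le> (4 * K) powr ?e" using True i by (intro powr_mono2) auto
      then have "real i powr ?e * real i powr (- ?e) \<le> (4 * K) powr ?e * real i powr (- ?e)"
        by (rule mult_right_mono) simp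
      then show "1 \<le> (4 * K) powr ?e * real i powr (- ?e)"
        using i by (simp add: powr_add[symmetric])
    qed simp
    also have "\<dots> = B1 * real i powr (- ?e)" by (simp only: B1_def mult.assoc)
    also have "\<dots> \<le> (B1 + B2 + 1) * real i powr (- ?e)" using B by (intro mult_right_mono) auto
    finally show ?thesis .
  next
    case False
    define y where "y = (real i / (4 * K)) powr (1 / ?d)"
    have ratio: "1 \<le> real i / (4 * K)" using False K1 by (simp add: le_divide_eq)
    then have y1: "1 \<le> y" unfolding y_def by (intro ge_one_powr_ge_zero) auto
    have yd: "y ^ ?d = real i / (4 * K)"
    proof -
      have "y ^ ?d = y powr ?d" using y1 by (simp add: powr_realpow)
      also have "\<dots> = (real i / (4 * K)) powr 1" unfolding y_def powr_powr by simp
      finally show ?thesis using ratio K1 by simp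
    qed
    \<comment> \<open>Since y >= 1, rounding down loses at most a factor 2, which is absorbed in
      \<open>B2\<close>.\<close>
    define q where "q = nat \<lfloor>y\<rfloor>"
    have q1: "1 \<le> q" using y1 by (simp add: q_def le_nat_iff le_floor_iff)
    have qy: "real q \<le> y" "y / 2 \<le> real q"
    proof -
      have "real q \<le> y \<and> y < real q + 1" using y1 unfolding q_def by linarith
      moreover have "1 \<le> real q" using q1 by simp
      ultimately show "real q \<le> y" "y / 2 \<le> real q" by linarith+
    qed
    have "real q ^ ?d \<le> y ^ ?d" using qy by (intro power_mono) auto
    then have "K * real q ^ ?d \<le> K * (real i / (4 * K))" unfolding yd using K1 by (intro mult_left_mono) auto
    then have Kq: "K * real q ^ ?d \<le> real i / 4" using K1 by simp
    define N where "N = nat \<lfloor>real i - K * real q ^ ?d - 1\<rfloor>"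
    have "4 \<le> real i" using False K1 by linarith
    \<comment> \<open>This leaves room for the 1 of the constant function and for the floor: i - i/4
      - 2 is at least i/2.\<close>
    have "8 \<le> real i"
    proof -
      have "2 \<le> K"
      proof -
        have "2 * 1 \<le> (2 * (real ?d + 1)) * 3 ^ ?d" by (intro mult_mono) auto
        then show ?thesis by (simp add: K_def algebra_simps)
      qed
      then show ?thesis using False by linarith
    qed
    have N_le: "real N + K * real q ^ ?d + 1 \<le> real i" and N_ge: "real i / 2 \<le> real N"
      using Kq \<open>8 \<le> real i\<close> unfolding N_def by linarith+
    have tpos: "0 < t" using t by (simp add: eigenvalue_bounds_def)
    have "real i / 2 * t \<le> real N * t" using N_ge tpos by (intro mult_right_mono) auto
    also have "\<dots> \<le> 2 * (F / q) * W" by (rule cells[OF q1 t N_le])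
    also have "\<dots> \<le> 2 * (F / (y / 2)) * W"
      using qy y1 q1 F0 W0 by (intro mult_right_mono mult_left_mono divide_left_mono) auto
    also have "\<dots> = 4 * F * W / y" by simp
    finally have "real i * t \<le> 8 * F * W / y" by simp
    then have "t * real i \<le> 8 * F * W / y" by (simp only: mult.commute)
    then have "t \<le> 8 * F * W / y / real i" using i by (subst pos_le_divide_eq) auto
    also have "\<dots> = B2 * real i powr (- ?e)"
    proof -
      have yi: "1 / y = (4 * K) powr (1 / ?d) * real i powr (- (1 / ?d))"
        unfolding y_def using K1 i by (simp add: powr_divide powr_minus_divide)
      have e: "real i powr (- ?e) = real i powr (- (1 / ?d)) * (1 / real i)"
      proof -
        have "- ?e = - (1 / ?d) + - 1" by (simp add: add_divide_distrib)
        then have "real i powr (- ?e) = real i powr (- (1 / ?d)) * real i powr (- 1)" by (simp only: powr_add)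
        then show ?thesis using i by (simp add: powr_minus_divide)
      qed
      have "8 * F * W / y / real i = 8 * F * W * (1 / y) * (1 / real i)" by simp
      also have "\<dots> = B2 * (real i powr (- (1 / ?d)) * (1 / real i))" unfolding yi B2_def by (simp only: mult.assoc)
      finally show ?thesis unfolding e .
    qed
    also have "\<dots> \<le> (B1 + B2 + 1) * real i powr (- ?e)" using B by (intro mult_right_mono) auto
    finally show ?thesis .
  qed
  moreover have "- ?e = - (real ?d + 1) / real ?d" by (rule minus_divide_left)
  moreover have "0 < B1 + B2 + 1" using B by simp
  ultimately show ?thesis by metis
qed

end

section \<open>Riemann integrable densities\<close>

text \<open>A constant mesh is a special gauge. The Riemann condition is returned with the same
  \<open>I\<close>, because moving the tags later requires a mesh that does not depend on the
  point.\<close>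

lemma riemann_integrable_imp_has_integral:
  assumes "riemann_integrable_on f (cbox a b)"
  obtains I where "(f has_integral I) (cbox a b)"
    "\<forall>e>0. \<exists>\<delta>>0. \<forall>D. D tagged_division_of (cbox a b) \<and> (\<lambda>x. ball x \<delta>) fine D \<longrightarrow>
        \<bar>(\<Sum>(x, K)\<in>D. Henstock_Kurzweil_Integration.content K * f x) - I\<bar> < e"
proof -
  obtain I where I: "\<forall>e>0. \<exists>\<delta>>0. \<forall>D. D tagged_division_of (cbox a b) \<and> (\<lambda>x. ball x \<delta>) fine D \<longrightarrow>
        \<bar>(\<Sum>(x, K)\<in>D. Henstock_Kurzweil_Integration.content K * f x) - I\<bar> < e"
    using assms unfolding riemann_integrable_on_def by (elim exE)
  have "(f has_integral I) (cbox a b)"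
    unfolding has_integral
  proof (intro allI impI)
    fix e :: real assume "e > 0"
    from I[rule_format, OF this] obtain \<delta> where \<delta>: "\<delta> > 0"
      "\<forall>D. D tagged_division_of (cbox a b) \<and> (\<lambda>x. ball x \<delta>) fine D \<longrightarrow>
        \<bar>(\<Sum>(x, K)\<in>D. Henstock_Kurzweil_Integration.content K * f x) - I\<bar> < e" by (elim exE conjE)
    show "\<exists>\<gamma>. gauge \<gamma> \<and> (\<forall>D. D tagged_division_of cbox a b \<and> \<gamma> fine D \<longrightarrow>
        norm ((\<Sum>(x, k)\<in>D. Henstock_Kurzweil_Integration.content k *\<^sub>R f x) - I) < e)"
    proof (intro exI[of _ "\<lambda>x. ball x \<delta>"] conjI allI impI)
      show "gauge (\<lambda>x. ball x \<delta>)" using \<delta>(1) by (rule gauge_ball)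
      fix D assume "D tagged_division_of cbox a b \<and> (\<lambda>x. ball x \<delta>) fine D"
      then show "norm ((\<Sum>(x, k)\<in>D. Henstock_Kurzweil_Integration.content k *\<^sub>R f x) - I) < e"
        using \<delta>(2) by (simp only: real_norm_def real_scaleR_def)
    qed
  qed
  then show ?thesis by (rule that[OF _ I])
qed

text \<open>Otherwise the tags of a fine division could be moved to points with small values.\<close>
lemma riemann_positive_integral_box:
  fixes f :: "'a::euclidean_space \<Rightarrow> real"
  assumes nonneg: "\<And>x. 0 \<le> f x" and I0: "0 < I"
    and I: "\<forall>e>0. \<exists>\<delta>>0. \<forall>D. D tagged_division_of (cbox a b) \<and> (\<lambda>x. ball x \<delta>) fine D \<longrightarrow>
        \<bar>(\<Sum>(x, K)\<in>D. Henstock_Kurzweil_Integration.content K * f x) - I\<bar> < e"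
  shows "\<exists>c0>0. \<exists>u v. box u v \<noteq> {} \<and> (\<forall>x\<in>cbox u v. c0 \<le> f x)"
proof (rule ccontr)
  assume neg: "\<not> ?thesis"
  let ?c = "Henstock_Kurzweil_Integration.content"
  \<comment> \<open>Riemann sums with tags of value below \<open>e0\<close> stay at or below I/2;
    the added 1 avoids division by zero.\<close>
  define e0 where "e0 = I / (2 * (?c (cbox a b) + 1))"
  have e0: "0 < e0" using I0 content_pos_le by (auto simp: e0_def intro!: divide_pos_pos add_nonneg_pos)
  have small: "\<exists>x\<in>cbox u v. f x < e0" if "box u v \<noteq> {}" for u v
    using neg e0 that by (meson not_le)
  have "0 < I / 2" using I0 by simp
  from I[rule_format, OF this] obtain \<delta> where \<delta>: "\<delta> > 0"
    "\<forall>D. D tagged_division_of (cbox a b) \<and> (\<lambda>x. ball x \<delta>) fine D \<longrightarrow> \<bar>(\<Sum>(x, K)\<in>D. ?c K * f x) - I\<bar> < I / 2"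
    by (elim exE conjE)
  \<comment> \<open>Half the mesh, since a box that is within \<open>\<delta> / 2\<close> of its old
    tag is within \<delta> of any of its own points.\<close>
  obtain p where p: "p tagged_division_of (cbox a b)" "(\<lambda>x. ball x (\<delta> / 2)) fine p"
    using fine_division_exists[OF gauge_ball[OF half_gt_zero[OF \<delta>(1)]]] by blast
  \<comment> \<open>The tags are forgotten, and each box will receive a new one. Boxes with empty
    interior need no small value, having content 0.\<close>
  define d where "d = snd ` p"
  have d: "d division_of (cbox a b)" unfolding d_def by (rule division_of_tagged_division[OF p(1)])
  note dd = division_ofD[OF d]
  have "\<exists>x\<in>K. ?c K * f x \<le> ?c K * e0" if K: "K \<in> d" for K
  proof -
    obtain u v where uv: "K = cbox u v" using dd(4)[OF K] by blast
    show ?thesis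
    proof (cases "box u v = {}")
      case True
      then have "?c K = 0" unfolding uv by (simp add: content_eq_0_interior)
      then show ?thesis using dd(3)[OF K] by auto
    next
      case False
      then obtain x where "x \<in> K" "f x < e0" using small uv by blast
      then show ?thesis unfolding uv by (intro bexI[of _ x] mult_left_mono) auto
    qed
  qed
  then obtain tag where tag: "\<And>K. K \<in> d \<Longrightarrow> tag K \<in> K" "\<And>K. K \<in> d \<Longrightarrow> ?c K * f (tag K) \<le> ?c K * e0"
    by metis
  define D where "D = (\<lambda>K. (tag K, K)) ` d"
  have "D tagged_division_of (cbox a b)"
  proof (rule tagged_division_ofI)
    show "finite D" using dd(1) by (simp add: D_def)
    show "x \<in> K" "K \<subseteq> cbox a b" "\<exists>a b. K = cbox a b" if "(x, K) \<in> D" for x K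
      using that dd(2,4) tag(1) by (auto simp: D_def)
    show "interior K1 \<inter> interior K2 = {}"
      if "(x1, K1) \<in> D" "(x2, K2) \<in> D" "(x1, K1) \<noteq> (x2, K2)" for x1 K1 x2 K2
      using that dd(5) by (auto simp: D_def)
    show "\<Union> {K. \<exists>x. (x, K) \<in> D} = cbox a b"
      unfolding dd(6)[symmetric] by (auto simp: D_def)
  qed
  moreover have "(\<lambda>x. ball x \<delta>) fine D"
  proof (rule fineI)
    fix x K assume "(x, K) \<in> D"
    then have K: "K \<in> d" "x = tag K" by (auto simp: D_def)
    then obtain y where "(y, K) \<in> p" by (auto simp: d_def)
    then have sub: "K \<subseteq> ball y (\<delta> / 2)" using p(2) by (auto simp: fine_def)
    then have "dist y x < \<delta> / 2" using tag(1)[OF K(1)] K(2) by auto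
    then show "K \<subseteq> ball x \<delta>"
    proof -
      have "dist x z < \<delta>" if "z \<in> K" for z
      proof -
        have "dist y z < \<delta> / 2" using sub that by auto
        then show ?thesis using dist_triangle2[of x z y] \<open>dist y x < \<delta> / 2\<close> by (simp add: dist_commute)
      qed
      then show ?thesis by auto
    qed
  qed
  ultimately have "\<bar>(\<Sum>(x, K)\<in>D. ?c K * f x) - I\<bar> < I / 2" using \<delta>(2) by simp
  moreover have "(\<Sum>(x, K)\<in>D. ?c K * f x) \<le> I / 2"
  proof -
    have "(\<Sum>(x, K)\<in>D. ?c K * f x) = (\<Sum>K\<in>d. ?c K * f (tag K))"
      unfolding D_def by (subst sum.reindex) (auto simp: inj_on_def)
    also have "\<dots> \<le> (\<Sum>K\<in>d. ?c K * e0)" by (intro sum_mono tag(2))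
    also have "\<dots> = ?c (cbox a b) * e0"
      unfolding sum_distrib_right[symmetric] additive_content_division[OF d] ..
    also have "\<dots> \<le> (?c (cbox a b) + 1) * e0" using e0 by simp
    also have "\<dots> = I / 2"
    proof -
      have "(V + 1) * (I / (2 * (V + 1))) = I / 2" if "V + 1 \<noteq> 0" for V :: real
        using that by (simp add: field_simps)
      moreover have "?c (cbox a b) + 1 \<noteq> 0"
        using add_nonneg_pos[OF content_pos_le zero_less_one] by (rule less_imp_neq[symmetric])
      ultimately show ?thesis unfolding e0_def by blast
    qed
    finally show ?thesis .
  qed
  ultimately show False by linarith
qed

lemma integrable_cube_exhaustion_measurable:
  fixes p :: "'a::euclidean_space \<Rightarrow> real"
  assumes "\<And>n::nat. p integrable_on cbox (- real n *\<^sub>R One) (real n *\<^sub>R One)"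
  shows "p \<in> borel_measurable lebesgue"
proof (rule borel_measurable_LIMSEQ_real)
  let ?S = "\<lambda>n. cbox (- real n *\<^sub>R One) (real n *\<^sub>R One) :: 'a set"
  show "(\<lambda>x. if x \<in> ?S n then p x else 0) \<in> borel_measurable lebesgue" for n
    by (rule borel_measurable_if_I[OF integrable_imp_measurable[OF assms[of n]]]) simp
  fix x :: 'a
  obtain N :: nat where N: "norm x \<le> N" using real_arch_simple by blast
  have "x \<in> ?S n" if "n \<ge> N" for n
  proof -
    have "- real n \<le> x \<bullet> b \<and> x \<bullet> b \<le> real n" if "b \<in> Basis" for b
      using Basis_le_norm[OF that, of x] N \<open>n \<ge> N\<close> by linarith
    then show ?thesis by (simp add: mem_box)
  qed
  then have "\<forall>\<^sub>F n in sequentially. p x = (if x \<in> ?S n then p x else 0)"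
    unfolding eventually_sequentially by auto
  then show "(\<lambda>n. if x \<in> ?S n then p x else 0) \<longlonglongrightarrow> p x"
    by (rule Lim_transform_eventually[OF tendsto_const])
qed

text \<open>For the least k with |x| < 2^k, minimality gives |x| >= 2^(k-1) unless k = 0; the factor
  2^(n+1) pays for this shift.\<close>

lemma powr_decay_dyadic_bound:
  fixes x :: "'a::euclidean_space"
  obtains k :: nat where "x \<in> ball 0 (2 ^ k)"
    "(1 + (norm x)\<^sup>2) powr (- (real n + 1) / 2) \<le> 2 ^ (n + 1) * (1 / 2 ^ (k * (n + 1)))"
proof -
  define k where "k = (LEAST k. norm x < 2 ^ k)"
  have "\<exists>k. norm x < 2 ^ k" using real_arch_pow[of 2 "norm x"] by simp
  then have k: "norm x < 2 ^ k" unfolding k_def by (rule LeastI_ex)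
  have "(1 + (norm x)\<^sup>2) powr (- (real n + 1) / 2) \<le> 2 ^ (n + 1) * (1 / 2 ^ (k * (n + 1)))"
  proof (cases k)
    case 0
    have "(1 + (norm x)\<^sup>2) powr (- (real n + 1) / 2) \<le> (1 + (norm x)\<^sup>2) powr 0"
      by (intro powr_mono) auto
    also have "\<dots> = 1" by (simp add: add_nonneg_eq_0_iff)
    also have "(1::real) \<le> 2 ^ (n + 1)" by (rule one_le_power) simp
    finally show ?thesis using 0 by simp
  next
    case (Suc j)
    have "\<not> norm x < 2 ^ j" using not_less_Least[of j "\<lambda>k. norm x < 2 ^ k"] Suc by (simp add: k_def)
    then have "2 ^ j \<le> norm x" by simp
    then have "(2 ^ j)\<^sup>2 \<le> (norm x)\<^sup>2" by (rule power_mono) simp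
    then have j: "(2 ^ j)\<^sup>2 \<le> 1 + (norm x)\<^sup>2" by linarith
    have "(1 + (norm x)\<^sup>2) powr (- (real n + 1) / 2) \<le> ((2 ^ j)\<^sup>2) powr (- (real n + 1) / 2)"
      by (rule powr_mono2'[OF _ _ j]) auto
    also have "((2::real) ^ j)\<^sup>2 = (2 ^ j) powr 2" by simp
    also have "(((2::real) ^ j) powr 2) powr (- (real n + 1) / 2) = (2 ^ j) powr (- real (n + 1))"
    proof -
      have "2 * (- (real n + 1) / 2) = - real (n + 1)" by simp
      then show ?thesis by (simp only: powr_powr)
    qed
    also have "\<dots> = 1 / (2 ^ j) ^ (n + 1)" unfolding powr_minus_divide by (subst powr_realpow) auto
    also have "\<dots> = 2 ^ (n + 1) * (1 / 2 ^ (k * (n + 1)))"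
      unfolding Suc by (simp add: power_mult power_add power_mult_distrib)
    finally show ?thesis .
  qed
  then show ?thesis by (intro that[of k]) (use k in auto)
qed

text \<open>The ball of radius 2^k has volume of order 2^(kd) and the function is of order
  2^(-k(d+1)) where k is selected, which leaves a geometric series. Whole balls in place of shells
  only enlarge the majorant.\<close>

lemma powr_decay_integrable:
  "integrable lebesgue (\<lambda>x :: 'a::euclidean_space. (1 + (norm x)\<^sup>2) powr (- (real DIM('a) + 1) / 2))"
proof -
  let ?n = "DIM('a)"
  let ?g = "\<lambda>x :: 'a. (1 + (norm x)\<^sup>2) powr (- (real ?n + 1) / 2)"
  have meas: "?g \<in> borel_measurable lborel" by measurable
  define V where "V = unit_ball_vol ?n"
  have V0: "0 \<le> V" by (simp add: V_def)
  define B where "B k = (2 ^ (?n + 1) * (1 / 2 ^ (k * (?n + 1))) :: real)" for k :: nat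
  have "(\<integral>\<^sup>+x. ennreal (?g x) \<partial>lborel) \<le> (\<integral>\<^sup>+x. (\<Sum>k. ennreal (B k) * indicator (ball (0::'a) (2 ^ k)) x) \<partial>lborel)"
  proof (rule nn_integral_mono)
    fix x :: 'a
    obtain k where k: "x \<in> ball 0 (2 ^ k)" "?g x \<le> B k"
      using powr_decay_dyadic_bound[of x ?n] unfolding B_def by metis
    define F where "F k = ennreal (B k) * indicator (ball (0::'a) (2 ^ k)) x" for k
    have "ennreal (?g x) \<le> F k"
      using k by (simp add: F_def ennreal_leI)
    also have "F k = sum F {k}" by simp
    also have "\<dots> \<le> suminf F" by (rule sum_le_suminf) auto
    also have "\<dots> = (\<Sum>k. ennreal (B k) * indicator (ball (0::'a) (2 ^ k)) x)" by (simp add: F_def[abs_def])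
    finally show "ennreal (?g x) \<le> (\<Sum>k. ennreal (B k) * indicator (ball (0::'a) (2 ^ k)) x)" .
  qed
  also have "\<dots> = (\<Sum>k. \<integral>\<^sup>+x. ennreal (B k) * indicator (ball (0::'a) (2 ^ k)) x \<partial>lborel)"
    by (rule nn_integral_suminf)
      (intro borel_measurable_times_ennreal borel_measurable_const borel_measurable_indicator, simp)
  also have "\<dots> = (\<Sum>k. ennreal (2 ^ (?n + 1) * V * (1 / 2) ^ k))"
  proof (intro arg_cong[where f = suminf] ext)
    fix k :: nat
    have "(\<integral>\<^sup>+x. ennreal (B k) * indicator (ball (0::'a) (2 ^ k)) x \<partial>lborel) = ennreal (B k) * ennreal (V * (2 ^ k) ^ ?n)"
      by (simp add: nn_integral_cmult_indicator emeasure_ball V_def)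
    also have "\<dots> = ennreal (B k * (V * (2 ^ k) ^ ?n))"
      using V0 by (subst ennreal_mult) (auto simp: B_def)
    also have "B k * (V * (2 ^ k) ^ ?n) = 2 ^ (?n + 1) * V * (1 / 2) ^ k"
      by (simp add: B_def power_mult power_add power_mult_distrib power_divide field_simps)
    finally show "(\<integral>\<^sup>+x. ennreal (B k) * indicator (ball (0::'a) (2 ^ k)) x \<partial>lborel) = ennreal (2 ^ (?n + 1) * V * (1 / 2) ^ k)" .
  qed
  also have "\<dots> < \<infinity>"
  proof -
    have "summable (\<lambda>k. 2 ^ (?n + 1) * V * (1 / 2 :: real) ^ k)"
      by (intro summable_mult summable_geometric) simp
    then show ?thesis using V0 by (subst suminf_ennreal2) auto
  qed
  finally have "integrable lborel ?g" using meas by (intro integrableI_nonneg) auto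
  then show ?thesis using meas by (simp add: integrable_completion)
qed

section \<open>The kernel and the density of the theorem\<close>

lemma NTK_eq_zonal_kernel: "NTK L = zonal_kernel (ntk_profile L)"
proof (intro ext)
  fix x x' :: 'a
  have "(x, 1::real) \<bullet> (x', 1) / (lift_norm x * lift_norm x') = direction x \<bullet> direction x'"
    by (simp add: inner_direction)
  then show "NTK L x x' = zonal_kernel (ntk_profile L) x x'"
    unfolding NTK_def zonal_kernel_def Let_def lift_norm_def[symmetric] by (simp add: ntk_profile_def)
qed

lemma riemann_density_measurable:
  fixes p :: "'a::euclidean_space \<Rightarrow> real"
  assumes "\<forall>a b. riemann_integrable_on p (cbox a b)"
  shows "p \<in> borel_measurable lebesgue"
proof (rule integrable_cube_exhaustion_measurable)
  fix n :: nat
  obtain I where "(p has_integral I) (cbox (- real n *\<^sub>R One) (real n *\<^sub>R One))"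
    by (rule riemann_integrable_imp_has_integral[OF assms[rule_format]])
  then show "p integrable_on cbox (- real n *\<^sub>R One) (real n *\<^sub>R One)" by (auto simp: integrable_on_def)
qed

text \<open>If there were no such box, the integral over every cube would vanish by
  \<open>riemann_positive_integral_box\<close>; then p = 0 almost everywhere, against total mass
  1.\<close>

lemma riemann_density_bounded_below_on_box:
  fixes p :: "'a::euclidean_space \<Rightarrow> real"
  assumes p0: "\<forall>x. 0 \<le> p x" and prob: "prob_space (density lebesgue (\<lambda>x. ennreal (p x)))"
    and riem: "\<forall>a b. riemann_integrable_on p (cbox a b)"
  shows "\<exists>c0>0. \<exists>u v. box u v \<noteq> {} \<and> (\<forall>x\<in>cbox u v. c0 \<le> p x)"
proof (rule ccontr)
  assume neg: "\<not> ?thesis"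
  have meas: "p \<in> borel_measurable lebesgue" by (rule riemann_density_measurable[OF riem])
  let ?S = "\<lambda>n::nat. cbox (- real n *\<^sub>R One) (real n *\<^sub>R One) :: 'a set"
  have zero: "(\<integral>\<^sup>+x. ennreal (p x) * indicator (?S n) x \<partial>lebesgue) = 0" for n
  proof -
    obtain I where I: "(p has_integral I) (?S n)"
      "\<forall>e>0. \<exists>\<delta>>0. \<forall>D. D tagged_division_of (?S n) \<and> (\<lambda>x. ball x \<delta>) fine D \<longrightarrow>
        \<bar>(\<Sum>(x, K)\<in>D. Henstock_Kurzweil_Integration.content K * p x) - I\<bar> < e"
      by (rule riemann_integrable_imp_has_integral[OF riem[rule_format, of "- real n *\<^sub>R One" "real n *\<^sub>R One"]])
    have "\<not> 0 < I" using riemann_positive_integral_box[of p I, OF _ _ I(2)] p0 neg by blast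
    moreover have "0 \<le> I" using has_integral_nonneg[OF I(1)] p0 by blast
    ultimately have I0: "(p has_integral 0) (?S n)" using I(1) by simp
    have "(\<integral>\<^sup>+x. ennreal (p x) * indicator (?S n) x \<partial>lborel) = ennreal 0"
      by (rule nn_integral_has_integral_lebesgue'[OF _ I0]) (use p0 in auto)
    then show ?thesis by (simp add: nn_integral_completion)
  qed
  have "AE x in lebesgue. \<forall>n. ennreal (p x) * indicator (?S n) x = 0"
  proof (subst AE_all_countable, intro allI)
    fix n
    have "(\<lambda>x. ennreal (p x) * indicator (?S n) x) \<in> borel_measurable lebesgue"
      using meas by (intro borel_measurable_times_ennreal borel_measurable_indicator measurable_compose[OF meas]) auto
    from nn_integral_0_iff_AE[OF this] zero[of n]
    show "AE x in lebesgue. ennreal (p x) * indicator (?S n) x = 0" by simp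
  qed
  then have "AE x in lebesgue. ennreal (p x) = 0"
  proof eventually_elim
    case (elim x)
    obtain n :: nat where n: "norm x \<le> n" using real_arch_simple by blast
    have "- real n \<le> x \<bullet> b \<and> x \<bullet> b \<le> real n" if "b \<in> Basis" for b
      using Basis_le_norm[OF that, of x] n by linarith
    then have "x \<in> ?S n" by (simp add: mem_box)
    then show ?case using elim[rule_format, of n] by simp
  qed
  then have "emeasure (density lebesgue (\<lambda>x. ennreal (p x))) UNIV = 0"
    using meas nn_integral_0_iff_AE[of "\<lambda>x. ennreal (p x)" lebesgue]
    by (subst emeasure_density) auto
  then show False using prob_space.emeasure_space_1[OF prob] by simp
qed

text \<open>The squared weight is 1 + |x|^2, so it lowers the decay exponent from (d+3)/2 to
  (d+1)/2, which is still integrable on R^d.\<close>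

lemma density_moment_integrable:
  fixes p :: "'a::euclidean_space \<Rightarrow> real"
  assumes meas: "p \<in> borel_measurable lebesgue" and p0: "\<forall>x. 0 \<le> p x"
    and bound: "\<forall>x. p x \<le> C * (1 + (norm x)\<^sup>2) powr (- (real DIM('a) + 3) / 2)"
  shows "integrable (density lebesgue (\<lambda>x. ennreal (p x))) (\<lambda>x. (lift_norm x)\<^sup>2)"
proof -
  have wm: "(\<lambda>x :: 'a. (lift_norm x)\<^sup>2) \<in> borel_measurable lebesgue"
  proof -
    have "(\<lambda>x :: 'a. (lift_norm x)\<^sup>2) \<in> borel_measurable lborel"
      using borel_measurable_continuous_onI[of "\<lambda>x :: 'a. (lift_norm x)\<^sup>2"] by (simp add: continuous_intros)
    then show ?thesis by (rule measurable_completion)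
  qed
  have "integrable lebesgue (\<lambda>x. p x *\<^sub>R (lift_norm x)\<^sup>2)"
  proof (rule Bochner_Integration.integrable_bound)
    show "integrable lebesgue (\<lambda>x :: 'a. C * (1 + (norm x)\<^sup>2) powr (- (real DIM('a) + 1) / 2))"
      by (intro integrable_mult_right powr_decay_integrable)
    show "(\<lambda>x. p x *\<^sub>R (lift_norm x)\<^sup>2) \<in> borel_measurable lebesgue"
      using meas wm by simp
    have "norm (p x *\<^sub>R (lift_norm x)\<^sup>2) \<le> norm (C * (1 + (norm x)\<^sup>2) powr (- (real DIM('a) + 1) / 2))" for x
    proof -
      have pos: "0 < 1 + (norm x)\<^sup>2" by (simp add: add_pos_nonneg)
      have "p x * (1 + (norm x)\<^sup>2) \<le> C * (1 + (norm x)\<^sup>2) powr (- (real DIM('a) + 3) / 2) * (1 + (norm x)\<^sup>2)"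
        using bound pos by (intro mult_right_mono) auto
      also have "\<dots> = C * ((1 + (norm x)\<^sup>2) powr (- (real DIM('a) + 3) / 2) * (1 + (norm x)\<^sup>2) powr 1)"
        using pos by simp
      also have "\<dots> = C * (1 + (norm x)\<^sup>2) powr (- (real DIM('a) + 1) / 2)"
        unfolding powr_add[symmetric] by (simp add: field_simps)
      finally have "p x * (1 + (norm x)\<^sup>2) \<le> C * (1 + (norm x)\<^sup>2) powr (- (real DIM('a) + 1) / 2)" .
      moreover have "0 \<le> p x * (1 + (norm x)\<^sup>2)" using p0 pos by simp
      ultimately show ?thesis unfolding lift_norm_square by simp
    qed
    then show "AE x in lebesgue. norm (p x *\<^sub>R (lift_norm x)\<^sup>2) \<le> norm (C * (1 + (norm x)\<^sup>2) powr (- (real DIM('a) + 1) / 2))"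
      by (rule AE_I2)
  qed
  then show ?thesis
    using meas wm p0 by (subst integrable_density) auto
qed

lemma density_measure_ge:
  fixes p :: "'a::euclidean_space \<Rightarrow> real"
  assumes meas: "p \<in> borel_measurable lebesgue" and fin: "finite_measure (density lebesgue (\<lambda>x. ennreal (p x)))"
    and c0: "0 < c0" and ge: "\<And>x. x \<in> cbox u v \<Longrightarrow> c0 \<le> p x"
  shows "c0 * Henstock_Kurzweil_Integration.content (cbox u v) \<le> measure (density lebesgue (\<lambda>x. ennreal (p x))) (cbox u v)"
proof -
  let ?\<mu> = "density lebesgue (\<lambda>x. ennreal (p x))"
  have "ennreal (c0 * Henstock_Kurzweil_Integration.content (cbox u v)) = ennreal c0 * emeasure lebesgue (cbox u v)"
  proof -
    have "emeasure lebesgue (cbox u v) = ennreal (Henstock_Kurzweil_Integration.content (cbox u v))"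
      using emeasure_lborel_cbox_finite[of u v] by (simp add: emeasure_eq_ennreal_measure less_top)
    then show ?thesis using c0 by (simp add: ennreal_mult)
  qed
  also have "\<dots> = (\<integral>\<^sup>+x. ennreal c0 * indicator (cbox u v) x \<partial>lebesgue)"
    by (rule nn_integral_cmult_indicator[symmetric]) simp
  also have "\<dots> \<le> (\<integral>\<^sup>+x. ennreal (p x) * indicator (cbox u v) x \<partial>lebesgue)"
    using ge by (intro nn_integral_mono) (auto simp: indicator_def ennreal_leI)
  also have "\<dots> = emeasure ?\<mu> (cbox u v)" using meas by (subst emeasure_density) auto
  also have "\<dots> = ennreal (measure ?\<mu> (cbox u v))" by (rule finite_measure.emeasure_eq_measure[OF fin])
  finally show ?thesis by (simp add: ennreal_le_iff)
qed

theorem theorem10: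
  fixes p :: "real^'d \<Rightarrow> real" and \<mu> :: "(real^'d) measure" and L :: nat and C :: real
  assumes "L \<ge> 2"
    and "\<mu> = density lebesgue (\<lambda>x. ennreal (p x))"
    and "\<forall>x. p x \<ge> 0"
    and "prob_space \<mu>"
    and "\<forall>a b. riemann_integrable_on p (cbox a b)"
    and "\<forall>x. p x \<le> C * (1 + (norm x)\<^sup>2) powr (- (real CARD('d) + 3) / 2)"
  shows "\<exists>c1 c2. c1 > 0 \<and> c2 > 0 \<and> (\<forall>i\<ge>1.
           c1 * real i powr (- (real CARD('d) + 1) / real CARD('d)) \<le> int_op_eigenvalue (NTK L) \<mu> i \<and>
           int_op_eigenvalue (NTK L) \<mu> i \<le> c2 * real i powr (- (real CARD('d) + 1) / real CARD('d)))"
proof -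
  let ?d = "CARD('d)"
  note p0 = assms(3) and riem = assms(5)
  have meas: "p \<in> borel_measurable lebesgue" by (rule riemann_density_measurable[OF riem])
  obtain a \<kappa> where a: "0 < \<kappa>" "nonneg_powser a (ntk_profile L)" "\<forall>k\<ge>1. a (2 * k) \<ge> \<kappa> * real k powr (-3/2)"
    using ntk_profile_nonneg_powser[of L] assms(1) by auto
  interpret prob_space \<mu> by (rule assms(4))
  have sets: "sets \<mu> = sets lebesgue" and space: "space \<mu> = UNIV" by (simp_all add: assms(2))
  have borel_sub: "X \<in> sets \<mu>" if "X \<in> sets borel" for X using that unfolding sets by simp
  interpret zonal_prob_cart \<mu> a "ntk_profile L"
  proof unfold_locales
    show "space \<mu> = UNIV" by (rule space)
    show "(\<lambda>x. x) \<in> borel_measurable \<mu>"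
      by (rule measurableI) (auto simp: space borel_sub)
    show "integrable \<mu> (\<lambda>x. (lift_norm x)\<^sup>2)"
      unfolding assms(2) using density_moment_integrable[OF meas p0, of C] assms(6) by simp
  qed (rule a(2))
  obtain c0 u v where c0: "0 < c0" and uv: "box u v \<noteq> {}" and ge: "\<And>x. x \<in> cbox u v \<Longrightarrow> c0 \<le> p x"
    using riemann_density_bounded_below_on_box[OF p0 assms(4)[unfolded assms(2)] riem] by blast
  have uv_less: "u $ i < v $ i" for i using uv by (simp add: interval_ne_empty_cart)
  \<comment> \<open>A cube inside the box, of side at most 1 as \<open>eigenvalue_lower_rate\<close>
    demands.\<close>
  define \<rho> where "\<rho> = min 1 (Min (range (\<lambda>i. v $ i - u $ i)))"
  have \<rho>: "0 < \<rho>" "\<rho> \<le> 1" using uv_less by (auto simp: \<rho>_def)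
  have \<rho>_le: "u $ i + \<rho> \<le> v $ i" for i
  proof -
    have "\<rho> \<le> v $ i - u $ i" unfolding \<rho>_def by (rule min.coboundedI2) (rule Min_le, auto)
    then show ?thesis by simp
  qed
  have cube: "cbox u (\<chi> i. u $ i + \<rho>) \<subseteq> cbox u v"
  proof
    fix x assume "x \<in> cbox u (\<chi> i. u $ i + \<rho>)"
    then have "u $ i \<le> x $ i \<and> x $ i \<le> v $ i" for i
      using order_trans[OF _ \<rho>_le[of i]] by (auto simp: mem_box_cart)
    then show "x \<in> cbox u v" by (simp add: mem_box_cart)
  qed
  have mass: "c0 * Henstock_Kurzweil_Integration.content (cbox u' v') \<le> measure \<mu> (cbox u' v')"
    if "cbox u' v' \<subseteq> cbox u (\<chi> i. u $ i + \<rho>)" for u' v'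
    unfolding assms(2)
    by (rule density_measure_ge[OF meas _ c0]) (use that cube ge finite_measure_axioms assms(2) in auto)
  obtain A where A: "0 < A"
    "\<forall>m\<ge>1. \<forall>i\<le>m ^ ?d. A / real m ^ (?d + 1) \<in> eigenvalue_bounds (zonal_kernel (ntk_profile L)) \<mu> i"
    using eigenvalue_lower_rate[OF \<rho> c0 _ mass a(1)] a(3) borel_sub by blast
  have holder: "ntk_profile L 1 - ntk_profile L w \<le> ((real L + 1) * (real L + 2)) * sqrt (1 - w)"
    if "\<bar>w\<bar> \<le> 1" for w
    using ntk_profile_half_holder[OF that, of L] by (simp add: algebra_simps)
  have "0 \<le> (real L + 1) * (real L + 2)" by simp
  from eigenvalue_upper_rate[OF borel_sub this holder]
  obtain B where B: "0 < B" "\<forall>i\<ge>1. \<forall>t\<in>eigenvalue_bounds (zonal_kernel (ntk_profile L)) \<mu> i.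
      t \<le> B * real i powr (- (real ?d + 1) / real ?d)" by blast
  \<comment> \<open>The power of 2 accounts for rounding i^(1/d) up to m, which at most doubles
    it.\<close>
  define c1 where "c1 = A / 2 ^ (?d + 1)"
  have "c1 * real i powr (- (real ?d + 1) / real ?d) \<le> int_op_eigenvalue (NTK L) \<mu> i \<and>
        int_op_eigenvalue (NTK L) \<mu> i \<le> B * real i powr (- (real ?d + 1) / real ?d)" if i: "i \<ge> 1" for i
  proof
    show "int_op_eigenvalue (NTK L) \<mu> i \<le> B * real i powr (- (real ?d + 1) / real ?d)"
      unfolding NTK_eq_zonal_kernel using B i by (intro int_op_eigenvalue_le) auto
    define y where "y = real i powr (1 / ?d)"
    have y1: "1 \<le> y" unfolding y_def using i by (intro ge_one_powr_ge_zero) auto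
    have yd: "y ^ ?d = i"
    proof -
      have "y ^ ?d = y powr ?d" using y1 by (simp add: powr_realpow)
      also have "\<dots> = real i powr 1" unfolding y_def powr_powr by simp
      finally show ?thesis using i by simp
    qed
    define m where "m = nat \<lceil>y\<rceil>"
    have m: "y \<le> real m" "real m \<le> y + 1" using y1 unfolding m_def by linarith+
    have m1: "1 \<le> m" using m(1) y1 by linarith
    have "real i \<le> real m ^ ?d" unfolding yd[symmetric] using m y1 by (intro power_mono) auto
    then have "i \<le> m ^ ?d" by (simp only: of_nat_power[symmetric] of_nat_le_iff)
    then have mem: "A / real m ^ (?d + 1) \<in> eigenvalue_bounds (NTK L) \<mu> i"
      unfolding NTK_eq_zonal_kernel using A(2) m1 by blast
    have "real i powr (- (real ?d + 1) / real ?d) = 1 / y ^ (?d + 1)"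
    proof -
      have "y ^ (?d + 1) = y powr (real ?d + 1)" using y1 powr_realpow[of y "?d + 1"] by (simp add: add.commute)
      also have "\<dots> = real i powr ((real ?d + 1) / ?d)" unfolding y_def powr_powr by simp
      finally show ?thesis by (simp add: powr_minus_divide[symmetric] minus_divide_left)
    qed
    then have "c1 * real i powr (- (real ?d + 1) / real ?d) = A / (2 * y) ^ (?d + 1)"
      by (simp add: c1_def power_mult_distrib)
    also have "\<dots> \<le> A / real m ^ (?d + 1)"
      using A(1) m m1 y1 by (intro divide_left_mono power_mono mult_pos_pos) auto
    also have "\<dots> \<le> int_op_eigenvalue (NTK L) \<mu> i"
      using B i by (intro int_op_eigenvalue_ge[OF mem]) (auto simp: NTK_eq_zonal_kernel)
    finally show "c1 * real i powr (- (real ?d + 1) / real ?d) \<le> int_op_eigenvalue (NTK L) \<mu> i" .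
  qed
  moreover have "0 < c1" using A by (simp add: c1_def)
  ultimately show ?thesis using B(1) by blast
qed

end
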